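(* Let $M$ be a smooth manifold, let $\mathbf{A}$ be a Weil algebra, and let $M^{\mathbf{A}}$ be the Weil bundle of $M$. Then the homotopy groups satisfy $$\pi_k(M^{\mathbf{A}})\cong\pi_k(M)\qquad\text{for all }k\ge 0$$ (for $k=0$ this is a bijection of sets of path components; for $k\geq 1$ the base points in $M^{\mathbf{A}}$ and $M$ correspond under the projection $\pi_{\mathbf{A}}:M^{\mathbf{A}}\to M$).
   Context: A Weil algebra is a finite-dimensional, commutative, associative, unital $\mathbb{R}$-algebra $\mathbf{A}=\mathbb{R}\oplus\mathcal{A}$, where $\mathcal{A}$ is a maximal ideal with $\mathcal{A}^{r+1}=0$ for some $r\ge 1$. For a smooth manifold $M$ and $x\in M$, $M^{\mathbf{A}}_x$ is the set of $\mathbb{R}$-algebra morphisms $\xi:C^\infty(M)\to\mathbf{A}$ with $\mathrm{pr}_{\mathbb{R}}\circ\xi=\mathrm{ev}_x$, where $\mathrm{ev}_x(f)=f(x)$ and $\mathrm{pr}_{\mathbb{R}}:\mathbf{A}\to\mathbb{R}$ is the projection along $\mathcal{A}$. The Weil bundle is $M^{\mathbf{A}}=\bigcup_{x\in M}M^{\mathbf{A}}_x$, with projection $\pi_{\mathbf{A}}:M^{\mathbf{A}}\to M$ sending $\xi\in M^{\mathbf{A}}_x$ to $x$. It is a smooth manifold: for a chart $(U,\phi_1,\dots,\phi_m)$ of $M$ and a basis $\alpha_1=1_{\mathbf{A}},\alpha_2,\dots,\alpha_l$ of $\mathbf{A}$, write $\xi(\phi_i)=\sum_j x_{ij}(\xi)\alpha_j$;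 the functions $x_{ij}$ form a chart on $\pi_{\mathbf{A}}^{-1}(U)$. $M^{\mathbf{A}}$ carries its manifold topology. *)

theory Defs
  imports "HOL-Analysis.Analysis" "HOL-Algebra.Group"
begin

section \<open>Smooth manifolds\<close>

text \<open>
  The model space of an \<open>m\<close>-dimensional manifold is \<^const>\<open>Euclidean_space\<close> \<open>m\<close>, whose points are
  the sequences vanishing from index \<open>m\<close> on. The dimension is thus a natural number, and \<open>m = 0\<close>
  is allowed. In \<open>Ck_on\<close> and \<open>smooth_on\<close> the set \<open>S\<close> is meant to be open in
  \<^const>\<open>Euclidean_space\<close> \<open>m\<close>: smoothness is existence and continuity of all iterated partial
  derivatives, and only the values of \<open>f\<close> on \<open>S\<close> matter.
\<close>

fun Ck_on :: "nat \<Rightarrow> nat \<Rightarrow> (nat \<Rightarrow> real) set \<Rightarrow> ((nat \<Rightarrow> real) \<Rightarrow> real) \<Rightarrow> bool" where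
  "Ck_on 0 m S f \<longleftrightarrow> continuous_map (subtopology (Euclidean_space m) S) euclideanreal f"
| "Ck_on (Suc k) m S f \<longleftrightarrow>
     continuous_map (subtopology (Euclidean_space m) S) euclideanreal f \<and>
     (\<forall>i<m. \<exists>g. (\<forall>x\<in>S. ((\<lambda>t. f (x(i := t))) has_real_derivative g x) (at (x i))) \<and> Ck_on k m S g)"

definition smooth_on :: "nat \<Rightarrow> (nat \<Rightarrow> real) set \<Rightarrow> ((nat \<Rightarrow> real) \<Rightarrow> real) \<Rightarrow> bool" where
  "smooth_on m S f \<longleftrightarrow> (\<forall>k. Ck_on k m S f)"

type_synonym 'a chart = "'a set \<times> ('a \<Rightarrow> nat \<Rightarrow> real)"

definition is_chart :: "nat \<Rightarrow> 'a topology \<Rightarrow> 'a chart \<Rightarrow> bool" where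
  "is_chart m M = (\<lambda>(U, \<phi>).
     openin M U \<and> openin (Euclidean_space m) (\<phi> ` U) \<and>
     homeomorphic_map (subtopology M U) (subtopology (Euclidean_space m) (\<phi> ` U)) \<phi>)"

definition smoothly_compatible :: "nat \<Rightarrow> 'a chart \<Rightarrow> 'a chart \<Rightarrow> bool" where
  "smoothly_compatible m = (\<lambda>(U, \<phi>) (V, \<psi>).
     \<forall>i<m. smooth_on m (\<phi> ` (U \<inter> V)) (\<lambda>p. \<psi> (inv_into U \<phi> p) i))"

text \<open>The atlas \<open>\<C>\<close> is not required to be maximal; maximal atlases are a special case.\<close>

definition smooth_manifold :: "nat \<Rightarrow> 'a topology \<Rightarrow> 'a chart set \<Rightarrow> bool" where
  "smooth_manifold m M \<C> \<longleftrightarrow>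
     Hausdorff_space M \<and> second_countable M \<and>
     (\<forall>c\<in>\<C>. is_chart m M c) \<and>
     (\<Union>(U, \<phi>)\<in>\<C>. U) = topspace M \<and>
     (\<forall>c\<in>\<C>. \<forall>d\<in>\<C>. smoothly_compatible m c d)"

text \<open>
  Real functions on \<open>M\<close> are represented by functions on the whole type that vanish outside
  \<^term>\<open>topspace M\<close>. The algebra operations of \<open>C\<^sup>\<infinity>(M)\<close> are then the pointwise ones, and its unit
  is the indicator function of \<^term>\<open>topspace M\<close>.
\<close>

definition smooth_functions :: "nat \<Rightarrow> 'a topology \<Rightarrow> 'a chart set \<Rightarrow> ('a \<Rightarrow> real) set" where
  "smooth_functions m M \<C> =
     {f. (\<forall>x. x \<notin> topspace M \<longrightarrow> f x = 0) \<and>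
         (\<forall>(U, \<phi>)\<in>\<C>. smooth_on m (\<phi> ` U) (\<lambda>p. f (inv_into U \<phi> p)))}"

section \<open>Weil algebras\<close>

definition algebra_ideal :: "'b::{comm_ring_1,real_algebra_1} set \<Rightarrow> bool" where
  "algebra_ideal I \<longleftrightarrow> subspace I \<and> (\<forall>a. \<forall>x\<in>I. a * x \<in> I)"

definition maximal_algebra_ideal :: "'b::{comm_ring_1,real_algebra_1} set \<Rightarrow> bool" where
  "maximal_algebra_ideal I \<longleftrightarrow>
     algebra_ideal I \<and> I \<noteq> UNIV \<and>
     (\<forall>J. algebra_ideal J \<longrightarrow> I \<subseteq> J \<longrightarrow> J = I \<or> J = UNIV)"

definition ideal_power :: "'b::{comm_ring_1,real_algebra_1} set \<Rightarrow> nat \<Rightarrow> 'b set" where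
  "ideal_power I n = span {prod_list xs | xs. length xs = n \<and> set xs \<subseteq> I}"

definition algebra_basis :: "'b::{comm_ring_1,real_algebra_1} set \<Rightarrow> bool" where
  "algebra_basis B \<longleftrightarrow> finite B \<and> independent B \<and> span B = UNIV"

text \<open>
  The algebra is the whole type \<open>'b\<close>, and \<open>N\<close> is its ideal \<open>\<A>\<close>. The third conjunct says that
  \<open>'b\<close> is the direct sum of the scalars and \<open>N\<close>.
\<close>

definition weil_algebra :: "'b::{comm_ring_1,real_algebra_1} set \<Rightarrow> bool" where
  "weil_algebra N \<longleftrightarrow>
     (\<exists>B::'b set. algebra_basis B) \<and>
     maximal_algebra_ideal N \<and>
     (\<forall>a. \<exists>!c::real. a - of_real c \<in> N) \<and>
     (\<exists>r\<ge>1. ideal_power N (r + 1) = {0})"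

definition real_part :: "'b::{comm_ring_1,real_algebra_1} set \<Rightarrow> 'b \<Rightarrow> real" where
  "real_part N a = (THE c. a - of_real c \<in> N)"

section \<open>The Weil bundle\<close>

text \<open>
  A morphism is taken to be extensional, so that it is determined by its values on \<open>C\<^sup>\<infinity>(M)\<close>.
\<close>

definition algebra_morphisms ::
    "nat \<Rightarrow> 'a topology \<Rightarrow> 'a chart set \<Rightarrow> (('a \<Rightarrow> real) \<Rightarrow> 'b::{comm_ring_1,real_algebra_1}) set" where
  "algebra_morphisms m M \<C> =
     {\<xi> \<in> extensional (smooth_functions m M \<C>).
        (\<forall>f\<in>smooth_functions m M \<C>. \<forall>g\<in>smooth_functions m M \<C>.
           \<xi> (\<lambda>x. f x + g x) = \<xi> f + \<xi> g \<and> \<xi> (\<lambda>x. f x * g x) = \<xi> f * \<xi> g) \<and>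
        (\<forall>c. \<forall>f\<in>smooth_functions m M \<C>. \<xi> (\<lambda>x. c * f x) = c *\<^sub>R \<xi> f) \<and>
        \<xi> (indicator (topspace M)) = 1}"

definition weil_fibre ::
    "nat \<Rightarrow> 'a topology \<Rightarrow> 'a chart set \<Rightarrow> 'b set \<Rightarrow> 'a
      \<Rightarrow> (('a \<Rightarrow> real) \<Rightarrow> 'b::{comm_ring_1,real_algebra_1}) set" where
  "weil_fibre m M \<C> N x =
     {\<xi> \<in> algebra_morphisms m M \<C>. \<forall>f\<in>smooth_functions m M \<C>. real_part N (\<xi> f) = f x}"

definition weil_bundle ::
    "nat \<Rightarrow> 'a topology \<Rightarrow> 'a chart set \<Rightarrow> 'b set
      \<Rightarrow> (('a \<Rightarrow> real) \<Rightarrow> 'b::{comm_ring_1,real_algebra_1}) set" where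
  "weil_bundle m M \<C> N = (\<Union>x\<in>topspace M. weil_fibre m M \<C> N x)"

definition weil_proj ::
    "nat \<Rightarrow> 'a topology \<Rightarrow> 'a chart set \<Rightarrow> 'b set
      \<Rightarrow> (('a \<Rightarrow> real) \<Rightarrow> 'b::{comm_ring_1,real_algebra_1}) \<Rightarrow> 'a" where
  "weil_proj m M \<C> N \<xi> = (THE x. x \<in> topspace M \<and> \<xi> \<in> weil_fibre m M \<C> N x)"

text \<open>
  A chart component \<open>\<phi>\<^sub>i\<close> is only defined on \<open>U\<close>, so \<open>\<xi>(\<phi>\<^sub>i)\<close> abbreviates \<open>\<xi> f\<close> for any global
  smooth function \<open>f\<close> that agrees with \<open>\<phi>\<^sub>i\<close> near the base point of \<open>\<xi>\<close>; the value does not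
  depend on \<open>f\<close>, since \<open>\<xi>\<close> only depends on germs at its base point.
\<close>

definition weil_eval ::
    "nat \<Rightarrow> 'a topology \<Rightarrow> 'a chart set \<Rightarrow> 'b set
      \<Rightarrow> (('a \<Rightarrow> real) \<Rightarrow> 'b::{comm_ring_1,real_algebra_1}) \<Rightarrow> ('a \<Rightarrow> real) \<Rightarrow> 'b" where
  "weil_eval m M \<C> N \<xi> g =
     (THE a. \<exists>f\<in>smooth_functions m M \<C>.
        (\<exists>W. openin M W \<and> weil_proj m M \<C> N \<xi> \<in> W \<and> (\<forall>y\<in>W. f y = g y)) \<and> a = \<xi> f)"

definition weil_coords ::
    "nat \<Rightarrow> 'a topology \<Rightarrow> 'a chart set \<Rightarrow> 'b set \<Rightarrow> 'b set \<Rightarrow> ('a \<Rightarrow> nat \<Rightarrow> real)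
      \<Rightarrow> (('a \<Rightarrow> real) \<Rightarrow> 'b::{comm_ring_1,real_algebra_1}) \<Rightarrow> nat \<times> 'b \<Rightarrow> real" where
  "weil_coords m M \<C> N B \<phi> \<xi> =
     (\<lambda>(i, \<alpha>)\<in>{..<m} \<times> B. representation B (weil_eval m M \<C> N \<xi> (\<lambda>y. \<phi> y i)) \<alpha>)"

text \<open>
  The manifold topology is generated by the domains of the charts \<^const>\<open>weil_coords\<close>, i.e. the
  sets \<open>\<pi>\<^sub>A\<^sup>-\<^sup>1(U)\<close>, and by the preimages in them of the open subsets of \<open>\<real>\<^sup>m\<^sup>l\<close>. Here \<open>\<real>\<^sup>m\<^sup>l\<close> is the
  product of copies of the real line indexed by \<open>{..<m} \<times> B\<close>.
\<close>

definition weil_topology ::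
    "nat \<Rightarrow> 'a topology \<Rightarrow> 'a chart set \<Rightarrow> 'b set
      \<Rightarrow> (('a \<Rightarrow> real) \<Rightarrow> 'b::{comm_ring_1,real_algebra_1}) topology" where
  "weil_topology m M \<C> N = topology_generated_by
     {{\<xi> \<in> weil_bundle m M \<C> N. weil_proj m M \<C> N \<xi> \<in> U \<and> weil_coords m M \<C> N B \<phi> \<xi> \<in> V} | U \<phi> B V.
        (U, \<phi>) \<in> \<C> \<and> algebra_basis B \<and> 1 \<in> B \<and>
        openin (product_topology (\<lambda>_. euclideanreal) ({..<m} \<times> B)) V}"

section \<open>Homotopy groups\<close>

definition cube :: "nat \<Rightarrow> (nat \<Rightarrow> real) topology" where
  "cube k = subtopology (Euclidean_space k) {x. \<forall>i<k. 0 \<le> x i \<and> x i \<le> 1}"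

definition cube_boundary :: "nat \<Rightarrow> (nat \<Rightarrow> real) set" where
  "cube_boundary k = {x \<in> topspace (cube k). \<exists>i<k. x i = 0 \<or> x i = 1}"

definition based_cubes :: "nat \<Rightarrow> 'c topology \<Rightarrow> 'c \<Rightarrow> ((nat \<Rightarrow> real) \<Rightarrow> 'c) set" where
  "based_cubes k X x0 = {f. continuous_map (cube k) X f \<and> (\<forall>x\<in>cube_boundary k. f x = x0)}"

definition cube_homotopy ::
    "nat \<Rightarrow> 'c topology \<Rightarrow> 'c \<Rightarrow> (((nat \<Rightarrow> real) \<Rightarrow> 'c) \<times> ((nat \<Rightarrow> real) \<Rightarrow> 'c)) set" where
  "cube_homotopy k X x0 =
     {(f, g). homotopic_with (\<lambda>h. \<forall>x\<in>cube_boundary k. h x = x0) (cube k) X f g}"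

definition cube_concat :: "((nat \<Rightarrow> real) \<Rightarrow> 'c) \<Rightarrow> ((nat \<Rightarrow> real) \<Rightarrow> 'c) \<Rightarrow> (nat \<Rightarrow> real) \<Rightarrow> 'c" where
  "cube_concat f g = (\<lambda>x. if x 0 \<le> 1/2 then f (x(0 := 2 * x 0)) else g (x(0 := 2 * x 0 - 1)))"

text \<open>
  The product of two classes is the class of \<^term>\<open>cube_concat f g\<close> for arbitrary representatives
  \<open>f\<close> and \<open>g\<close>. This is used for \<open>k \<ge> 1\<close> and a base point in \<^term>\<open>topspace X\<close> only; \<open>\<pi>\<^sub>0\<close> is
  \<^const>\<open>path_components_of\<close>.
\<close>

definition homotopy_group :: "nat \<Rightarrow> 'c topology \<Rightarrow> 'c \<Rightarrow> ((nat \<Rightarrow> real) \<Rightarrow> 'c) set monoid" where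
  "homotopy_group k X x0 =
     \<lparr>carrier = based_cubes k X x0 // cube_homotopy k X x0,
      mult = (\<lambda>A B. \<Union>f\<in>A. \<Union>g\<in>B. cube_homotopy k X x0 `` {cube_concat f g}),
      one = cube_homotopy k X x0 `` {\<lambda>_. x0}\<rparr>"

end

theory Submission
  imports Defs
begin

text \<open>
  Over a chart \<open>(U, \<phi>)\<close>, a point \<open>\<xi>\<close> of the Weil bundle over \<open>y\<close> is the same thing as its displacement
  \<open>n\<^sub>i = \<xi>(\<phi>\<^sub>i) - \<phi>\<^sub>i(y)\<close>, an arbitrary vector in \<open>N\<^sup>m\<close>. Every displacement occurs: \<open>D = \<Sum> n\<^sub>i \<partial>\<^sub>i\<close> is a
  derivation with nilpotent coefficients, so \<open>exp D\<close> is a finite sum and multiplicative, and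
  \<open>f \<mapsto> (exp D f)(y)\<close> is a morphism with displacement \<open>n\<close> (\<open>exp_jet_mult\<close>, \<open>jet_point_in_fibre\<close>).
  It is the only one: by Hadamard's lemma, the difference of two morphisms with the same
  displacement takes values in every power of \<open>N\<close>, and a high power is zero (\<open>fibre_eqI\<close>).
  Hence the projection is locally the projection of a product with a vector space
  (\<open>jet_point_continuous\<close>, \<open>displacement_continuous\<close>).

  The fibres are therefore contractible, but not in a canonical way. A change of chart acts on
  displacements by the jets of the transition map, so polynomially, and the straight line between
  two points of a fibre depends on the chart; moreover a Weil algebra need not have a grading along
  which displacements could be rescaled. The homotopies are therefore patched together from
  straight lines in different charts. Let \<open>K\<close> be compact Hausdorff.

  \<^item> Two maps \<open>f\<^sub>0, f\<^sub>1\<close> from \<open>K\<close> to the bundle with the same projection are homotopic relative to the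
    set where they agree (\<open>same_projection_homotopic\<close>): cover \<open>K\<close> by finitely many sets lying over
    charts and, one chart after another, move \<open>f\<^sub>0\<close> towards \<open>f\<^sub>1\<close> along straight lines, damped by a
    Urysohn function. A point that has reached \<open>f\<^sub>1\<close> stays there, because a straight line between
    equal points is constant; after the last chart every point has arrived.

  \<^item> A map from \<open>K\<close> to \<open>M\<close> that is constant on a closed set \<open>L\<close> lifts to the bundle, with any
    prescribed constant value on \<open>L\<close> over the given one (\<open>lift_with_constant_boundary\<close>): start with the
    zero section and bend it near \<open>L\<close>.

  Lifting cubes gives surjectivity of \<open>\<pi>\<^sub>k\<close> of the projection. Lifting a homotopy between the
  projections of two cubes and comparing the ends of the lift with these cubes gives injectivity.
  On path components the zero section provides the inverse.
\<close>

section \<open>Calculus in coordinates\<close>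

declare Ck_on.simps(2) [simp del]

abbreviation model_space :: "nat \<Rightarrow> (nat \<Rightarrow> real) set" where
  "model_space m \<equiv> topspace (Euclidean_space m)"

definition open_box :: "nat \<Rightarrow> (nat \<Rightarrow> real) \<Rightarrow> real \<Rightarrow> (nat \<Rightarrow> real) set" where
  "open_box m a e = {x \<in> model_space m. \<forall>i<m. \<bar>x i - a i\<bar> < e}"

text \<open>
  \<open>Ck_on\<close> only asserts that partial derivatives exist. Naming them makes iterated derivatives
  functions of \<open>f\<close>, as needed to form differential operators; on an open set nothing is lost
  (\<open>Ck_on_Suc_pd\<close>).
\<close>
definition pd :: "nat \<Rightarrow> ((nat \<Rightarrow> real) \<Rightarrow> real) \<Rightarrow> (nat \<Rightarrow> real) \<Rightarrow> real" where
  "pd i f x = deriv (\<lambda>t. f (x(i := t))) (x i)"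

lemma continuous_map_locally:
  assumes "\<And>x. x \<in> topspace X \<Longrightarrow> \<exists>T. openin X T \<and> x \<in> T \<and> continuous_map (subtopology X T) Y f"
  shows "continuous_map X Y f"
  by (rule pasting_lemma[where I = "{T. openin X T \<and> continuous_map (subtopology X T) Y f}"
        and T = "\<lambda>T. T" and f = "\<lambda>_. f"]) (use assms in auto)

lemma Euclidean_space_eq_top_of_set: "Euclidean_space m = top_of_set (model_space m)"
  by (simp add: Euclidean_space_def euclidean_product_topology)

lemma model_space_iff: "x \<in> model_space m \<longleftrightarrow> (\<forall>i\<ge>m. x i = 0)"
  by (simp add: topspace_Euclidean_space)

lemma continuous_map_Euclidean_iff:
  assumes "openin (Euclidean_space m) S"
  shows "continuous_map (subtopology (Euclidean_space m) S) euclidean f \<longleftrightarrow> continuous_on S f"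
proof -
  have "subtopology (Euclidean_space m) S = top_of_set S"
    using openin_subset[OF assms] by (subst Euclidean_space_eq_top_of_set) (simp add: subtopology_subtopology inf_absorb2)
  then show ?thesis by simp
qed

lemma continuous_on_coord: "continuous_on S (\<lambda>x::nat \<Rightarrow> real. x i)"
  by (rule continuous_on_subset[OF continuous_on_product_coordinates subset_UNIV])

lemma openin_open_box: "openin (Euclidean_space m) (open_box m a e)"
proof -
  have "openin (Euclidean_space m) {x \<in> model_space m. \<forall>i\<in>{..<m}. \<bar>x i - a i\<bar> < e}"
  proof -
    have "open {x::nat \<Rightarrow> real. \<bar>x i - a i\<bar> < e}" for i
    proof (rule open_Collect_less)
      show "continuous_on UNIV (\<lambda>x::nat \<Rightarrow> real. \<bar>x i - a i\<bar>)"
        by (rule continuous_on_rabs, rule continuous_on_diff, rule continuous_on_coord, rule continuous_on_const)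
    qed (rule continuous_on_const)
    then have "open (\<Inter>i\<in>{..<m}. {x::nat \<Rightarrow> real. \<bar>x i - a i\<bar> < e})"
      by (intro open_INT ballI) simp_all
    then show ?thesis
      by (subst Euclidean_space_eq_top_of_set) (auto simp: openin_open)
  qed
  then show ?thesis by (simp only: open_box_def Ball_def lessThan_iff)
qed

lemma center_in_open_box: "a \<in> model_space m \<Longrightarrow> e > 0 \<Longrightarrow> a \<in> open_box m a e"
  by (simp add: open_box_def)

lemma openin_contains_box:
  assumes S: "openin (Euclidean_space m) S" and a: "a \<in> S"
  obtains e where "e > 0" "open_box m a e \<subseteq> S"
proof -
  obtain T where T: "openin (powertop_real UNIV) T" "S = T \<inter> {x. \<forall>i\<ge>m. x i = 0}"
    using S by (auto simp: Euclidean_space_def openin_subtopology)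
  obtain X where X: "a \<in> PiE UNIV X" "\<And>i. open (X i)" "PiE UNIV X \<subseteq> T"
    using product_topology_open_contains_basis[OF T(1), of a] a T(2) by auto
  have "\<exists>e>0. \<forall>t. \<bar>t - a i\<bar> < e \<longrightarrow> t \<in> X i" for i
  proof -
    have "a i \<in> X i" using X(1) by auto
    then show ?thesis using X(2)[of i] unfolding open_dist dist_real_def by blast
  qed
  then obtain \<epsilon> where \<epsilon>: "\<And>i. \<epsilon> i > 0" "\<And>i t. \<bar>t - a i\<bar> < \<epsilon> i \<Longrightarrow> t \<in> X i" by metis
  let ?e = "Min (insert 1 (\<epsilon> ` {..<m}))"
  show ?thesis
  proof
    show "?e > 0" using \<epsilon>(1) by (subst Min_gr_iff) auto
    show "open_box m a ?e \<subseteq> S"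
    proof
      fix x assume x: "x \<in> open_box m a ?e"
      have "x i \<in> X i" for i
      proof (cases "i < m")
        case True
        then have "\<bar>x i - a i\<bar> < ?e" using x by (simp add: open_box_def)
        also have "?e \<le> \<epsilon> i" using True by (intro Min_le) auto
        finally show ?thesis by (rule \<epsilon>(2))
      next
        case False
        then have "x i = a i" using x a T(2) by (auto simp: open_box_def model_space_iff)
        then show ?thesis using \<epsilon> by simp
      qed
      then show "x \<in> S" using x X(3) T(2) by (auto simp: open_box_def model_space_iff)
    qed
  qed
qed

lemma eventually_slice_in:
  assumes "openin (Euclidean_space m) S" "x \<in> S" "i < m"
  shows "eventually (\<lambda>t. x(i := t) \<in> S) (nhds (x i))"
proof -
  obtain e where e: "e > 0" "open_box m x e \<subseteq> S" using openin_contains_box assms by blast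
  have x: "x \<in> model_space m" using openin_subset assms by blast
  show ?thesis unfolding eventually_nhds_metric
    using e x assms(3) by (intro exI[of _ e]) (auto simp: open_box_def dist_real_def model_space_iff subset_iff)
qed

lemma Ck_on_imp_continuous_map:
  "Ck_on k m S f \<Longrightarrow> continuous_map (subtopology (Euclidean_space m) S) euclideanreal f"
  by (cases k) (auto simp: Ck_on.simps(2))

lemma Ck_on_imp_continuous_on:
  "openin (Euclidean_space m) S \<Longrightarrow> Ck_on k m S f \<Longrightarrow> continuous_on S f"
  using Ck_on_imp_continuous_map continuous_map_Euclidean_iff by blast

lemma Ck_on_Suc_imp: "Ck_on (Suc k) m S f \<Longrightarrow> Ck_on k m S f"
proof (induction k arbitrary: f)
  case (Suc k)
  show ?case unfolding Ck_on.simps(2)[of k]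
  proof (intro conjI allI impI)
    fix i assume "i < m"
    then obtain g where "\<forall>x\<in>S. ((\<lambda>t. f (x(i := t))) has_real_derivative g x) (at (x i))" "Ck_on (Suc k) m S g"
      using Suc.prems unfolding Ck_on.simps(2)[of "Suc k"] by blast
    then show "\<exists>g. (\<forall>x\<in>S. ((\<lambda>t. f (x(i := t))) has_real_derivative g x) (at (x i))) \<and> Ck_on k m S g"
      using Suc.IH by blast
  qed (rule Ck_on_imp_continuous_map[OF Suc.prems])
qed (simp add: Ck_on.simps(2))

lemma Ck_on_cong:
  assumes S: "openin (Euclidean_space m) S" and eq: "\<And>x. x \<in> S \<Longrightarrow> f x = g x" and f: "Ck_on k m S f"
  shows "Ck_on k m S g"
proof -
  have c: "continuous_map (subtopology (Euclidean_space m) S) euclideanreal g"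
    by (rule continuous_map_eq[OF Ck_on_imp_continuous_map[OF f]]) (simp add: eq)
  show ?thesis
  proof (cases k)
    case (Suc n)
    have "((\<lambda>t. g (x(i := t))) has_real_derivative d) (at (x i))"
      if "((\<lambda>t. f (x(i := t))) has_real_derivative d) (at (x i))" "x \<in> S" "i < m" for x d i
    proof -
      have "eventually (\<lambda>t. f (x(i := t)) = g (x(i := t))) (nhds (x i))"
        using eventually_slice_in[OF S that(2,3)] by eventually_elim (rule eq)
      from DERIV_cong_ev[OF refl this refl] show ?thesis using that(1) by blast
    qed
    then show ?thesis using f c unfolding Suc Ck_on.simps(2) by meson
  qed (use c in simp)
qed

lemma Ck_on_Suc_pd:
  assumes S: "openin (Euclidean_space m) S"
  shows "Ck_on (Suc k) m S f \<longleftrightarrow> continuous_on S f \<and>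
    (\<forall>i<m. (\<forall>x\<in>S. ((\<lambda>t. f (x(i := t))) has_real_derivative pd i f x) (at (x i))) \<and> Ck_on k m S (pd i f))"
    (is "_ \<longleftrightarrow> ?R")
proof
  assume f: "Ck_on (Suc k) m S f"
  show ?R
  proof (intro conjI allI impI)
    show "continuous_on S f" using f S by (rule Ck_on_imp_continuous_on[rotated])
    fix i assume "i < m"
    then obtain g where g: "\<forall>x\<in>S. ((\<lambda>t. f (x(i := t))) has_real_derivative g x) (at (x i))" "Ck_on k m S g"
      using f unfolding Ck_on.simps(2) by blast
    then have "\<forall>x\<in>S. pd i f x = g x" by (auto simp: pd_def intro: DERIV_imp_deriv)
    then show "\<forall>x\<in>S. ((\<lambda>t. f (x(i := t))) has_real_derivative pd i f x) (at (x i))" "Ck_on k m S (pd i f)"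
      using g Ck_on_cong[OF S, of g "pd i f"] by auto
  qed
next
  assume ?R
  then show "Ck_on (Suc k) m S f"
    unfolding Ck_on.simps(2) continuous_map_Euclidean_iff[OF S] by blast
qed

lemma Ck_on_SucI:
  assumes "openin (Euclidean_space m) S" "continuous_on S f"
    and "\<And>i x. i < m \<Longrightarrow> x \<in> S \<Longrightarrow> ((\<lambda>t. f (x(i := t))) has_real_derivative g i x) (at (x i))"
    and "\<And>i. i < m \<Longrightarrow> Ck_on k m S (g i)"
  shows "Ck_on (Suc k) m S f"
  unfolding Ck_on.simps(2) continuous_map_Euclidean_iff[OF assms(1)] using assms(2-4) by blast

lemma pd_eqI: "((\<lambda>t. f (x(i := t))) has_real_derivative d) (at (x i)) \<Longrightarrow> pd i f x = d"
  unfolding pd_def by (rule DERIV_imp_deriv)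

lemma Ck_on_subset:
  assumes "Ck_on k m S f" "T \<subseteq> S"
  shows "Ck_on k m T f"
  using assms
proof (induction k arbitrary: f)
  case 0
  then show ?case by (auto intro: continuous_map_from_subtopology_mono)
next
  case (Suc k)
  show ?case unfolding Ck_on.simps
  proof (intro conjI allI impI)
    show "continuous_map (subtopology (Euclidean_space m) T) euclideanreal f"
      by (rule continuous_map_from_subtopology_mono[OF Ck_on_imp_continuous_map]) (use Suc.prems in auto)
    fix i assume "i < m"
    then obtain g where "\<forall>x\<in>S. ((\<lambda>t. f (x(i := t))) has_real_derivative g x) (at (x i))" "Ck_on k m S g"
      using Suc.prems(1) unfolding Ck_on.simps(2) by blast
    then show "\<exists>g. (\<forall>x\<in>T. ((\<lambda>t. f (x(i := t))) has_real_derivative g x) (at (x i))) \<and> Ck_on k m T g"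
      using Suc.IH[of g] Suc.prems(2) by blast
  qed
qed

lemma Ck_on_local:
  assumes S: "openin (Euclidean_space m) S"
    and loc: "\<And>x. x \<in> S \<Longrightarrow> \<exists>T. openin (Euclidean_space m) T \<and> x \<in> T \<and> Ck_on k m T f"
  shows "Ck_on k m S f"
proof -
  have loc': "\<exists>T. openin (Euclidean_space m) T \<and> x \<in> T \<and> T \<subseteq> S \<and> Ck_on k m T f" if x: "x \<in> S" for x
  proof -
    obtain T where T: "openin (Euclidean_space m) T" "x \<in> T" "Ck_on k m T f" using loc[OF x] by blast
    then show ?thesis using S x by (intro exI[of _ "T \<inter> S"]) (auto intro: Ck_on_subset)
  qed
  then show ?thesis
  proof (induction k arbitrary: f)
    case 0
    show ?case unfolding Ck_on.simps
    proof (rule continuous_map_locally)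
      fix x assume "x \<in> topspace (subtopology (Euclidean_space m) S)"
      then obtain T where T: "openin (Euclidean_space m) T" "x \<in> T" "T \<subseteq> S" "Ck_on 0 m T f"
        using 0 by auto
      then show "\<exists>T. openin (subtopology (Euclidean_space m) S) T \<and> x \<in> T \<and>
          continuous_map (subtopology (subtopology (Euclidean_space m) S) T) euclideanreal f"
        using S by (intro exI[of _ T]) (simp add: subtopology_subtopology inf_absorb2 openin_open_subtopology)
    qed
  next
    case (Suc k)
    have "Ck_on k m S f"
    proof (rule Suc.IH)
      show "\<exists>T. openin (Euclidean_space m) T \<and> x \<in> T \<and> T \<subseteq> S \<and> Ck_on k m T f" if "x \<in> S" for x
        using Suc.prems[OF that] Ck_on_Suc_imp by blast
    qed
    then have c: "continuous_on S f" by (rule Ck_on_imp_continuous_on[OF S])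
    have ex: "\<exists>T. openin (Euclidean_space m) T \<and> x \<in> T \<and> T \<subseteq> S \<and>
        (\<forall>y\<in>T. ((\<lambda>t. f (y(i := t))) has_real_derivative pd i f y) (at (y i))) \<and> Ck_on k m T (pd i f)"
      if x: "x \<in> S" and i: "i < m" for x i
    proof -
      obtain T where T: "openin (Euclidean_space m) T" "x \<in> T" "T \<subseteq> S" "Ck_on (Suc k) m T f"
        using Suc.prems[OF x] by blast
      then show ?thesis using Ck_on_Suc_pd[OF T(1)] i by blast
    qed
    show ?case unfolding Ck_on_Suc_pd[OF S]
    proof (intro conjI allI impI ballI c)
      fix i assume i: "i < m"
      show "Ck_on k m S (pd i f)"
      proof (rule Suc.IH)
        show "\<exists>T. openin (Euclidean_space m) T \<and> x \<in> T \<and> T \<subseteq> S \<and> Ck_on k m T (pd i f)" if "x \<in> S" for x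
          using ex[OF that i] by blast
      qed
      fix x assume "x \<in> S"
      then show "((\<lambda>t. f (x(i := t))) has_real_derivative pd i f x) (at (x i))"
        using ex[OF _ i] by blast
    qed
  qed
qed

lemma Ck_on_0_iff: "openin (Euclidean_space m) S \<Longrightarrow> Ck_on 0 m S f \<longleftrightarrow> continuous_on S f"
  by (simp add: continuous_map_Euclidean_iff)

declare Ck_on.simps(1) [simp del]

lemma Ck_on_const: "openin (Euclidean_space m) S \<Longrightarrow> Ck_on k m S (\<lambda>_. c)"
proof (induction k arbitrary: c)
  case (Suc k)
  show ?case
    by (rule Ck_on_SucI[where g = "\<lambda>_ _. 0"]) (use Suc in auto)
qed (simp add: Ck_on_0_iff)

lemma Ck_on_coord:
  assumes S: "openin (Euclidean_space m) S"
  shows "Ck_on k m S (\<lambda>x. x j)"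
proof (cases k)
  case 0
  then show ?thesis by (simp only: Ck_on_0_iff[OF S] continuous_on_coord)
next
  case (Suc n)
  show ?thesis unfolding Suc
  proof (rule Ck_on_SucI[OF S continuous_on_coord])
    fix i x
    show "((\<lambda>t. (x(i := t)) j) has_real_derivative (\<lambda>_. if i = j then 1 else 0) x) (at (x i))"
      by (cases "i = j") auto
  qed (rule Ck_on_const[OF S])
qed

lemma Ck_on_add:
  assumes S: "openin (Euclidean_space m) S"
  shows "Ck_on k m S f \<Longrightarrow> Ck_on k m S g \<Longrightarrow> Ck_on k m S (\<lambda>x. f x + g x)"
proof (induction k arbitrary: f g)
  case 0
  then show ?case unfolding Ck_on_0_iff[OF S] by (auto intro: continuous_on_add)
next
  case (Suc k)
  show ?case
  proof (rule Ck_on_SucI[OF S, where g = "\<lambda>i x. pd i f x + pd i g x"])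
    show "continuous_on S (\<lambda>x. f x + g x)"
      using Suc.prems Ck_on_imp_continuous_on[OF S] by (auto intro: continuous_on_add)
    show "((\<lambda>t. f (x(i := t)) + g (x(i := t))) has_real_derivative pd i f x + pd i g x) (at (x i))"
      if "i < m" "x \<in> S" for i x
      using Suc.prems that unfolding Ck_on_Suc_pd[OF S] by (intro DERIV_add) blast+
    show "Ck_on k m S (\<lambda>x. pd i f x + pd i g x)" if "i < m" for i
      using Suc.prems that unfolding Ck_on_Suc_pd[OF S] by (intro Suc.IH) blast+
  qed
qed

lemma Ck_on_mult:
  assumes S: "openin (Euclidean_space m) S"
  shows "Ck_on k m S f \<Longrightarrow> Ck_on k m S g \<Longrightarrow> Ck_on k m S (\<lambda>x. f x * g x)"
proof (induction k arbitrary: f g)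
  case 0
  then show ?case unfolding Ck_on_0_iff[OF S] by (auto intro: continuous_on_mult)
next
  case (Suc k)
  have low: "Ck_on k m S f" "Ck_on k m S g" using Suc.prems Ck_on_Suc_imp by blast+
  show ?case
  proof (rule Ck_on_SucI[OF S, where g = "\<lambda>i x. pd i f x * g x + f x * pd i g x"])
    show "continuous_on S (\<lambda>x. f x * g x)"
      using Suc.prems Ck_on_imp_continuous_on[OF S] by (auto intro: continuous_on_mult)
    show "((\<lambda>t. f (x(i := t)) * g (x(i := t))) has_real_derivative pd i f x * g x + f x * pd i g x) (at (x i))"
      if i: "i < m" and x: "x \<in> S" for i x
      using Suc.prems i x DERIV_mult[of "\<lambda>t. f (x(i := t))" "pd i f x" "x i" UNIV "\<lambda>t. g (x(i := t))" "pd i g x"]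
      by (simp add: Ck_on_Suc_pd[OF S] algebra_simps)
    show "Ck_on k m S (\<lambda>x. pd i f x * g x + f x * pd i g x)" if "i < m" for i
      using Suc.prems that low by (intro Ck_on_add[OF S] Suc.IH) (auto simp: Ck_on_Suc_pd[OF S])
  qed
qed

lemma Ck_on_sum:
  assumes S: "openin (Euclidean_space m) S"
  shows "(\<And>i. i \<in> I \<Longrightarrow> Ck_on k m S (f i)) \<Longrightarrow> Ck_on k m S (\<lambda>x. \<Sum>i\<in>I. f i x)"
  by (induction I rule: infinite_finite_induct) (simp_all add: Ck_on_const[OF S] Ck_on_add[OF S])

lemma Ck_on_inverse:
  assumes S: "openin (Euclidean_space m) S"
  shows "Ck_on k m S f \<Longrightarrow> (\<And>x. x \<in> S \<Longrightarrow> f x \<noteq> 0) \<Longrightarrow> Ck_on k m S (\<lambda>x. inverse (f x))"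
proof (induction k)
  case 0
  then show ?case unfolding Ck_on_0_iff[OF S] by (auto intro: continuous_on_inverse)
next
  case (Suc k)
  have low: "Ck_on k m S (\<lambda>x. inverse (f x))" using Suc Ck_on_Suc_imp by blast
  show ?case
  proof (rule Ck_on_SucI[OF S, where g = "\<lambda>i x. (-1) * (inverse (f x) * pd i f x * inverse (f x))"])
    show "continuous_on S (\<lambda>x. inverse (f x))"
      using low Ck_on_imp_continuous_on[OF S] by blast
    show "((\<lambda>t. inverse (f (x(i := t)))) has_real_derivative (-1) * (inverse (f x) * pd i f x * inverse (f x))) (at (x i))"
      if i: "i < m" and x: "x \<in> S" for i x
      using Suc.prems i x DERIV_inverse'[of "\<lambda>t. f (x(i := t))" "pd i f x" "x i" UNIV]
      by (simp add: Ck_on_Suc_pd[OF S])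
    show "Ck_on k m S (\<lambda>x. (-1) * (inverse (f x) * pd i f x * inverse (f x)))" if "i < m" for i
      using Suc.prems that low
      by (intro Ck_on_mult[OF S] Ck_on_const[OF S]) (auto simp: Ck_on_Suc_pd[OF S])
  qed
qed

text \<open>
  The outer function is given with all its derivatives, so that the induction on \<open>k\<close> can pass from
  \<open>h n\<close> to \<open>h (Suc n)\<close>.
\<close>
lemma Ck_on_compose_real:
  fixes h :: "nat \<Rightarrow> real \<Rightarrow> real"
  assumes S: "openin (Euclidean_space m) S"
    and h: "\<And>n t. (h n has_real_derivative h (Suc n) t) (at t)"
  shows "Ck_on k m S f \<Longrightarrow> Ck_on k m S (\<lambda>x. h n (f x))"
proof (induction k arbitrary: n)
  case 0
  have "continuous_on UNIV (h n)" using h by (meson DERIV_continuous_on has_field_derivative_at_within)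
  then have "continuous_on S (\<lambda>x. h n (f x))"
    using 0 unfolding Ck_on_0_iff[OF S] by (auto intro: continuous_on_compose2)
  then show ?case by (simp only: Ck_on_0_iff[OF S])
next
  case (Suc k)
  have low: "Ck_on k m S f" using Suc.prems Ck_on_Suc_imp by blast
  show ?case
  proof (rule Ck_on_SucI[OF S, where g = "\<lambda>i x. h (Suc n) (f x) * pd i f x"])
    show "continuous_on S (\<lambda>x. h n (f x))"
      using Suc.IH[OF low] Ck_on_imp_continuous_on[OF S] by blast
    show "((\<lambda>t. h n (f (x(i := t)))) has_real_derivative h (Suc n) (f x) * pd i f x) (at (x i))"
      if i: "i < m" and x: "x \<in> S" for i x
      using Suc.prems i x DERIV_chain2[of "h n" "h (Suc n) (f x)" "\<lambda>t. f (x(i := t))" "x i" "pd i f x" UNIV] h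
      by (simp add: Ck_on_Suc_pd[OF S])
    show "Ck_on k m S (\<lambda>x. h (Suc n) (f x) * pd i f x)" if "i < m" for i
      using Suc.prems that Suc.IH[OF low]
      by (intro Ck_on_mult[OF S]) (auto simp: Ck_on_Suc_pd[OF S])
  qed
qed

text \<open>
  Total differentiability in the form of Caratheodory. The increment of \<open>F\<close> is split along the path
  from \<open>a\<close> to \<open>v\<close> that changes one coordinate after the other; the mean value theorem on the \<open>i\<close>-th
  leg compares the difference quotient \<open>q i v\<close> with the continuous function \<open>pd i F\<close>.
\<close>
lemma partial_difference_quotients:
  assumes T: "openin (Euclidean_space m) T" and F: "Ck_on 1 m T F" and a: "a \<in> T"
  obtains q where
    "\<And>v. v \<in> model_space m \<Longrightarrow> F v - F a = (\<Sum>i<m. q i v * (v i - a i))"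
    "\<And>e. e > 0 \<Longrightarrow> \<exists>d>0. \<forall>v\<in>open_box m a d. \<forall>i<m. \<bar>q i v - pd i F a\<bar> \<le> e"
proof
  \<comment> \<open>\<open>w j v\<close> is the corner of the path after \<open>j\<close> steps.\<close>
  define w where "w j v = (\<lambda>i. if i < j then v i else a i)" for j :: nat and v :: "nat \<Rightarrow> real"
  define q where "q i v = (if v i = a i then pd i F a else (F (w (Suc i) v) - F (w i v)) / (v i - a i))" for i v
  have aR: "a \<in> model_space m" using openin_subset[OF T] a by blast
  have w_Suc: "w (Suc j) v = (w j v)(j := v j)" for j v by (auto simp: w_def)
  have w_same: "w (Suc j) v = w j v" if "v j = a j" for j v using that by (auto simp: w_def less_Suc_eq)
  show "F v - F a = (\<Sum>i<m. q i v * (v i - a i))" if v: "v \<in> model_space m" for v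
  proof -
    have "w m v = v" "w 0 v = a" using v aR by (auto simp: w_def model_space_iff fun_eq_iff)
    then have "F v - F a = (\<Sum>i<m. F (w (Suc i) v) - F (w i v))"
      using sum_lessThan_telescope[of "\<lambda>i. F (w i v)" m] by simp
    also have "\<dots> = (\<Sum>i<m. q i v * (v i - a i))"
      by (rule sum.cong) (auto simp: q_def w_same)
    finally show ?thesis .
  qed
  fix e :: real assume e: "e > 0"
  have contpd: "continuous_on T (pd i F)" if "i < m" for i
    using F that Ck_on_Suc_pd[OF T, of 0 F] Ck_on_imp_continuous_on[OF T] by auto
  let ?N = "{x \<in> T. \<forall>i\<in>{..<m}. pd i F x \<in> {pd i F a - e<..<pd i F a + e}}"
  have N1: "openin (Euclidean_space m) {x \<in> T. pd i F x \<in> {pd i F a - e<..<pd i F a + e}}" if i: "i < m" for i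
  proof -
    have "continuous_map (subtopology (Euclidean_space m) T) euclideanreal (pd i F)"
      using contpd[OF i] continuous_map_Euclidean_iff[OF T] by blast
    from openin_continuous_map_preimage[OF this, of "{pd i F a - e<..<pd i F a + e}"]
    have "openin (subtopology (Euclidean_space m) T)
        {x \<in> topspace (subtopology (Euclidean_space m) T). pd i F x \<in> {pd i F a - e<..<pd i F a + e}}"
      by simp
    also have "topspace (subtopology (Euclidean_space m) T) = T"
      using openin_subset[OF T] by (simp add: inf_absorb2)
    finally show ?thesis using openin_trans_full T by blast
  qed
  have "openin (Euclidean_space m) (T \<inter> (\<Inter>i\<in>{..<m}. {x \<in> T. pd i F x \<in> {pd i F a - e<..<pd i F a + e}}))"
    using T N1 by (cases "m = 0") (auto intro!: openin_Int openin_INT2)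
  moreover have "a \<in> T \<inter> (\<Inter>i\<in>{..<m}. {x \<in> T. pd i F x \<in> {pd i F a - e<..<pd i F a + e}})"
    using a e by auto
  ultimately obtain d where d: "d > 0"
     "open_box m a d \<subseteq> T \<inter> (\<Inter>i\<in>{..<m}. {x \<in> T. pd i F x \<in> {pd i F a - e<..<pd i F a + e}})"
    using openin_contains_box by blast
  have "\<bar>q i v - pd i F a\<bar> \<le> e" if v: "v \<in> open_box m a d" and i: "i < m" for v i
  proof (cases "v i = a i")
    case True
    then show ?thesis using e by (simp add: q_def)
  next
    case False
    let ?p = "w i v"
    have seg: "?p(i := t) \<in> open_box m a d" if t: "t \<in> closed_segment (a i) (v i)" for t
    proof -
      have "\<bar>t - a i\<bar> \<le> \<bar>v i - a i\<bar>" using t by (auto simp: closed_segment_eq_real_ivl split: if_splits)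
      then show ?thesis using v i aR d(1) by (auto simp: open_box_def w_def model_space_iff)
    qed
    define \<phi> where "\<phi> t = F (?p(i := t)) - pd i F a * t" for t
    have der: "(\<phi> has_field_derivative (pd i F (?p(i := t)) - pd i F a)) (at t within closed_segment (a i) (v i))"
      if t: "t \<in> closed_segment (a i) (v i)" for t
    proof -
      have "?p(i := t) \<in> T" using seg[OF t] d by blast
      then have "((\<lambda>s. F ((?p(i := t))(i := s))) has_real_derivative pd i F (?p(i := t))) (at ((?p(i := t)) i))"
        using F i unfolding One_nat_def Ck_on_Suc_pd[OF T] by blast
      then have "((\<lambda>s. F (?p(i := s))) has_real_derivative pd i F (?p(i := t))) (at t)" by simp
      from DERIV_diff[OF this DERIV_cmult_Id[of "pd i F a"]] show ?thesis
        unfolding \<phi>_def by (rule has_field_derivative_at_within)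
    qed
    have "norm (\<phi> (v i) - \<phi> (a i)) \<le> e * norm (v i - a i)"
    proof (rule field_differentiable_bound[OF _ der])
      show "norm (pd i F (?p(i := t)) - pd i F a) \<le> e" if "t \<in> closed_segment (a i) (v i)" for t
        using subsetD[OF d(2) seg[OF that]] i by (auto simp: abs_le_iff dest!: bspec[of _ _ i])
    qed auto
    moreover have "?p(i := v i) = w (Suc i) v" "?p(i := a i) = w i v"
      by (auto simp: w_def fun_eq_iff)
    ultimately have "\<bar>(F (w (Suc i) v) - F (w i v)) - pd i F a * (v i - a i)\<bar> \<le> e * \<bar>v i - a i\<bar>"
      by (simp add: \<phi>_def algebra_simps)
    moreover have "(F (w (Suc i) v) - F (w i v)) - pd i F a * (v i - a i) = (q i v - pd i F a) * (v i - a i)"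
      using False by (simp add: q_def field_simps)
    ultimately show ?thesis using False by (simp add: abs_mult)
  qed
  then show "\<exists>d>0. \<forall>v\<in>open_box m a d. \<forall>i<m. \<bar>q i v - pd i F a\<bar> \<le> e" using d(1) by blast
qed

lemma has_real_derivative_along_curve:
  assumes T: "openin (Euclidean_space m) T" and F: "Ck_on 1 m T F" and c0: "c t0 \<in> T"
    and cR: "eventually (\<lambda>t. c t \<in> model_space m) (nhds t0)"
    and c: "\<And>i. i < m \<Longrightarrow> ((\<lambda>t. c t i) has_real_derivative c' i) (at t0)"
  shows "((\<lambda>t. F (c t)) has_real_derivative (\<Sum>i<m. pd i F (c t0) * c' i)) (at t0)"
proof -
  obtain q where q: "\<And>v. v \<in> model_space m \<Longrightarrow> F v - F (c t0) = (\<Sum>i<m. q i v * (v i - c t0 i))"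
    "\<And>e. e > 0 \<Longrightarrow> \<exists>d>0. \<forall>v\<in>open_box m (c t0) d. \<forall>i<m. \<bar>q i v - pd i F (c t0)\<bar> \<le> e"
    using partial_difference_quotients[OF T F c0] by blast
  have cR': "eventually (\<lambda>t. c t \<in> model_space m) (at t0)"
    using cR unfolding eventually_at_filter by (rule eventually_mono) simp
  have q_lim: "((\<lambda>t. q i (c t)) \<longlongrightarrow> pd i F (c t0)) (at t0)" if i: "i < m" for i
  proof (rule tendstoI)
    fix e :: real assume "e > 0"
    then obtain d where d: "d > 0" "\<forall>v\<in>open_box m (c t0) d. \<forall>i<m. \<bar>q i v - pd i F (c t0)\<bar> \<le> e/2"
      using q(2)[of "e/2"] by auto
    have "eventually (\<lambda>t. \<forall>j\<in>{..<m}. \<bar>c t j - c t0 j\<bar> < d) (at t0)"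
    proof (intro eventually_ball_finite ballI)
      fix j assume "j \<in> {..<m}"
      then have "((\<lambda>t. c t j) \<longlongrightarrow> c t0 j) (at t0)" using c[of j] DERIV_isCont isContD by blast
      then show "eventually (\<lambda>t. \<bar>c t j - c t0 j\<bar> < d) (at t0)"
        using tendstoD[OF _ d(1)] by (fastforce simp: dist_real_def)
    qed auto
    with cR' have "eventually (\<lambda>t. c t \<in> open_box m (c t0) d) (at t0)"
      by eventually_elim (auto simp: open_box_def)
    then show "eventually (\<lambda>t. dist (q i (c t)) (pd i F (c t0)) < e) (at t0)"
    proof eventually_elim
      case (elim t)
      then have "\<bar>q i (c t) - pd i F (c t0)\<bar> \<le> e/2" using d(2) i by blast
      then show ?case using \<open>e > 0\<close> by (simp add: dist_real_def)
    qed
  qed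
  have "((\<lambda>t. \<Sum>i<m. q i (c t) * ((c t i - c t0 i) / (t - t0))) \<longlongrightarrow> (\<Sum>i<m. pd i F (c t0) * c' i)) (at t0)"
  proof (intro tendsto_sum tendsto_mult q_lim)
    fix i assume "i \<in> {..<m}"
    then show "((\<lambda>t. (c t i - c t0 i) / (t - t0)) \<longlongrightarrow> c' i) (at t0)"
      using c[of i] by (simp add: has_field_derivative_iff)
  qed auto
  moreover have "eventually (\<lambda>t. (\<Sum>i<m. q i (c t) * ((c t i - c t0 i) / (t - t0))) = (F (c t) - F (c t0)) / (t - t0)) (at t0)"
    using cR' by eventually_elim (simp add: q(1) sum_divide_distrib)
  ultimately show ?thesis
    unfolding has_field_derivative_iff by (rule Lim_transform_eventually)
qed

lemma Ck_on_compose: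
  assumes S: "openin (Euclidean_space l) S" and T: "openin (Euclidean_space m) T"
    and GT: "\<And>x. x \<in> S \<Longrightarrow> G x \<in> T"
  shows "Ck_on k m T F \<Longrightarrow> (\<And>j. j < m \<Longrightarrow> Ck_on k l S (\<lambda>x. G x j)) \<Longrightarrow> Ck_on k l S (\<lambda>x. F (G x))"
proof (induction k arbitrary: F)
  have cont: "continuous_on S (\<lambda>x. F (G x))"
    if F: "continuous_on T F" and G: "\<And>j. j < m \<Longrightarrow> continuous_on S (\<lambda>x. G x j)" for F :: "(nat \<Rightarrow> real) \<Rightarrow> real"
  proof -
    have "continuous_on S (\<lambda>x. G x j)" for j
    proof (cases "j < m")
      case False
      then have "G x j = 0" if "x \<in> S" for x
        using GT[OF that] openin_subset[OF T] by (auto simp: model_space_iff subset_iff)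
      then show ?thesis by (simp cong: continuous_on_cong)
    qed (rule G)
    then have "continuous_on S G" by (rule continuous_on_coordinatewise_then_product)
    then show ?thesis using continuous_on_compose2[OF F] GT by blast
  qed
  {
    case 0
    then show ?case using cont[of F] unfolding Ck_on_0_iff[OF S] Ck_on_0_iff[OF T] by blast
  next
    case (Suc k)
    have G: "Ck_on k l S (\<lambda>x. G x j)" if "j < m" for j using Suc.prems(2)[OF that] Ck_on_Suc_imp by blast
    show ?case
    proof (rule Ck_on_SucI[OF S, where g = "\<lambda>i x. \<Sum>j<m. pd j F (G x) * pd i (\<lambda>x. G x j) x"])
      show "continuous_on S (\<lambda>x. F (G x))"
        using cont[of F] Ck_on_imp_continuous_on[OF T Suc.prems(1)] Ck_on_imp_continuous_on[OF S Suc.prems(2)] by blast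
      show "((\<lambda>t. F (G (x(i := t)))) has_real_derivative (\<Sum>j<m. pd j F (G x) * pd i (\<lambda>x. G x j) x)) (at (x i))"
        if i: "i < l" and x: "x \<in> S" for i x
      proof -
        have "Ck_on 1 m T F" using Suc.prems(1) unfolding One_nat_def
          by (induction k) (auto dest: Ck_on_Suc_imp)
        moreover have "eventually (\<lambda>t. G (x(i := t)) \<in> model_space m) (nhds (x i))"
          using eventually_slice_in[OF S x i] by eventually_elim (use GT openin_subset[OF T] in blast)
        moreover have "((\<lambda>t. G (x(i := t)) j) has_real_derivative pd i (\<lambda>x. G x j) x) (at (x i))" if "j < m" for j
          using Suc.prems(2)[OF that] i x unfolding Ck_on_Suc_pd[OF S] by blast
        ultimately show ?thesis
          using has_real_derivative_along_curve[OF T, of F "\<lambda>t. G (x(i := t))" "x i" "\<lambda>j. pd i (\<lambda>x. G x j) x"] GT[OF x]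
          by simp
      qed
      show "Ck_on k l S (\<lambda>x. \<Sum>j<m. pd j F (G x) * pd i (\<lambda>x. G x j) x)" if i: "i < l" for i
      proof (intro Ck_on_sum[OF S] Ck_on_mult[OF S])
        fix j assume j: "j \<in> {..<m}"
        then have "Ck_on k m T (pd j F)" using Suc.prems(1) unfolding Ck_on_Suc_pd[OF T] by blast
        then show "Ck_on k l S (\<lambda>x. pd j F (G x))" by (rule Suc.IH) (rule G)
        show "Ck_on k l S (pd i (\<lambda>x. G x j))" using Suc.prems(2)[of j] j i unfolding Ck_on_Suc_pd[OF S] by blast
      qed
    qed
  }
qed

section \<open>Bump functions and Hadamard's lemma\<close>

text \<open>
  \<open>flat 1\<close> is the function \<open>exp (-1/x)\<close>, continued by zero. The polynomial factor makes the family
  closed under differentiation, which replaces a computation of the higher derivatives.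
\<close>
definition flat :: "real poly \<Rightarrow> real \<Rightarrow> real" where
  "flat Q x = (if x > 0 then poly Q (inverse x) * exp (- inverse x) else 0)"

lemma poly_exp_decay: "((\<lambda>u. poly Q u * exp (- u)) \<longlongrightarrow> 0) at_top" for Q :: "real poly"
proof -
  have "((\<lambda>u. \<Sum>i\<le>degree Q. coeff Q i * (u ^ i / exp u)) \<longlongrightarrow> (\<Sum>i\<le>degree Q. coeff Q i * 0)) at_top"
    by (intro tendsto_sum tendsto_mult tendsto_const tendsto_power_div_exp_0)
  moreover have "(\<lambda>u. poly Q u * exp (- u)) = (\<lambda>u. \<Sum>i\<le>degree Q. coeff Q i * (u ^ i / exp u))"
    by (simp add: poly_altdef sum_distrib_right exp_minus divide_inverse mult.assoc)
  ultimately show ?thesis by simp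
qed

lemma flat_has_derivative:
  "(flat Q has_real_derivative flat ([:0, 0, 1:] * (Q - pderiv Q)) x) (at x)"
proof -
  consider "x < 0" | "x > 0" | "x = 0" by linarith
  then show ?thesis
  proof cases
    case 1
    have "eventually (\<lambda>y. flat Q y = 0) (nhds x)"
      using eventually_nhds_in_open[of "{..<0}" x] 1 by (auto elim!: eventually_mono simp: flat_def)
    from DERIV_cong_ev[OF refl this refl, THEN iffD2, OF DERIV_const]
    have "(flat Q has_real_derivative 0) (at x)" .
    moreover have "flat ([:0, 0, 1:] * (Q - pderiv Q)) x = 0" using 1 by (simp add: flat_def)
    ultimately show ?thesis by simp
  next
    case 2
    have "eventually (\<lambda>y. flat Q y = poly Q (inverse y) * exp (- inverse y)) (nhds x)"
      using eventually_nhds_in_open[of "{0<..}" x] 2 by (auto elim!: eventually_mono simp: flat_def)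
    note DERIV_cong_ev[OF refl this refl]
    moreover have "((\<lambda>y. poly Q (inverse y) * exp (- inverse y)) has_real_derivative
       flat ([:0, 0, 1:] * (Q - pderiv Q)) x) (at x)"
      using 2 by (auto intro!: derivative_eq_intros DERIV_chain2[OF poly_DERIV]
          simp: flat_def power2_eq_square algebra_simps)
    ultimately show ?thesis by blast
  next
    case 3
    have "((\<lambda>y. flat Q y / y) \<longlongrightarrow> 0) (at_right 0)"
    proof -
      have "((\<lambda>y. poly (pCons 0 Q) (inverse y) * exp (- inverse y)) \<longlongrightarrow> 0) (at_right (0::real))"
        using filterlim_compose[OF poly_exp_decay filterlim_inverse_at_top_right] .
      moreover have "eventually (\<lambda>y. poly (pCons 0 Q) (inverse y) * exp (- inverse y) = flat Q y / y) (at_right (0::real))"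
        unfolding eventually_at_right_field by (intro exI[of _ 1]) (auto simp: flat_def field_simps)
      ultimately show ?thesis by (rule Lim_transform_eventually)
    qed
    moreover have "((\<lambda>y. flat Q y / y) \<longlongrightarrow> 0) (at_left 0)"
    proof (rule Lim_transform_eventually[OF tendsto_const])
      show "eventually (\<lambda>y. 0 = flat Q y / y) (at_left 0)"
        unfolding eventually_at_left_field by (intro exI[of _ "-1"]) (auto simp: flat_def)
    qed
    ultimately have "((\<lambda>y. flat Q y / y) \<longlongrightarrow> 0) (at 0)" by (rule filterlim_split_at[rotated])
    then show ?thesis using 3 by (simp add: has_field_derivative_iff flat_def)
  qed
qed

lemma Ck_on_flat:
  assumes S: "openin (Euclidean_space m) S" and f: "Ck_on k m S f"
  shows "Ck_on k m S (\<lambda>x. flat Q (f x))"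
proof -
  define D where "D Q = [:0, 0, 1:] * (Q - pderiv Q)" for Q :: "real poly"
  have "(flat ((D ^^ n) Q) has_real_derivative flat ((D ^^ Suc n) Q) t) (at t)" for n t
    using flat_has_derivative[of "(D ^^ n) Q" t] by (simp add: D_def)
  from Ck_on_compose_real[of m S "\<lambda>n. flat ((D ^^ n) Q)" k f 0, OF S this f] show ?thesis by simp
qed

text \<open>
  With \<open>h = flat 1\<close> and the scaled square distance \<open>q\<close> from \<open>a\<close>, the bump function is
  \<open>h(4 - q) / (h(4 - q) + h(q - 1))\<close>. The denominator never vanishes, as \<open>4 - q\<close> or \<open>q - 1\<close> is
  positive; the quotient is 1 for \<open>q \<le> 1\<close> and 0 for \<open>q \<ge> 4\<close>.
\<close>
lemma bump_function:
  assumes S: "openin (Euclidean_space m) S" and a: "a \<in> S"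
  obtains \<beta> K V where "smooth_on m (model_space m) \<beta>"
    "compactin (Euclidean_space m) K" "K \<subseteq> S"
    "openin (Euclidean_space m) V" "a \<in> V" "V \<subseteq> K"
    "\<And>p. p \<in> V \<Longrightarrow> \<beta> p = 1" "\<And>p. p \<in> model_space m \<Longrightarrow> p \<notin> K \<Longrightarrow> \<beta> p = 0"
proof -
  have aR: "a \<in> model_space m" using openin_subset[OF S] a by blast
  obtain e' where e': "e' > 0" "open_box m a e' \<subseteq> S" using openin_contains_box[OF S a] .
  \<comment> \<open>\<open>q \<le> 4\<close> means distance at most \<open>2 e\<close>, and the factor 3 keeps this inside the box of size \<open>e'\<close>.\<close>
  define e where "e = e' / 3"
  have e: "e > 0" using e' by (simp add: e_def)
  define q where "q p = (\<Sum>i<m. ((p i - a i) / e) * ((p i - a i) / e))" for p :: "nat \<Rightarrow> real"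
  define \<beta> where "\<beta> p = flat 1 (4 - q p) * inverse (flat 1 (4 - q p) + flat 1 (q p - 1))" for p
  define K where "K = {p \<in> model_space m. \<forall>i<m. \<bar>p i - a i\<bar> \<le> 2 * e}"
  define V where "V = {p \<in> model_space m. q p < 1}"
  have topo: "openin (Euclidean_space m) (model_space m)" by simp
  have q: "Ck_on k m (model_space m) q" for k
  proof -
    have "Ck_on k m (model_space m) (\<lambda>p. (p i + (- a i)) * inverse e)" for i
      by (intro Ck_on_mult Ck_on_add Ck_on_const Ck_on_coord topo)
    then have "Ck_on k m (model_space m) (\<lambda>p. (p i - a i) / e)" for i by (simp add: divide_inverse)
    then show ?thesis unfolding q_def by (intro Ck_on_sum Ck_on_mult topo)
  qed
  have f4: "Ck_on k m (model_space m) (\<lambda>p. flat 1 (4 - q p))" for k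
    using Ck_on_flat[OF topo Ck_on_add[OF topo Ck_on_const[OF topo, of k 4] Ck_on_mult[OF topo Ck_on_const[OF topo, of k "-1"] q]]]
    by simp
  have f1: "Ck_on k m (model_space m) (\<lambda>p. flat 1 (q p - 1))" for k
    using Ck_on_flat[OF topo Ck_on_add[OF topo q Ck_on_const[OF topo, of k "-1"]]] by simp
  have pos: "flat 1 (4 - t) + flat 1 (t - 1) > 0" for t
    by (cases "t < 4") (auto simp: flat_def intro!: add_pos_nonneg)
  have "Ck_on k m (model_space m) \<beta>" for k
    unfolding \<beta>_def by (intro Ck_on_mult Ck_on_inverse Ck_on_add topo f1 f4) (use pos in \<open>simp add: less_imp_neq[symmetric]\<close>)
  then have 1: "smooth_on m (model_space m) \<beta>" by (simp add: smooth_on_def)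
  have q_ge: "((p i - a i) / e)\<^sup>2 \<le> q p" if "i < m" for p i
    using member_le_sum[of i "{..<m}" "\<lambda>i. ((p i - a i) / e) * ((p i - a i) / e)"] that
    by (simp add: q_def power2_eq_square)
  have "compactin (Euclidean_space m) K"
  proof -
    have "K = PiE UNIV (\<lambda>i. if i < m then {a i - 2 * e .. a i + 2 * e} else {0})"
    proof (intro equalityI subsetI)
      fix p assume "p \<in> K"
      then have "p i \<in> (if i < m then {a i - 2 * e .. a i + 2 * e} else {0})" for i
        by (simp add: K_def model_space_iff abs_le_iff algebra_simps)
      then show "p \<in> PiE UNIV (\<lambda>i. if i < m then {a i - 2 * e .. a i + 2 * e} else {0})" by blast
    next
      fix p assume "p \<in> PiE UNIV (\<lambda>i. if i < m then {a i - 2 * e .. a i + 2 * e} else {0})"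
      then have p: "p i \<in> (if i < m then {a i - 2 * e .. a i + 2 * e} else {0})" for i by blast
      have "p i = 0" if "i \<ge> m" for i using p[of i] that by simp
      moreover have "\<bar>p i - a i\<bar> \<le> 2 * e" if "i < m" for i
        using p[of i] that by (simp add: abs_le_iff algebra_simps)
      ultimately show "p \<in> K" by (simp add: K_def model_space_iff)
    qed
    moreover have "compactin (powertop_real UNIV) (PiE UNIV (\<lambda>i. if i < m then {a i - 2 * e .. a i + 2 * e} else {0}))"
      by (auto simp: compactin_PiE)
    ultimately show ?thesis by (auto simp: Euclidean_space_def compactin_subtopology K_def model_space_iff)
  qed
  moreover have "K \<subseteq> S"
  proof -
    have "K \<subseteq> open_box m a e'" using e by (auto simp: K_def open_box_def e_def)
    then show ?thesis using e' by blast
  qed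
  moreover have "openin (Euclidean_space m) V"
    using openin_continuous_map_preimage[of "Euclidean_space m" euclideanreal q "{..<1}"]
      Ck_on_imp_continuous_map[OF q[of 0]] by (simp add: V_def)
  moreover have "a \<in> V" using aR by (simp add: V_def q_def)
  moreover have "V \<subseteq> K"
  proof
    fix p assume p: "p \<in> V"
    have "\<bar>p i - a i\<bar> \<le> 2 * e" if "i < m" for i
    proof -
      have "((p i - a i) / e)\<^sup>2 < 1" using q_ge[OF that, of p] p by (simp add: V_def)
      then have "\<bar>(p i - a i) / e\<bar> < 1" by (simp add: abs_square_less_1)
      then show ?thesis using e by (simp add: abs_divide)
    qed
    then show "p \<in> K" using p by (simp add: K_def V_def)
  qed
  moreover have "\<beta> p = 1" if "p \<in> V" for p
    using that pos[of "q p"] by (auto simp: \<beta>_def V_def flat_def)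
  moreover have "\<beta> p = 0" if p: "p \<in> model_space m" "p \<notin> K" for p
  proof -
    obtain i where i: "i < m" "\<bar>p i - a i\<bar> > 2 * e" using p by (auto simp: K_def)
    then have "2 < \<bar>(p i - a i) / e\<bar>" using e by (simp add: abs_divide field_simps)
    then have "2\<^sup>2 < \<bar>(p i - a i) / e\<bar>\<^sup>2" by (intro power_strict_mono) auto
    then have "4 < ((p i - a i) / e)\<^sup>2" unfolding power2_abs by simp
    then have "4 < q p" using q_ge[OF i(1), of p] by linarith
    then show ?thesis by (simp add: \<beta>_def flat_def)
  qed
  ultimately show ?thesis using 1 that by blast
qed

lemma open_box_ray:
  assumes a: "a \<in> model_space m" and p: "p \<in> open_box m a e" and t: "t \<in> {0..1}"
  shows "(\<lambda>i. a i + t * (p i - a i)) \<in> open_box m a e"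
proof -
  have le: "t * \<bar>p i - a i\<bar> \<le> \<bar>p i - a i\<bar>" for i using t by (simp add: mult_left_le_one_le)
  have "\<bar>t * (p i - a i)\<bar> < e" if "i < m" for i
  proof -
    have "\<bar>t * (p i - a i)\<bar> \<le> \<bar>p i - a i\<bar>" using le[of i] t by (simp add: abs_mult)
    also have "\<dots> < e" using p that by (simp add: open_box_def)
    finally show ?thesis .
  qed
  then show ?thesis using p a by (auto simp: open_box_def model_space_iff)
qed

text \<open>
  Differentiation under the integral sign. Each partial derivative produces a factor \<open>t\<close> by the chain
  rule; the weight \<open>t ^ j\<close> is there to absorb it in the induction.
\<close>
lemma Ck_on_ray_integral:
  assumes a: "a \<in> model_space m"
  shows "Ck_on k m (open_box m a e) F \<Longrightarrow>
    Ck_on k m (open_box m a e) (\<lambda>p. integral {0..1} (\<lambda>t. t ^ j * F (\<lambda>i. a i + t * (p i - a i))))"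
proof (induction k arbitrary: F j)
  let ?B = "open_box m a e"
  note B = openin_open_box[of m a e]
  note ray = open_box_ray[OF a]
  have joint: "continuous_on (?B \<times> {0..1}) (\<lambda>(p, t). t ^ j * F (\<lambda>i. a i + t * (p i - a i)))"
    if F: "continuous_on ?B F" for F j
  proof -
    have coord: "continuous_on (?B \<times> {0..1::real}) (\<lambda>z. fst z i)" for i
      by (rule continuous_on_compose2[OF continuous_on_coord[of UNIV] continuous_on_fst[OF continuous_on_id]]) auto
    have "continuous_on (?B \<times> {0..1}) (\<lambda>z i. a i + snd z * (fst z i - a i))"
    proof (rule continuous_on_coordinatewise_then_product)
      show "continuous_on (?B \<times> {0..1}) (\<lambda>z. a i + snd z * (fst z i - a i))" for i
        by (rule continuous_on_add[OF continuous_on_const continuous_on_mult[OF continuous_on_snd[OF continuous_on_id]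
               continuous_on_diff[OF coord continuous_on_const]]])
    qed
    then have "continuous_on (?B \<times> {0..1}) (\<lambda>z. F (\<lambda>i. a i + snd z * (fst z i - a i)))"
      by (rule continuous_on_compose2[OF F]) (use ray in auto)
    then show ?thesis unfolding case_prod_beta
      by (rule continuous_on_mult[OF continuous_on_power[OF continuous_on_snd[OF continuous_on_id]]])
  qed
  have cont: "continuous_on ?B (\<lambda>p. integral {0..1} (\<lambda>t. t ^ j * F (\<lambda>i. a i + t * (p i - a i))))"
    if F: "continuous_on ?B F" for F j
    using integral_continuous_on_param[of ?B 0 1 "\<lambda>p t. t ^ j * F (\<lambda>i. a i + t * (p i - a i))"] joint[OF F]
    by (simp add: cbox_interval)
  {
    case 0
    then show ?case unfolding Ck_on_0_iff[OF B] by (rule cont)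
  next
    case (Suc k)
    have cF: "continuous_on ?B F" using Ck_on_imp_continuous_on[OF B Suc.prems] .
    show ?case
    proof (rule Ck_on_SucI[OF B, where g = "\<lambda>i p. integral {0..1} (\<lambda>t. t ^ Suc j * pd i F (\<lambda>i. a i + t * (p i - a i)))"])
      show "continuous_on ?B (\<lambda>p. integral {0..1} (\<lambda>t. t ^ j * F (\<lambda>i. a i + t * (p i - a i))))"
        by (rule cont[OF cF])
      show "Ck_on k m ?B (\<lambda>p. integral {0..1} (\<lambda>t. t ^ Suc j * pd i F (\<lambda>i. a i + t * (p i - a i))))" if "i < m" for i
        using Suc.prems that unfolding Ck_on_Suc_pd[OF B] by (intro Suc.IH) blast
      fix i x assume i: "i < m" and x: "x \<in> ?B"
      have pF: "continuous_on ?B (pd i F)"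
        using Suc.prems i Ck_on_imp_continuous_on[OF B] unfolding Ck_on_Suc_pd[OF B] by blast
      let ?U = "{x i - (e - \<bar>x i - a i\<bar>)<..<x i + (e - \<bar>x i - a i\<bar>)}"
      have xi: "x i \<in> ?U" using x i by (auto simp: open_box_def)
      have U: "x(i := s) \<in> ?B" if "s \<in> ?U" for s
        using that x i by (auto simp: open_box_def model_space_iff abs_less_iff)
      let ?f = "\<lambda>s t. t ^ j * F (\<lambda>l. a l + t * ((x(i := s)) l - a l))"
      let ?f' = "\<lambda>s t. t ^ Suc j * pd i F (\<lambda>l. a l + t * ((x(i := s)) l - a l))"
      have "((\<lambda>s. integral (cbox 0 1) (?f s)) has_field_derivative integral (cbox 0 1) (?f' (x i))) (at (x i) within ?U)"
      proof (rule leibniz_rule_field_derivative)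
        fix s t :: real assume s: "s \<in> ?U" and t: "t \<in> cbox 0 1"
        let ?c = "\<lambda>l. a l + t * ((x(i := s)) l - a l)"
        have cB: "?c \<in> ?B" using ray[OF U[OF s]] t by simp
        have "((\<lambda>u. F (?c(i := u))) has_real_derivative pd i F ?c) (at (?c i))"
          using Suc.prems i cB unfolding Ck_on_Suc_pd[OF B] by blast
        then have "((\<lambda>u. F (?c(i := u))) has_real_derivative pd i F ?c) (at (a i + t * (s - a i)))" by simp
        moreover have "((\<lambda>s. a i + t * (s - a i)) has_real_derivative t) (at s)"
          by (auto intro!: derivative_eq_intros)
        ultimately have "((\<lambda>r. F (?c(i := a i + t * (r - a i)))) has_real_derivative pd i F ?c * t) (at s)"
          by (rule DERIV_chain2)
        moreover have "?c(i := a i + t * (r - a i)) = (\<lambda>l. a l + t * ((x(i := r)) l - a l))" for r by auto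
        ultimately have "((\<lambda>r. F (\<lambda>l. a l + t * ((x(i := r)) l - a l))) has_real_derivative pd i F ?c * t) (at s)" by simp
        from has_field_derivative_at_within[OF DERIV_cmult[OF this, of "t ^ j"]]
        have "((\<lambda>s. ?f s t) has_field_derivative t ^ j * (pd i F ?c * t)) (at s within ?U)" .
        also have "t ^ j * (pd i F ?c * t) = ?f' s t" by simp
        finally show "((\<lambda>s. ?f s t) has_field_derivative ?f' s t) (at s within ?U)" .
      next
        fix s :: real assume s: "s \<in> ?U"
        have "continuous_on {0..1} (\<lambda>t. (\<lambda>(p, t). t ^ j * F (\<lambda>i. a i + t * (p i - a i))) (x(i := s), t))"
          by (rule continuous_on_compose2[OF joint[OF cF, of j] continuous_on_Pair[OF continuous_on_const continuous_on_id]])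
             (use U[OF s] in auto)
        then show "?f s integrable_on cbox 0 1" by (simp add: integrable_continuous_interval)
      next
        have upd: "continuous_on (?U \<times> {0..1::real}) (\<lambda>z. x(i := fst z))"
        proof (rule continuous_on_coordinatewise_then_product)
          show "continuous_on (?U \<times> {0..1::real}) (\<lambda>z. (x(i := fst z)) l)" for l
            by (cases "l = i") (simp_all add: continuous_on_fst)
        qed
        have "continuous_on (?U \<times> {0..1}) (\<lambda>z. (\<lambda>(p, t). t ^ Suc j * pd i F (\<lambda>i. a i + t * (p i - a i))) (x(i := fst z), snd z))"
          by (rule continuous_on_compose2[OF joint[OF pF, of "Suc j"] continuous_on_Pair[OF upd continuous_on_snd[OF continuous_on_id]]])
             (use U in auto)
        then show "continuous_on (?U \<times> cbox 0 1) (\<lambda>(s, t). ?f' s t)"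
          by (simp add: case_prod_beta cbox_interval)
      qed (use xi in auto)
      then show "((\<lambda>s. integral {0..1} (\<lambda>t. t ^ j * F (\<lambda>l. a l + t * ((x(i := s)) l - a l)))) has_real_derivative
          integral {0..1} (\<lambda>t. t ^ Suc j * pd i F (\<lambda>l. a l + t * (x l - a l)))) (at (x i))"
        using at_within_open[OF xi] by (simp add: cbox_interval)
    qed
  }
qed

text \<open>
  The fundamental theorem of calculus along the ray from \<open>a\<close> to \<open>p\<close>, whose derivative is
  \<open>\<Sum> (p i - a i) * pd i f\<close>.
\<close>
lemma Hadamard:
  assumes a: "a \<in> model_space m" and f: "smooth_on m (open_box m a e) f"
  obtains g where "\<And>i. i < m \<Longrightarrow> smooth_on m (open_box m a e) (g i)"
    "\<And>p. p \<in> open_box m a e \<Longrightarrow> f p = f a + (\<Sum>i<m. (p i - a i) * g i p)"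
proof
  let ?B = "open_box m a e"
  note B = openin_open_box[of m a e]
  let ?g = "\<lambda>i p. integral {0..1} (\<lambda>t. t ^ 0 * pd i f (\<lambda>i. a i + t * (p i - a i)))"
  have fk: "Ck_on k m ?B f" for k using f by (simp add: smooth_on_def)
  show "smooth_on m ?B (?g i)" if "i < m" for i
    unfolding smooth_on_def using fk[of "Suc _"] that unfolding Ck_on_Suc_pd[OF B]
    by (intro allI Ck_on_ray_integral[OF a]) blast
  fix p assume p: "p \<in> ?B"
  note ray = open_box_ray[OF a p]
  let ?F = "\<lambda>t. f (\<lambda>i. a i + t * (p i - a i))"
  let ?D = "\<lambda>t. \<Sum>i<m. pd i f (\<lambda>i. a i + t * (p i - a i)) * (p i - a i)"
  have "(?F has_real_derivative ?D t) (at t)" if t: "t \<in> {0..1}" for t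
  proof (rule has_real_derivative_along_curve[OF B])
    show "Ck_on 1 m ?B f" by (rule fk)
    show "(\<lambda>i. a i + t * (p i - a i)) \<in> ?B" by (rule ray[OF t])
    show "\<forall>\<^sub>F t in nhds t. (\<lambda>i. a i + t * (p i - a i)) \<in> model_space m"
      using p a by (intro always_eventually) (auto simp: open_box_def model_space_iff)
    show "((\<lambda>t. a i + t * (p i - a i)) has_real_derivative p i - a i) (at t)" for i
      by (auto intro!: derivative_eq_intros)
  qed
  then have "(?D has_integral (?F 1 - ?F 0)) {0..1}"
    by (intro fundamental_theorem_of_calculus)
       (auto simp: has_real_derivative_iff_has_vector_derivative[symmetric] intro: has_field_derivative_at_within)
  then have "f p - f a = integral {0..1} ?D" by (simp add: integral_unique)
  also have "\<dots> = (\<Sum>i<m. integral {0..1} (\<lambda>t. pd i f (\<lambda>i. a i + t * (p i - a i)) * (p i - a i)))"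
  proof (rule integral_sum)
    fix i assume i: "i \<in> {..<m}"
    have "Ck_on 0 m ?B (pd i f)" using fk[of "Suc 0"] i unfolding Ck_on_Suc_pd[OF B] by blast
    then have "continuous_on ?B (pd i f)" by (rule Ck_on_imp_continuous_on[OF B])
    moreover have "continuous_on {0..1} (\<lambda>t i. a i + t * (p i - a i))"
      by (rule continuous_on_coordinatewise_then_product)
         (rule continuous_on_add[OF continuous_on_const continuous_on_mult_right[OF continuous_on_id]])
    ultimately have "continuous_on {0..1} (\<lambda>t. pd i f (\<lambda>i. a i + t * (p i - a i)))"
      by (rule continuous_on_compose2) (use ray in auto)
    then show "(\<lambda>t. pd i f (\<lambda>i. a i + t * (p i - a i)) * (p i - a i)) integrable_on {0..1}"
      by (intro integrable_continuous_interval continuous_on_mult_right)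
  qed auto
  also have "\<dots> = (\<Sum>i<m. (p i - a i) * ?g i p)" by (simp add: mult.commute)
  finally show "f p = f a + (\<Sum>i<m. (p i - a i) * ?g i p)" by simp
qed

lemma smooth_on_const: "openin (Euclidean_space m) S \<Longrightarrow> smooth_on m S (\<lambda>_. c)"
  by (simp add: smooth_on_def Ck_on_const)

lemma smooth_on_coord: "openin (Euclidean_space m) S \<Longrightarrow> smooth_on m S (\<lambda>x. x j)"
  by (simp add: smooth_on_def Ck_on_coord)

lemma smooth_on_add:
  "openin (Euclidean_space m) S \<Longrightarrow> smooth_on m S f \<Longrightarrow> smooth_on m S g \<Longrightarrow> smooth_on m S (\<lambda>x. f x + g x)"
  by (simp add: smooth_on_def Ck_on_add)

lemma smooth_on_mult:
  "openin (Euclidean_space m) S \<Longrightarrow> smooth_on m S f \<Longrightarrow> smooth_on m S g \<Longrightarrow> smooth_on m S (\<lambda>x. f x * g x)"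
  by (simp add: smooth_on_def Ck_on_mult)

lemma smooth_on_subset: "smooth_on m S f \<Longrightarrow> T \<subseteq> S \<Longrightarrow> smooth_on m T f"
  unfolding smooth_on_def by (meson Ck_on_subset)

lemma smooth_on_cong:
  "openin (Euclidean_space m) S \<Longrightarrow> (\<And>x. x \<in> S \<Longrightarrow> f x = g x) \<Longrightarrow> smooth_on m S f \<Longrightarrow> smooth_on m S g"
  unfolding smooth_on_def by (meson Ck_on_cong)

lemma smooth_on_local:
  assumes "openin (Euclidean_space m) S"
    and "\<And>x. x \<in> S \<Longrightarrow> \<exists>T. openin (Euclidean_space m) T \<and> x \<in> T \<and> smooth_on m T f"
  shows "smooth_on m S f"
  unfolding smooth_on_def
proof
  fix k show "Ck_on k m S f"
    by (rule Ck_on_local[OF assms(1)]) (use assms(2) in \<open>unfold smooth_on_def, blast\<close>)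
qed

lemma smooth_on_compose:
  assumes "openin (Euclidean_space m) S" "openin (Euclidean_space m) T"
    and "\<And>x. x \<in> S \<Longrightarrow> G x \<in> T" "smooth_on m T F" "\<And>j. j < m \<Longrightarrow> smooth_on m S (\<lambda>x. G x j)"
  shows "smooth_on m S (\<lambda>x. F (G x))"
  unfolding smooth_on_def
proof
  fix k
  have F: "Ck_on k m T F" and G: "\<And>j. j < m \<Longrightarrow> Ck_on k m S (\<lambda>x. G x j)"
    using assms(4,5) by (simp_all add: smooth_on_def)
  show "Ck_on k m S (\<lambda>x. F (G x))" using Ck_on_compose[OF assms(1,2,3) F G] .
qed

lemma smooth_on_imp_continuous_on:
  "openin (Euclidean_space m) S \<Longrightarrow> smooth_on m S f \<Longrightarrow> continuous_on S f"
  unfolding smooth_on_def using Ck_on_imp_continuous_on by blast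

lemma smooth_on_pd:
  assumes S: "openin (Euclidean_space m) S" and f: "smooth_on m S f" and i: "i < m"
  shows "smooth_on m S (pd i f)"
    and "\<And>x. x \<in> S \<Longrightarrow> ((\<lambda>t. f (x(i := t))) has_real_derivative pd i f x) (at (x i))"
proof -
  have *: "Ck_on (Suc k) m S f" for k using f unfolding smooth_on_def by blast
  show "smooth_on m S (pd i f)" unfolding smooth_on_def using * i unfolding Ck_on_Suc_pd[OF S] by blast
  show "((\<lambda>t. f (x(i := t))) has_real_derivative pd i f x) (at (x i))" if "x \<in> S" for x
    using *[of 0] i that unfolding Ck_on_Suc_pd[OF S] by blast
qed

lemma pd_cong:
  assumes S: "openin (Euclidean_space m) S" and i: "i < m" and x: "x \<in> S"
    and eq: "\<And>y. y \<in> S \<Longrightarrow> f y = g y"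
  shows "pd i f x = pd i g x"
proof -
  have "eventually (\<lambda>t. f (x(i := t)) = g (x(i := t))) (nhds (x i))"
    using eventually_slice_in[OF S x i] by eventually_elim (rule eq)
  from DERIV_cong_ev[OF refl this refl] show ?thesis by (simp add: pd_def deriv_def)
qed

lemma pd_const: "pd i (\<lambda>_. c) x = 0"
  by (rule pd_eqI) simp

lemma pd_coord: "pd i (\<lambda>x. x j) x = (if i = j then 1 else 0)"
  by (rule pd_eqI) (cases "i = j"; simp)

lemma pd_add:
  assumes S: "openin (Euclidean_space m) S" and f: "smooth_on m S f" "smooth_on m S g" and i: "i < m" and x: "x \<in> S"
  shows "pd i (\<lambda>x. f x + g x) x = pd i f x + pd i g x"
  by (rule pd_eqI, rule DERIV_add) (rule smooth_on_pd(2)[OF S f(1) i x], rule smooth_on_pd(2)[OF S f(2) i x])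

lemma pd_mult:
  assumes S: "openin (Euclidean_space m) S" and f: "smooth_on m S f" "smooth_on m S g" and i: "i < m" and x: "x \<in> S"
  shows "pd i (\<lambda>x. f x * g x) x = pd i f x * g x + f x * pd i g x"
proof (rule pd_eqI)
  from DERIV_mult[OF smooth_on_pd(2)[OF S f(1) i x] smooth_on_pd(2)[OF S f(2) i x]]
  show "((\<lambda>t. f (x(i := t)) * g (x(i := t))) has_real_derivative pd i f x * g x + f x * pd i g x) (at (x i))"
    by (simp add: mult.commute)
qed

section \<open>Smooth functions on a manifold\<close>

locale smooth_manifold_loc =
  fixes m :: nat and M :: "'a topology" and \<C> :: "'a chart set"
  assumes manifold: "smooth_manifold m M \<C>"
begin

abbreviation SF :: "('a \<Rightarrow> real) set" where "SF \<equiv> smooth_functions m M \<C>"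

lemma Hausdorff: "Hausdorff_space M"
  using manifold by (simp add: smooth_manifold_def)

lemma chart_at:
  assumes "x \<in> topspace M" obtains U \<phi> where "(U, \<phi>) \<in> \<C>" "x \<in> U"
  using assms manifold unfolding smooth_manifold_def by blast

lemma chart:
  assumes "(U, \<phi>) \<in> \<C>"
  shows "openin M U" "openin (Euclidean_space m) (\<phi> ` U)"
    "homeomorphic_map (subtopology M U) (subtopology (Euclidean_space m) (\<phi> ` U)) \<phi>"
  using assms manifold unfolding smooth_manifold_def is_chart_def by auto

lemma chart_subset: "(U, \<phi>) \<in> \<C> \<Longrightarrow> U \<subseteq> topspace M"
  using chart(1) openin_subset by blast

lemma chart_inj:
  assumes "(U, \<phi>) \<in> \<C>" shows "inj_on \<phi> U"
  using chart(3)[OF assms] chart_subset[OF assms]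
  by (auto simp: homeomorphic_eq_everything_map inf_absorb2)

lemma chart_inv: "(U, \<phi>) \<in> \<C> \<Longrightarrow> x \<in> U \<Longrightarrow> inv_into U \<phi> (\<phi> x) = x"
  by (simp add: chart_inj inv_into_f_f)

lemma chart_model: "(U, \<phi>) \<in> \<C> \<Longrightarrow> x \<in> U \<Longrightarrow> \<phi> x \<in> model_space m"
  using chart(2) openin_subset by blast

lemma chart_image_open:
  assumes c: "(U, \<phi>) \<in> \<C>" and W: "openin M W" "W \<subseteq> U"
  shows "openin (Euclidean_space m) (\<phi> ` W)"
proof -
  have "openin (subtopology M U) W" using W by (simp add: openin_open_subtopology chart(1)[OF c])
  then have "openin (subtopology (Euclidean_space m) (\<phi> ` U)) (\<phi> ` W)"
    using homeomorphic_imp_open_map[OF chart(3)[OF c]] by (simp add: open_map_def)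
  then show ?thesis using chart(2)[OF c] openin_trans_full by blast
qed

lemma chart_continuous:
  assumes c: "(U, \<phi>) \<in> \<C>" shows "continuous_map (subtopology M U) (Euclidean_space m) \<phi>"
  using homeomorphic_imp_continuous_map[OF chart(3)[OF c]] by (simp add: continuous_map_in_subtopology)

lemma chart_preimage_open:
  assumes c: "(U, \<phi>) \<in> \<C>" and T: "openin (Euclidean_space m) T"
  shows "openin M {x \<in> U. \<phi> x \<in> T}"
proof -
  from openin_continuous_map_preimage[OF chart_continuous[OF c] T]
  have "openin (subtopology M U) {x \<in> U. \<phi> x \<in> T}"
    using chart_subset[OF c] by (simp add: inf_absorb2)
  then show ?thesis using chart(1)[OF c] openin_trans_full by blast
qed

lemma chart_inv_continuous:
  assumes c: "(U, \<phi>) \<in> \<C>"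
  shows "continuous_map (subtopology (Euclidean_space m) (\<phi> ` U)) M (inv_into U \<phi>)"
  unfolding continuous_map_def
proof (intro conjI allI impI)
  show "inv_into U \<phi> \<in> topspace (subtopology (Euclidean_space m) (\<phi> ` U)) \<rightarrow> topspace M"
    using chart_subset[OF c] inv_into_into[of _ \<phi> U] by auto
  fix W assume W: "openin M W"
  have "{p \<in> topspace (subtopology (Euclidean_space m) (\<phi> ` U)). inv_into U \<phi> p \<in> W} = \<phi> ` (U \<inter> W)"
    using chart_inv[OF c] chart_model[OF c] by auto
  moreover have "openin (Euclidean_space m) (\<phi> ` (U \<inter> W))"
    by (rule chart_image_open[OF c]) (use W chart(1)[OF c] in auto)
  ultimately show "openin (subtopology (Euclidean_space m) (\<phi> ` U))
      {p \<in> topspace (subtopology (Euclidean_space m) (\<phi> ` U)). inv_into U \<phi> p \<in> W}"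
    using chart(2)[OF c] by (auto simp: openin_open_subtopology)
qed

lemma SF_chart: "f \<in> SF \<Longrightarrow> (U, \<phi>) \<in> \<C> \<Longrightarrow> smooth_on m (\<phi> ` U) (\<lambda>p. f (inv_into U \<phi> p))"
  by (auto simp: smooth_functions_def)

text \<open>
  It suffices to test smoothness in one chart around each point: in any other chart the function is
  composed with a transition map.
\<close>
lemma SF_localI:
  assumes out: "\<And>x. x \<notin> topspace M \<Longrightarrow> f x = 0"
    and loc: "\<And>x. x \<in> topspace M \<Longrightarrow> \<exists>U \<phi> W. (U, \<phi>) \<in> \<C> \<and> openin M W \<and> x \<in> W \<and> W \<subseteq> U \<and>
       smooth_on m (\<phi> ` W) (\<lambda>p. f (inv_into U \<phi> p))"
  shows "f \<in> SF"
proof -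
  have "smooth_on m (\<psi> ` V) (\<lambda>p. f (inv_into V \<psi> p))" if d: "(V, \<psi>) \<in> \<C>" for V \<psi>
  proof (rule smooth_on_local[OF chart(2)[OF d]])
    fix p assume "p \<in> \<psi> ` V"
    then obtain x where x: "x \<in> V" "p = \<psi> x" by blast
    then obtain U \<phi> W where c: "(U, \<phi>) \<in> \<C>" and W: "openin M W" "x \<in> W" "W \<subseteq> U"
      and sm: "smooth_on m (\<phi> ` W) (\<lambda>p. f (inv_into U \<phi> p))"
      using loc[of x] chart_subset[OF d] by blast
    let ?S = "\<psi> ` (V \<inter> W)"
    have S: "openin (Euclidean_space m) ?S"
      by (rule chart_image_open[OF d]) (use W chart(1)[OF d] in auto)
    have "smooth_on m ?S (\<lambda>p. (\<lambda>p. f (inv_into U \<phi> p)) (\<phi> (inv_into V \<psi> p)))"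
    proof (rule smooth_on_compose[OF S chart_image_open[OF c W(1,3)] _ sm])
      show "\<phi> (inv_into V \<psi> q) \<in> \<phi> ` W" if "q \<in> ?S" for q
        using that chart_inv[OF d] by auto
      show "smooth_on m ?S (\<lambda>q. \<phi> (inv_into V \<psi> q) j)" if "j < m" for j
      proof -
        have "smoothly_compatible m (V, \<psi>) (U, \<phi>)"
          using manifold c d unfolding smooth_manifold_def by blast
        then have "smooth_on m (\<psi> ` (V \<inter> U)) (\<lambda>q. \<phi> (inv_into V \<psi> q) j)"
          using that by (simp add: smoothly_compatible_def)
        then show ?thesis by (rule smooth_on_subset) (use W(3) in blast)
      qed
    qed
    then have "smooth_on m ?S (\<lambda>p. f (inv_into V \<psi> p))"
      by (rule smooth_on_cong[OF S, rotated]) (use W(3) chart_inv[OF c] chart_inv[OF d] in auto)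
    then show "\<exists>T. openin (Euclidean_space m) T \<and> p \<in> T \<and> smooth_on m T (\<lambda>p. f (inv_into V \<psi> p))"
      using S x W(2) by blast
  qed
  then show ?thesis using out by (auto simp: smooth_functions_def)
qed

text \<open>
  The support condition is compactness of \<open>K\<close>. Its preimage in \<open>U\<close> is compact, hence closed in the
  Hausdorff space \<open>M\<close>. So \<open>M\<close> is covered by two open sets: on one the function is \<open>h \<circ> \<phi>\<close>, on the
  other it is zero.
\<close>
lemma SF_extend_by_zero:
  assumes c: "(U, \<phi>) \<in> \<C>" and T: "openin (Euclidean_space m) T" "T \<subseteq> \<phi> ` U"
    and K: "compactin (Euclidean_space m) K" "K \<subseteq> T"
    and h: "smooth_on m T h" and h0: "\<And>p. p \<in> T \<Longrightarrow> p \<notin> K \<Longrightarrow> h p = 0"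
  shows "(\<lambda>x. if x \<in> U \<and> \<phi> x \<in> T then h (\<phi> x) else 0) \<in> SF" (is "?F \<in> SF")
proof (rule SF_localI)
  show "?F x = 0" if "x \<notin> topspace M" for x
  proof -
    have "x \<notin> U" using that chart_subset[OF c] by blast
    then show ?thesis by simp
  qed
  fix x assume x: "x \<in> topspace M"
  show "\<exists>U \<phi> W. (U, \<phi>) \<in> \<C> \<and> openin M W \<and> x \<in> W \<and> W \<subseteq> U \<and> smooth_on m (\<phi> ` W) (\<lambda>p. ?F (inv_into U \<phi> p))"
  proof (cases "x \<in> U \<and> \<phi> x \<in> T")
    case True
    let ?W = "{x \<in> U. \<phi> x \<in> T}"
    have W: "openin M ?W" by (rule chart_preimage_open[OF c T(1)])
    have "smooth_on m (\<phi> ` ?W) h" by (rule smooth_on_subset[OF h]) auto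
    then have "smooth_on m (\<phi> ` ?W) (\<lambda>p. ?F (inv_into U \<phi> p))"
      by (rule smooth_on_cong[OF chart_image_open[OF c W], rotated 2]) (auto simp: chart_inv[OF c])
    then show ?thesis using c W True by blast
  next
    case False
    let ?K = "inv_into U \<phi> ` K"
    have "compactin (subtopology (Euclidean_space m) (\<phi> ` U)) K"
      using K T by (auto simp: compactin_subtopology)
    then have "compactin M ?K" by (rule image_compactin[OF _ chart_inv_continuous[OF c]])
    then have "closedin M ?K" by (rule compactin_imp_closedin[OF Hausdorff])
    obtain V \<psi> where d: "(V, \<psi>) \<in> \<C>" "x \<in> V" by (rule chart_at[OF x])
    let ?W = "V - ?K"
    have W: "openin M ?W" using chart(1)[OF d(1)] \<open>closedin M ?K\<close> by blast
    have F0: "?F y = 0" if "y \<notin> ?K" for y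
      using that h0[of "\<phi> y"] chart_inv[OF c, of y] by (auto simp: image_iff) metis
    have "smooth_on m (\<psi> ` ?W) (\<lambda>p. ?F (inv_into V \<psi> p))"
    proof (rule smooth_on_cong[OF chart_image_open[OF d(1) W] _ smooth_on_const[OF chart_image_open[OF d(1) W], of 0]])
      fix p assume "p \<in> \<psi> ` ?W"
      then obtain y where y: "y \<in> V" "y \<notin> ?K" "p = \<psi> y" by blast
      then have e: "inv_into V \<psi> p = y" by (simp add: chart_inv[OF d(1)])
      show "0 = ?F (inv_into V \<psi> p)" unfolding e using F0[OF y(2)] by (rule sym)
    qed auto
    moreover have "x \<notin> ?K"
    proof
      assume "x \<in> ?K"
      then obtain p where p: "p \<in> K" "x = inv_into U \<phi> p" by blast
      then have "p \<in> \<phi> ` U" "p \<in> T" using K T by auto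
      then show False using False p inv_into_into[of p \<phi> U] f_inv_into_f[of p \<phi> U] by auto
    qed
    ultimately show ?thesis using d W by blast
  qed
qed

text \<open>
  One neighbourhood \<open>W\<close> serves all \<open>h\<close>, since the same bump function cuts off all of them. This allows
  identities between several germs to be realised by global functions.
\<close>
lemma SF_realize_germs:
  assumes c: "(U, \<phi>) \<in> \<C>" and y: "y \<in> U" and T: "openin (Euclidean_space m) T" "\<phi> y \<in> T"
  obtains W where "openin M W" "y \<in> W" "W \<subseteq> U" "\<And>z. z \<in> W \<Longrightarrow> \<phi> z \<in> T"
    "\<And>h. smooth_on m T h \<Longrightarrow> \<exists>f\<in>SF. \<forall>z\<in>W. f z = h (\<phi> z)"
proof -
  let ?T = "T \<inter> \<phi> ` U"
  have T': "openin (Euclidean_space m) ?T" "\<phi> y \<in> ?T" using T y chart(2)[OF c] by auto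
  obtain \<beta> K V where b: "smooth_on m (model_space m) \<beta>" "compactin (Euclidean_space m) K" "K \<subseteq> ?T"
    "openin (Euclidean_space m) V" "\<phi> y \<in> V" "V \<subseteq> K"
    "\<And>p. p \<in> V \<Longrightarrow> \<beta> p = 1" "\<And>p. p \<in> model_space m \<Longrightarrow> p \<notin> K \<Longrightarrow> \<beta> p = 0"
    using bump_function[OF T'] by blast
  have sub: "?T \<subseteq> model_space m" using openin_subset[OF T'(1)] .
  show thesis
  proof (rule that[OF chart_preimage_open[OF c b(4)]])
    show "y \<in> {x \<in> U. \<phi> x \<in> V}" using y b(5) by simp
    show "\<phi> z \<in> T" if "z \<in> {x \<in> U. \<phi> x \<in> V}" for z using that b(3,6) by auto
    fix h assume h: "smooth_on m T h"
    let ?h = "\<lambda>p. \<beta> p * h p"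
    have "smooth_on m ?T ?h"
      by (rule smooth_on_mult[OF T'(1)]) (use b(1) h sub in \<open>auto intro: smooth_on_subset\<close>)
    define F where "F x = (if x \<in> U \<and> \<phi> x \<in> ?T then ?h (\<phi> x) else 0)" for x
    from SF_extend_by_zero[OF c T'(1) _ b(2,3) \<open>smooth_on m ?T ?h\<close>]
    have "F \<in> SF" using b(8) sub unfolding F_def[abs_def] by auto
    moreover have "\<forall>z\<in>{x \<in> U. \<phi> x \<in> V}. F z = h (\<phi> z)"
      using b(3,6,7) by (auto simp: F_def)
    ultimately show "\<exists>f\<in>SF. \<forall>z\<in>{x \<in> U. \<phi> x \<in> V}. f z = h (\<phi> z)" by blast
  qed auto
qed

lemma SF_bump:
  assumes W: "openin M W" and y: "y \<in> W"
  obtains f where "f \<in> SF" "f y = 1" "\<And>z. z \<notin> W \<Longrightarrow> f z = 0"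
proof -
  have "y \<in> topspace M" using openin_subset[OF W] y by blast
  then obtain U \<phi> where c: "(U, \<phi>) \<in> \<C>" and yU: "y \<in> U" by (rule chart_at)
  let ?T = "\<phi> ` (U \<inter> W)"
  have T: "openin (Euclidean_space m) ?T"
    by (rule chart_image_open[OF c]) (use W chart(1)[OF c] in auto)
  have \<phi>y: "\<phi> y \<in> ?T" using y yU by blast
  obtain \<beta> K V where b: "smooth_on m (model_space m) \<beta>" "compactin (Euclidean_space m) K" "K \<subseteq> ?T"
    "openin (Euclidean_space m) V" "\<phi> y \<in> V" "V \<subseteq> K"
    "\<And>p. p \<in> V \<Longrightarrow> \<beta> p = 1" "\<And>p. p \<in> model_space m \<Longrightarrow> p \<notin> K \<Longrightarrow> \<beta> p = 0"
    using bump_function[OF T \<phi>y] by blast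
  have sub: "?T \<subseteq> model_space m" using openin_subset[OF T] .
  from SF_extend_by_zero[OF c T _ b(2,3) smooth_on_subset[OF b(1) sub]]
  have F: "(\<lambda>x. if x \<in> U \<and> \<phi> x \<in> ?T then \<beta> (\<phi> x) else 0) \<in> SF" using b(8) sub by blast
  show thesis
  proof (rule that[OF F])
    show "(if y \<in> U \<and> \<phi> y \<in> ?T then \<beta> (\<phi> y) else 0) = 1" using y yU b(5,7) by auto
    show "(if z \<in> U \<and> \<phi> z \<in> ?T then \<beta> (\<phi> z) else 0) = 0" if "z \<notin> W" for z
      using that chart_inj[OF c] by (auto simp: inj_on_def)
  qed
qed

lemma SF_add: "f \<in> SF \<Longrightarrow> g \<in> SF \<Longrightarrow> (\<lambda>x. f x + g x) \<in> SF"
  using chart(2) by (auto simp: smooth_functions_def intro!: smooth_on_add)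

lemma SF_mult: "f \<in> SF \<Longrightarrow> g \<in> SF \<Longrightarrow> (\<lambda>x. f x * g x) \<in> SF"
  using chart(2) by (auto simp: smooth_functions_def intro!: smooth_on_mult)

lemma SF_cmult: "f \<in> SF \<Longrightarrow> (\<lambda>x. c * f x) \<in> SF"
  using chart(2) by (auto simp: smooth_functions_def intro!: smooth_on_mult smooth_on_const)

lemma SF_one: "indicator (topspace M) \<in> SF"
proof -
  have "smooth_on m (\<phi> ` U) (\<lambda>p. indicator (topspace M) (inv_into U \<phi> p))" if c: "(U, \<phi>) \<in> \<C>" for U \<phi>
    by (rule smooth_on_cong[OF chart(2)[OF c] _ smooth_on_const[OF chart(2)[OF c], of 1]])
       (use chart_subset[OF c] chart_inv[OF c] in auto)
  then show ?thesis by (auto simp: smooth_functions_def)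
qed

end

section \<open>Weil algebras\<close>

locale weil_algebra_loc =
  fixes N :: "'b::{comm_ring_1,real_algebra_1} set"
  assumes weil: "weil_algebra N"
begin

lemma N_ideal: "algebra_ideal N"
  using weil unfolding weil_algebra_def maximal_algebra_ideal_def by (elim conjE)

lemma N_subspace: "subspace N" and N_mult: "x \<in> N \<Longrightarrow> a * x \<in> N"
  using N_ideal by (simp_all add: algebra_ideal_def)

lemma scalar_part_ex1: "\<exists>!c. a - of_real c \<in> N"
proof -
  have "\<forall>a. \<exists>!c. a - of_real c \<in> N" using weil unfolding weil_algebra_def by (elim conjE)
  then show ?thesis by (rule spec)
qed

lemma real_part_eqI: "a - of_real c \<in> N \<Longrightarrow> real_part N a = c"
  unfolding real_part_def by (rule the1_equality[OF scalar_part_ex1])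

lemma real_part_diff: "a - of_real (real_part N a) \<in> N"
  unfolding real_part_def by (rule theI'[OF scalar_part_ex1])

lemma real_part_of_real_add: "n \<in> N \<Longrightarrow> real_part N (of_real c + n) = c"
  by (rule real_part_eqI) simp

lemma real_part_add: "real_part N (a + b) = real_part N a + real_part N b"
proof (rule real_part_eqI)
  have "(a - of_real (real_part N a)) + (b - of_real (real_part N b)) \<in> N"
    by (intro subspace_add[OF N_subspace] real_part_diff)
  then show "a + b - of_real (real_part N a + real_part N b) \<in> N" by (simp add: algebra_simps)
qed

lemma real_part_scaleR: "real_part N (c *\<^sub>R a) = c * real_part N a"
proof (rule real_part_eqI)
  have "c *\<^sub>R (a - of_real (real_part N a)) \<in> N"
    by (intro subspace_scale[OF N_subspace] real_part_diff)
  then show "c *\<^sub>R a - of_real (c * real_part N a) \<in> N"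
    by (simp add: scaleR_diff_right of_real_def)
qed

lemma linear_real_part: "linear (real_part N)"
  by (rule linearI) (simp_all add: real_part_add real_part_scaleR)

lemma mem_N_iff: "a \<in> N \<longleftrightarrow> real_part N a = 0"
  using real_part_eqI[of a 0] real_part_diff[of a] by auto

lemma ideal_power_0: "ideal_power N 0 = span {1}"
proof -
  have "{prod_list xs |xs. length xs = 0 \<and> set xs \<subseteq> N} = {1}" by auto
  then show ?thesis by (simp add: ideal_power_def)
qed

lemma subspace_ideal_power: "subspace (ideal_power N k)"
  by (simp add: ideal_power_def)

lemma ideal_power_Suc_mult:
  assumes n: "n \<in> N" and x: "x \<in> ideal_power N k"
  shows "n * x \<in> ideal_power N (Suc k)"
  using x unfolding ideal_power_def[of N k]
proof (induction rule: span_induct)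
  case base
  show "subspace {x. n * x \<in> ideal_power N (Suc k)}"
    using subspace_ideal_power[of "Suc k"] by (auto simp: subspace_def distrib_left)
next
  case (step x)
  then obtain xs where "x = prod_list xs" "length xs = k" "set xs \<subseteq> N" by auto
  then have "n * x = prod_list (n # xs)" "length (n # xs) = Suc k" "set (n # xs) \<subseteq> N" using n by auto
  then show "n * x \<in> ideal_power N (Suc k)" unfolding ideal_power_def by (intro span_base) blast
qed

lemma N_in_ideal_power_1: "n \<in> N \<Longrightarrow> n \<in> ideal_power N (Suc 0)"
  using ideal_power_Suc_mult[of n 1 0] by (simp add: ideal_power_0 span_base)

lemma ideal_power_mult:
  assumes x: "x \<in> ideal_power N i" and y: "y \<in> ideal_power N j"
  shows "x * y \<in> ideal_power N (i + j)"
  using x unfolding ideal_power_def[of N i]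
proof (induction rule: span_induct)
  case base
  show "subspace {x. x * y \<in> ideal_power N (i + j)}"
    using subspace_ideal_power[of "i + j"] by (auto simp: subspace_def distrib_right)
next
  case (step x)
  then obtain xs where xs: "x = prod_list xs" "length xs = i" "set xs \<subseteq> N" by auto
  have "prod_list xs * y \<in> ideal_power N (length xs + j)" using xs(3)
    by (induction xs) (simp_all add: y ideal_power_Suc_mult mult.assoc)
  then show "x * y \<in> ideal_power N (i + j)" using xs by simp
qed

lemma ideal_power_vanish_mono:
  assumes "ideal_power N k = {0}" "k \<le> l" shows "ideal_power N l = {0}"
  using assms(2)
proof (induction rule: dec_induct)
  case (step l)
  have "prod_list xs = 0" if xs: "length xs = Suc l" "set xs \<subseteq> N" for xs
  proof -
    obtain a as where as: "xs = a # as" using xs(1) by (cases xs) auto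
    then have "prod_list as \<in> ideal_power N l"
      using xs unfolding ideal_power_def by (intro span_base) auto
    then show ?thesis using step as by simp
  qed
  then have "{prod_list xs |xs. length xs = Suc l \<and> set xs \<subseteq> N} \<subseteq> {0}" by auto
  then have "ideal_power N (Suc l) \<subseteq> {0}"
    unfolding ideal_power_def by (rule span_minimal) (rule subspace_single_0)
  then show ?case using subspace_0[OF subspace_ideal_power, of "Suc l"] by blast
qed (rule assms(1))

text \<open>
  An exponent beyond which all powers of \<open>N\<close> vanish. It need not be the least one. The bound
  \<open>r \<ge> 1\<close> ensures that sums up to \<open>height\<close> contain the terms of order one, which carry the displacement.
\<close>
definition height :: nat where "height = (SOME r. r \<ge> 1 \<and> ideal_power N (r + 1) = {0})"

lemma height: "height \<ge> 1" "ideal_power N (height + 1) = {0}"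
proof -
  have "\<exists>r. r \<ge> 1 \<and> ideal_power N (r + 1) = {0}" using weil unfolding weil_algebra_def by (elim conjE)
  from someI_ex[OF this] show "height \<ge> 1" "ideal_power N (height + 1) = {0}"
    by (auto simp: height_def)
qed

lemma ideal_power_zero: "x \<in> ideal_power N k \<Longrightarrow> k > height \<Longrightarrow> x = 0"
  using ideal_power_vanish_mono[OF height(2), of k] by auto

text \<open>
  Elements of real part 1 are units. Here \<open>b = (1 - a) * b\<close>, and iterating this multiplies \<open>b\<close> by
  arbitrarily high powers of a nilpotent element.
\<close>
lemma one_plus_nilpotent_cancel:
  assumes a: "a - 1 \<in> N" and ab: "a * b = 0"
  shows "b = 0"
proof -
  let ?n = "1 - a"
  have n: "?n \<in> N" using subspace_neg[OF N_subspace a] by simp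
  have bn: "b = ?n * b" using ab by (simp add: algebra_simps)
  have "b = ?n ^ k * b" for k by (induction k) (use bn in \<open>simp_all add: mult.assoc\<close>)
  moreover have "?n ^ k \<in> ideal_power N k" for k
    by (induction k) (simp_all add: ideal_power_0 span_base ideal_power_Suc_mult[OF n])
  ultimately show ?thesis using ideal_power_zero[of _ "height + 1"]
    by (metis less_add_one mult_zero_left)
qed

lemma algebra_basis_with_one: obtains B :: "'b set" where "algebra_basis B" "1 \<in> B"
proof -
  obtain B0 :: "'b set" where B0: "finite B0" "span B0 = UNIV"
    using weil unfolding weil_algebra_def algebra_basis_def by blast
  have i: "independent {1::'b}" by simp
  let ?B = "extend_basis {1::'b}"
  have "independent ?B" "span ?B = UNIV" "{1} \<subseteq> ?B"
    using independent_extend_basis[OF i] span_extend_basis[OF i] extend_basis_superset[OF i] by auto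
  moreover from this have "finite ?B" using independent_span_bound[OF B0(1), of ?B] B0(2) by auto
  ultimately show ?thesis using that[of ?B] by (auto simp: algebra_basis_def)
qed

end

section \<open>Exponentials of nilpotent derivations\<close>

text \<open>
  \<open>jet m n j f p\<close> is \<open>(D\<^sup>j f)(p) / j!\<close> for the derivation \<open>D = \<Sum> n\<^sub>i \<partial>\<^sub>i\<close> with constant coefficients in
  the algebra. Since \<open>D\<close> turns real functions into algebra-valued ones, the recursion differentiates
  the real function \<open>f\<close> and keeps the coefficients outside.
\<close>
primrec jet :: "nat \<Rightarrow> (nat \<Rightarrow> 'b::{comm_ring_1,real_algebra_1}) \<Rightarrow> nat \<Rightarrow> ((nat \<Rightarrow> real) \<Rightarrow> real) \<Rightarrow> (nat \<Rightarrow> real) \<Rightarrow> 'b" where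
  "jet m n 0 f p = of_real (f p)"
| "jet m n (Suc j) f p = inverse (real (Suc j)) *\<^sub>R (\<Sum>i<m. n i * jet m n j (pd i f) p)"

lemma jet_cong:
  assumes S: "openin (Euclidean_space m) S" and eq: "\<And>x. x \<in> S \<Longrightarrow> f x = g x" and p: "p \<in> S"
  shows "jet m n j f p = jet m n j g p"
  using eq
proof (induction j arbitrary: f g)
  case (Suc j)
  have "jet m n j (pd i f) p = jet m n j (pd i g) p" if "i < m" for i
    by (rule Suc.IH) (rule pd_cong[OF S that _ Suc.prems])
  then show ?case by simp
qed (use p in simp)

lemma jet_zero: "jet m n j (\<lambda>_. 0) p = 0"
proof (induction j)
  case (Suc j)
  have "pd i (\<lambda>_. 0) = (\<lambda>_. 0)" for i by (rule ext) (rule pd_const)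
  then show ?case using Suc by simp
qed simp

lemma jet_const: "jet m n j (\<lambda>_. c) p = (if j = 0 then of_real c else 0)"
proof (cases j)
  case (Suc k)
  have "pd i (\<lambda>_. c) = (\<lambda>_. 0)" for i by (rule ext) (rule pd_const)
  then show ?thesis by (simp add: Suc jet_zero)
qed simp

lemma jet_coord:
  assumes l: "l < m"
  shows "jet m n j (\<lambda>x. x l) p = (if j = 0 then of_real (p l) else if j = 1 then n l else 0)"
proof (cases j)
  case (Suc k)
  have "pd i (\<lambda>x. x l) = (\<lambda>_. if i = l then 1 else 0)" for i by (rule ext) (rule pd_coord)
  then have "(\<Sum>i<m. n i * jet m n k (pd i (\<lambda>x. x l)) p) = (\<Sum>i<m. if i = l then n i * jet m n k (\<lambda>_. 1) p else 0)"
    by (intro sum.cong) (simp_all add: jet_const)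
  also have "\<dots> = n l * jet m n k (\<lambda>_. 1) p" using l by simp
  finally show ?thesis by (simp add: Suc jet_const)
qed simp

lemma jet_add:
  assumes S: "openin (Euclidean_space m) S" and p: "p \<in> S"
  shows "smooth_on m S f \<Longrightarrow> smooth_on m S g \<Longrightarrow> jet m n j (\<lambda>x. f x + g x) p = jet m n j f p + jet m n j g p"
proof (induction j arbitrary: f g)
  case (Suc j)
  have "jet m n j (pd i (\<lambda>x. f x + g x)) p = jet m n j (pd i f) p + jet m n j (pd i g) p" if i: "i < m" for i
  proof -
    have "jet m n j (pd i (\<lambda>x. f x + g x)) p = jet m n j (\<lambda>x. pd i f x + pd i g x) p"
      by (rule jet_cong[OF S _ p]) (rule pd_add[OF S Suc.prems i])
    also have "\<dots> = jet m n j (pd i f) p + jet m n j (pd i g) p"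
      by (rule Suc.IH) (use smooth_on_pd(1)[OF S _ i] Suc.prems in blast)+
    finally show ?thesis .
  qed
  then show ?case by (simp add: distrib_left sum.distrib scaleR_right_distrib)
qed simp

text \<open>
  The combinatorial part of the Leibniz rule for divided powers: as
  \<open>b + (k + 1 - b) = k + 1\<close>, the terms obtained by differentiating either factor add up to
  \<open>k + 1\<close> times the next convolution.
\<close>
lemma Leibniz_convolution:
  fixes F G :: "nat \<Rightarrow> 'b::real_algebra"
  shows "(\<Sum>a\<le>k. real (Suc a) *\<^sub>R (F (Suc a) * G (k - a))) + (\<Sum>a\<le>k. real (Suc (k - a)) *\<^sub>R (F a * G (Suc (k - a))))
       = real (Suc k) *\<^sub>R (\<Sum>b\<le>Suc k. F b * G (Suc k - b))"
proof -
  have "(\<Sum>a\<le>k. real (Suc a) *\<^sub>R (F (Suc a) * G (k - a))) = (\<Sum>b\<le>Suc k. real b *\<^sub>R (F b * G (Suc k - b)))"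
    unfolding sum.atMost_Suc_shift by simp
  moreover have "(\<Sum>a\<le>k. real (Suc (k - a)) *\<^sub>R (F a * G (Suc (k - a)))) = (\<Sum>b\<le>Suc k. real (Suc k - b) *\<^sub>R (F b * G (Suc k - b)))"
    by (simp add: Suc_diff_le add_diff_eq)
  moreover have "(\<Sum>b\<le>Suc k. real b *\<^sub>R (F b * G (Suc k - b))) + (\<Sum>b\<le>Suc k. real (Suc k - b) *\<^sub>R (F b * G (Suc k - b)))
     = (\<Sum>b\<le>Suc k. real (Suc k) *\<^sub>R (F b * G (Suc k - b)))"
    unfolding sum.distrib[symmetric] scaleR_left_distrib[symmetric]
    by (intro sum.cong) (auto simp: of_nat_diff)
  ultimately show ?thesis unfolding scaleR_sum_right by metis
qed

lemma jet_Suc_scaled: "real (Suc j) *\<^sub>R jet m n (Suc j) f p = (\<Sum>i<m. n i * jet m n j (pd i f) p)"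
  by (simp del: of_nat_Suc)

lemma jet_mult:
  assumes S: "openin (Euclidean_space m) S" and p: "p \<in> S"
  shows "smooth_on m S f \<Longrightarrow> smooth_on m S g \<Longrightarrow>
    jet m n k (\<lambda>x. f x * g x) p = (\<Sum>a\<le>k. jet m n a f p * jet m n (k - a) g p)"
proof (induction k arbitrary: f g)
  case (Suc k)
  have step: "jet m n k (pd i (\<lambda>x. f x * g x)) p
     = (\<Sum>a\<le>k. jet m n a (pd i f) p * jet m n (k - a) g p) + (\<Sum>a\<le>k. jet m n a f p * jet m n (k - a) (pd i g) p)"
    if i: "i < m" for i
  proof -
    have sf: "smooth_on m S (pd i f)" and sg: "smooth_on m S (pd i g)" using smooth_on_pd(1)[OF S _ i] Suc.prems by blast+
    have "jet m n k (pd i (\<lambda>x. f x * g x)) p = jet m n k (\<lambda>x. pd i f x * g x + f x * pd i g x) p"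
      by (rule jet_cong[OF S _ p]) (rule pd_mult[OF S Suc.prems i])
    also have "\<dots> = jet m n k (\<lambda>x. pd i f x * g x) p + jet m n k (\<lambda>x. f x * pd i g x) p"
      by (rule jet_add[OF S p]) (rule smooth_on_mult[OF S], use sf sg Suc.prems in blast, use sf sg Suc.prems in blast)+
    finally show ?thesis using Suc.IH[OF sf Suc.prems(2)] Suc.IH[OF Suc.prems(1) sg] by simp
  qed
  have "real (Suc k) *\<^sub>R jet m n (Suc k) (\<lambda>x. f x * g x) p = (\<Sum>i<m. n i * jet m n k (pd i (\<lambda>x. f x * g x)) p)"
    by (rule jet_Suc_scaled)
  also have "\<dots> = (\<Sum>i<m. \<Sum>a\<le>k. n i * (jet m n a (pd i f) p * jet m n (k - a) g p))
        + (\<Sum>i<m. \<Sum>a\<le>k. n i * (jet m n a f p * jet m n (k - a) (pd i g) p))"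
    by (simp add: step distrib_left sum.distrib sum_distrib_left)
  also have "(\<Sum>i<m. \<Sum>a\<le>k. n i * (jet m n a (pd i f) p * jet m n (k - a) g p))
      = (\<Sum>a\<le>k. real (Suc a) *\<^sub>R (jet m n (Suc a) f p * jet m n (k - a) g p))"
    by (subst sum.swap) (simp add: jet_Suc_scaled sum_distrib_right mult.assoc flip: scaleR_scaleR mult_scaleR_left del: of_nat_Suc jet.simps)
  also have "(\<Sum>i<m. \<Sum>a\<le>k. n i * (jet m n a f p * jet m n (k - a) (pd i g) p))
      = (\<Sum>a\<le>k. real (Suc (k - a)) *\<^sub>R (jet m n a f p * jet m n (Suc (k - a)) g p))"
    by (subst sum.swap) (simp add: jet_Suc_scaled sum_distrib_left mult.left_commute flip: mult_scaleR_right del: of_nat_Suc jet.simps)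
  also have "(\<Sum>a\<le>k. real (Suc a) *\<^sub>R (jet m n (Suc a) f p * jet m n (k - a) g p))
      + (\<Sum>a\<le>k. real (Suc (k - a)) *\<^sub>R (jet m n a f p * jet m n (Suc (k - a)) g p))
      = real (Suc k) *\<^sub>R (\<Sum>a\<le>Suc k. jet m n a f p * jet m n (Suc k - a) g p)"
    by (rule Leibniz_convolution)
  finally show ?case by (simp del: of_nat_Suc jet.simps)
qed simp

lemma jet_no_displacement: "jet m (\<lambda>_. 0) j f p = (if j = 0 then of_real (f p) else 0)"
  by (cases j) simp_all

lemma (in weil_algebra_loc) jet_in_ideal_power:
  assumes n: "\<And>i. i < m \<Longrightarrow> n i \<in> N"
  shows "jet m n j f p \<in> ideal_power N j"
proof (induction j arbitrary: f)
  case 0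
  show ?case using span_scale[OF span_base[of "1::'b" "{1}"], of "f p"] by (simp add: ideal_power_0 of_real_def)
next
  case (Suc j)
  show ?case unfolding jet.simps
    by (intro subspace_scale subspace_sum subspace_ideal_power ideal_power_Suc_mult Suc) (use n in auto)
qed

text \<open>
  \<open>exp D\<close> is multiplicative because \<open>D\<close> is a derivation. Cutting the series at \<open>height\<close> is harmless:
  the products of order \<open>i + j > height\<close> lie in a vanishing power of \<open>N\<close>.
\<close>
lemma (in weil_algebra_loc) exp_jet_mult:
  assumes S: "openin (Euclidean_space m) S" and p: "p \<in> S" and f: "smooth_on m S f" and g: "smooth_on m S g"
    and n: "\<And>i. i < m \<Longrightarrow> n i \<in> N"
  shows "(\<Sum>k\<le>height. jet m n k (\<lambda>x. f x * g x) p) = (\<Sum>k\<le>height. jet m n k f p) * (\<Sum>k\<le>height. jet m n k g p)"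
proof -
  let ?F = "\<lambda>k. jet m n k f p" and ?G = "\<lambda>k. jet m n k g p"
  have "(\<Sum>k\<le>height. ?F k) * (\<Sum>k\<le>height. ?G k) = (\<Sum>(i,j)\<in>{..height} \<times> {..height}. ?F i * ?G j)"
    by (simp add: sum_product sum.cartesian_product)
  also have "\<dots> = (\<Sum>(i,j)\<in>{(i,j). i + j \<le> height}. ?F i * ?G j)"
  proof (rule sum.mono_neutral_right)
    have "?F i * ?G j = 0" if "i + j > height" for i j
      by (rule ideal_power_zero[OF ideal_power_mult[OF jet_in_ideal_power jet_in_ideal_power] that]) (simp_all add: n)
    then show "\<forall>z\<in>{..height} \<times> {..height} - {(i,j). i + j \<le> height}. (case z of (i,j) \<Rightarrow> ?F i * ?G j) = 0"
      by (clarsimp simp: not_le[symmetric]) (metis not_le)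
  qed auto
  also have "\<dots> = (\<Sum>k\<le>height. \<Sum>i\<le>k. ?F i * ?G (k - i))" by (rule sum.triangle_reindex_eq)
  also have "\<dots> = (\<Sum>k\<le>height. jet m n k (\<lambda>x. f x * g x) p)" by (simp add: jet_mult[OF S p f g])
  finally show ?thesis by simp
qed

section \<open>Points of the Weil bundle\<close>

locale weil_bundle_loc = smooth_manifold_loc m M \<C> + weil_algebra_loc N
  for m :: nat and M :: "'a topology" and \<C> :: "'a chart set"
    and N :: "'b::{comm_ring_1,real_algebra_1} set"
begin

abbreviation fibre :: "'a \<Rightarrow> (('a \<Rightarrow> real) \<Rightarrow> 'b) set" where "fibre \<equiv> weil_fibre m M \<C> N"
abbreviation WB :: "(('a \<Rightarrow> real) \<Rightarrow> 'b) set" where "WB \<equiv> weil_bundle m M \<C> N"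
abbreviation proj :: "(('a \<Rightarrow> real) \<Rightarrow> 'b) \<Rightarrow> 'a" where "proj \<equiv> weil_proj m M \<C> N"
abbreviation evl :: "(('a \<Rightarrow> real) \<Rightarrow> 'b) \<Rightarrow> ('a \<Rightarrow> real) \<Rightarrow> 'b" where "evl \<equiv> weil_eval m M \<C> N"

lemma fibreD:
  assumes "\<xi> \<in> fibre x"
  shows "\<xi> \<in> extensional SF"
    and "f \<in> SF \<Longrightarrow> g \<in> SF \<Longrightarrow> \<xi> (\<lambda>x. f x + g x) = \<xi> f + \<xi> g"
    and "f \<in> SF \<Longrightarrow> g \<in> SF \<Longrightarrow> \<xi> (\<lambda>x. f x * g x) = \<xi> f * \<xi> g"
    and "f \<in> SF \<Longrightarrow> \<xi> (\<lambda>x. c * f x) = c *\<^sub>R \<xi> f"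
    and "\<xi> (indicator (topspace M)) = 1"
    and "f \<in> SF \<Longrightarrow> real_part N (\<xi> f) = f x"
  using assms by (auto simp: weil_fibre_def algebra_morphisms_def)

lemma fibreI:
  assumes "\<xi> \<in> extensional SF"
    and "\<And>f g. f \<in> SF \<Longrightarrow> g \<in> SF \<Longrightarrow> \<xi> (\<lambda>x. f x + g x) = \<xi> f + \<xi> g"
    and "\<And>f g. f \<in> SF \<Longrightarrow> g \<in> SF \<Longrightarrow> \<xi> (\<lambda>x. f x * g x) = \<xi> f * \<xi> g"
    and "\<And>c f. f \<in> SF \<Longrightarrow> \<xi> (\<lambda>x. c * f x) = c *\<^sub>R \<xi> f"
    and "\<xi> (indicator (topspace M)) = 1"
    and "\<And>f. f \<in> SF \<Longrightarrow> real_part N (\<xi> f) = f x"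
  shows "\<xi> \<in> fibre x"
  using assms by (auto simp: weil_fibre_def algebra_morphisms_def)

lemma fibre_unique_base:
  assumes "\<xi> \<in> fibre x" "\<xi> \<in> fibre y" "x \<in> topspace M" "y \<in> topspace M"
  shows "x = y"
proof (rule ccontr)
  assume "x \<noteq> y"
  then obtain W V where W: "openin M W" "x \<in> W" "y \<in> V" "disjnt W V"
    using Hausdorff assms(3,4) unfolding Hausdorff_space_def by blast
  obtain f where f: "f \<in> SF" "f x = 1" "\<And>z. z \<notin> W \<Longrightarrow> f z = 0" using SF_bump[OF W(1,2)] by blast
  have "f y = 0" using f(3) W(3,4) by (auto simp: disjnt_iff)
  then show False using fibreD(6)[OF assms(1) f(1)] fibreD(6)[OF assms(2) f(1)] f(2) by simp
qed

lemma proj_eq: "\<xi> \<in> fibre x \<Longrightarrow> x \<in> topspace M \<Longrightarrow> proj \<xi> = x"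
  unfolding weil_proj_def by (rule the_equality) (auto intro: fibre_unique_base)

lemma in_WB: "\<xi> \<in> fibre x \<Longrightarrow> x \<in> topspace M \<Longrightarrow> \<xi> \<in> WB"
  by (auto simp: weil_bundle_def)

lemma WB_D: assumes "\<xi> \<in> WB" shows "proj \<xi> \<in> topspace M" "\<xi> \<in> fibre (proj \<xi>)"
  using assms proj_eq by (auto simp: weil_bundle_def)

lemma morphism_zero: assumes "\<xi> \<in> fibre x" shows "\<xi> (\<lambda>_. 0) = 0"
  using fibreD(4)[OF assms SF_one, of 0] by simp

lemma SF_sum: "finite I \<Longrightarrow> (\<And>i. i \<in> I \<Longrightarrow> f i \<in> SF) \<Longrightarrow> (\<lambda>x. \<Sum>i\<in>I. f i x) \<in> SF"
proof (induction I rule: finite_induct)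
  case empty
  show ?case using SF_cmult[OF SF_one, of 0] by simp
next
  case (insert i I)
  then show ?case using SF_add[of "f i" "\<lambda>x. \<Sum>i\<in>I. f i x"] by simp
qed

lemma morphism_sum:
  assumes \<xi>: "\<xi> \<in> fibre x"
  shows "finite I \<Longrightarrow> (\<And>i. i \<in> I \<Longrightarrow> f i \<in> SF) \<Longrightarrow> \<xi> (\<lambda>x. \<Sum>i\<in>I. f i x) = (\<Sum>i\<in>I. \<xi> (f i))"
proof (induction I rule: finite_induct)
  case empty
  show ?case using morphism_zero[OF \<xi>] by simp
next
  case (insert i I)
  then show ?case using fibreD(2)[OF \<xi>, of "f i" "\<lambda>x. \<Sum>i\<in>I. f i x"] SF_sum[of I f] by simp
qed

text \<open>
  If \<open>f - g\<close> vanishes near \<open>x\<close>, a bump function \<open>\<beta>\<close> at \<open>x\<close> annihilates it, while \<open>\<xi>(\<beta>)\<close> has real part 1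
  and can be cancelled.
\<close>
lemma morphism_germ:
  assumes \<xi>: "\<xi> \<in> fibre x" and f: "f \<in> SF" and g: "g \<in> SF"
    and W: "openin M W" "x \<in> W" and eq: "\<And>z. z \<in> W \<Longrightarrow> f z = g z"
  shows "\<xi> f = \<xi> g"
proof -
  obtain \<beta> where b: "\<beta> \<in> SF" "\<beta> x = 1" "\<And>z. z \<notin> W \<Longrightarrow> \<beta> z = 0" using SF_bump[OF W] by blast
  let ?d = "\<lambda>z. f z + (-1) * g z"
  have d: "?d \<in> SF" by (rule SF_add[OF f SF_cmult[OF g]])
  have "(\<lambda>z. \<beta> z * ?d z) = (\<lambda>_. 0)" using eq b(3) by (auto simp: fun_eq_iff)
  then have "\<xi> \<beta> * \<xi> ?d = 0" using fibreD(3)[OF \<xi> b(1) d] morphism_zero[OF \<xi>] by simp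
  moreover have "\<xi> \<beta> - 1 \<in> N" using real_part_diff[of "\<xi> \<beta>"] fibreD(6)[OF \<xi> b(1)] b(2) by simp
  ultimately have "\<xi> ?d = 0" by (rule one_plus_nilpotent_cancel[rotated])
  moreover have "\<xi> ?d = \<xi> f - \<xi> g"
    using fibreD(2)[OF \<xi> f SF_cmult[OF g, of "-1"]] fibreD(4)[OF \<xi> g, of "-1"] by simp
  ultimately show ?thesis by simp
qed

lemma evl_eq:
  assumes \<xi>: "\<xi> \<in> fibre x" and x: "x \<in> topspace M" and f: "f \<in> SF"
    and W: "openin M W" "x \<in> W" and eq: "\<And>z. z \<in> W \<Longrightarrow> f z = g z"
  shows "evl \<xi> g = \<xi> f"
  unfolding weil_eval_def proj_eq[OF \<xi> x]
proof (rule the_equality)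
  show "\<exists>f'\<in>SF. (\<exists>W. openin M W \<and> x \<in> W \<and> (\<forall>y\<in>W. f' y = g y)) \<and> \<xi> f = \<xi> f'"
    using f W eq by blast
  fix a assume "\<exists>f'\<in>SF. (\<exists>W. openin M W \<and> x \<in> W \<and> (\<forall>y\<in>W. f' y = g y)) \<and> a = \<xi> f'"
  then obtain f' W' where f': "f' \<in> SF" "openin M W'" "x \<in> W'" "\<And>y. y \<in> W' \<Longrightarrow> f' y = g y" "a = \<xi> f'"
    by blast
  have "\<xi> f' = \<xi> f"
    by (rule morphism_germ[OF \<xi> f'(1) f openin_Int[OF f'(2) W(1)]]) (use f' W eq in auto)
  then show "a = \<xi> f" using f'(5) by simp
qed

text \<open>
  The point with base \<open>y\<close> and displacement \<open>n\<close> in the chart \<open>\<phi>\<close>: apply \<open>exp D\<close> and evaluate at \<open>y\<close>.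
\<close>
definition jet_point :: "'a set \<Rightarrow> ('a \<Rightarrow> nat \<Rightarrow> real) \<Rightarrow> (nat \<Rightarrow> 'b) \<Rightarrow> 'a \<Rightarrow> ('a \<Rightarrow> real) \<Rightarrow> 'b" where
  "jet_point U \<phi> n y = (\<lambda>f\<in>SF. \<Sum>k\<le>height. jet m n k (\<lambda>p. f (inv_into U \<phi> p)) (\<phi> y))"

lemma jet_point_in_fibre:
  assumes c: "(U, \<phi>) \<in> \<C>" and y: "y \<in> U" and n: "\<And>i. i < m \<Longrightarrow> n i \<in> N"
  shows "jet_point U \<phi> n y \<in> fibre y"
proof (rule fibreI)
  note S = chart(2)[OF c]
  have p: "\<phi> y \<in> \<phi> ` U" using y by simp
  show "jet_point U \<phi> n y \<in> extensional SF" by (simp add: jet_point_def)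
  show "jet_point U \<phi> n y (\<lambda>x. f x + g x) = jet_point U \<phi> n y f + jet_point U \<phi> n y g"
    if "f \<in> SF" "g \<in> SF" for f g
    using that SF_add[OF that] by (simp add: jet_point_def jet_add[OF S p SF_chart[OF _ c] SF_chart[OF _ c]] sum.distrib)
  show mult: "jet_point U \<phi> n y (\<lambda>x. f x * g x) = jet_point U \<phi> n y f * jet_point U \<phi> n y g"
    if "f \<in> SF" "g \<in> SF" for f g
    using that SF_mult[OF that] exp_jet_mult[OF S p SF_chart[OF that(1) c] SF_chart[OF that(2) c] n]
    by (simp add: jet_point_def)
  have const: "(\<Sum>k\<le>height. jet m n k (\<lambda>p. r) q) = of_real r" for r q
    by (simp add: jet_const)
  show "jet_point U \<phi> n y (\<lambda>x. r * f x) = r *\<^sub>R jet_point U \<phi> n y f" if "f \<in> SF" for r f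
    using that SF_cmult[OF that] exp_jet_mult[OF S p smooth_on_const[OF S, of r] SF_chart[OF that c] n]
    by (simp add: jet_point_def const scaleR_conv_of_real)
  have "jet m n k (\<lambda>p. indicator (topspace M) (inv_into U \<phi> p)) (\<phi> y) = jet m n k (\<lambda>_. 1) (\<phi> y)" for k
    by (rule jet_cong[OF S _ p]) (use chart_inv[OF c] chart_subset[OF c] in auto)
  then show "jet_point U \<phi> n y (indicator (topspace M)) = 1"
    using const[of 1 "\<phi> y"] SF_one by (simp add: jet_point_def)
  fix f assume f: "f \<in> SF"
  have "(\<Sum>k\<le>height. jet m n k (\<lambda>p. f (inv_into U \<phi> p)) (\<phi> y)) =
     of_real (f y) + (\<Sum>k<height. jet m n (Suc k) (\<lambda>p. f (inv_into U \<phi> p)) (\<phi> y))"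
    by (subst sum.atMost_shift) (simp add: chart_inv[OF c y] del: jet.simps(2))
  moreover have "(\<Sum>k<height. jet m n (Suc k) (\<lambda>p. f (inv_into U \<phi> p)) (\<phi> y)) \<in> N"
    unfolding jet.simps
    by (intro subspace_sum subspace_scale N_subspace) (simp add: N_mult n mult.commute[of "n _"])
  ultimately show "real_part N (jet_point U \<phi> n y f) = f y"
    using f by (simp add: jet_point_def real_part_of_real_add)
qed

lemma evl_chart:
  assumes c: "(U, \<phi>) \<in> \<C>" and y: "y \<in> U" and \<xi>: "\<xi> \<in> fibre y"
  obtains f W where "f \<in> SF" "openin M W" "y \<in> W" "W \<subseteq> U" "\<And>z. z \<in> W \<Longrightarrow> f z = \<phi> z i" "evl \<xi> (\<lambda>z. \<phi> z i) = \<xi> f"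
proof -
  obtain W where W: "openin M W" "y \<in> W" "W \<subseteq> U"
      "\<And>h. smooth_on m (\<phi> ` U) h \<Longrightarrow> \<exists>f\<in>SF. \<forall>z\<in>W. f z = h (\<phi> z)"
    using SF_realize_germs[OF c y chart(2)[OF c]] y by (metis imageI)
  obtain f where f: "f \<in> SF" "\<And>z. z \<in> W \<Longrightarrow> f z = \<phi> z i"
    using W(4)[OF smooth_on_coord[OF chart(2)[OF c]], of i] by auto
  have "evl \<xi> (\<lambda>z. \<phi> z i) = \<xi> f"
    by (rule evl_eq[OF \<xi> _ f(1) W(1,2) f(2)]) (use y chart_subset[OF c] in blast)
  with f W show ?thesis using that by blast
qed

text \<open>
  This is the change of charts of the Weil bundle: the coordinates in \<open>\<psi>\<close> are a Taylor polynomial of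
  the transition map, evaluated at the displacement in \<open>\<phi>\<close>.
\<close>
lemma evl_jet_point:
  assumes c: "(U, \<phi>) \<in> \<C>" and d: "(V, \<psi>) \<in> \<C>" and y: "y \<in> U" "y \<in> V" and n: "\<And>i. i < m \<Longrightarrow> n i \<in> N"
  shows "evl (jet_point U \<phi> n y) (\<lambda>z. \<psi> z i) = (\<Sum>k\<le>height. jet m n k (\<lambda>p. \<psi> (inv_into U \<phi> p) i) (\<phi> y))"
proof -
  have fib: "jet_point U \<phi> n y \<in> fibre y"
    by (rule jet_point_in_fibre[OF c y(1)]) (simp add: n)
  obtain f W where f: "f \<in> SF" "openin M W" "y \<in> W" "W \<subseteq> V" "\<And>z. z \<in> W \<Longrightarrow> f z = \<psi> z i"
      "evl (jet_point U \<phi> n y) (\<lambda>z. \<psi> z i) = jet_point U \<phi> n y f"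
    using evl_chart[OF d y(2) fib, of i] by blast
  have S: "openin (Euclidean_space m) (\<phi> ` (U \<inter> W))"
    by (rule chart_image_open[OF c]) (use f(2) chart(1)[OF c] in auto)
  have "jet m n k (\<lambda>p. f (inv_into U \<phi> p)) (\<phi> y) = jet m n k (\<lambda>p. \<psi> (inv_into U \<phi> p) i) (\<phi> y)" for k
    by (rule jet_cong[OF S]) (use f(3,5) y chart_inv[OF c] in auto)
  then show ?thesis using f(1,6) by (simp add: jet_point_def)
qed

lemma evl_jet_point_same:
  assumes c: "(U, \<phi>) \<in> \<C>" and y: "y \<in> U" and n: "\<And>i. i < m \<Longrightarrow> n i \<in> N" and i: "i < m"
  shows "evl (jet_point U \<phi> n y) (\<lambda>z. \<phi> z i) = of_real (\<phi> y i) + n i"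
proof -
  have "jet m n k (\<lambda>p. \<phi> (inv_into U \<phi> p) i) (\<phi> y) = jet m n k (\<lambda>p. p i) (\<phi> y)" for k
    by (rule jet_cong[OF chart(2)[OF c]]) (use y chart_inv[OF c] in auto)
  then have "evl (jet_point U \<phi> n y) (\<lambda>z. \<phi> z i) = (\<Sum>k\<le>height. jet m n k (\<lambda>p. p i) (\<phi> y))"
    using evl_jet_point[OF c c y y n] by simp
  also have "\<dots> = (\<Sum>k\<in>{0,1}. jet m n k (\<lambda>p. p i) (\<phi> y))"
    by (rule sum.mono_neutral_right) (use height(1) in \<open>auto simp: jet_coord[OF i]\<close>)
  also have "\<dots> = of_real (\<phi> y i) + n i" by (simp add: jet_coord[OF i] del: jet.simps)
  finally show ?thesis .
qed

lemma evl_chart_in_N: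
  assumes c: "(U, \<phi>) \<in> \<C>" and y: "y \<in> U" and \<xi>: "\<xi> \<in> fibre y"
  shows "evl \<xi> (\<lambda>z. \<phi> z i) - of_real (\<phi> y i) \<in> N"
proof -
  obtain f W where f: "f \<in> SF" "openin M W" "y \<in> W" "W \<subseteq> U" "\<And>z. z \<in> W \<Longrightarrow> f z = \<phi> z i"
      "evl \<xi> (\<lambda>z. \<phi> z i) = \<xi> f"
    using evl_chart[OF c y \<xi>, of i] by blast
  then show ?thesis using real_part_diff[of "\<xi> f"] fibreD(6)[OF \<xi> f(1)] by simp
qed

text \<open>
  Near \<open>y\<close>, Hadamard's lemma gives \<open>f = f(y) + \<Sum> (\<phi>\<^sub>i - \<phi>\<^sub>i(y)) g\<^sub>i\<close>. Both morphisms send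
  \<open>\<phi>\<^sub>i - \<phi>\<^sub>i(y)\<close> to the same element of \<open>N\<close>, so if \<open>\<xi> - \<eta>\<close> maps all functions into a power of \<open>N\<close>, it
  maps them into the next one.
\<close>
lemma fibre_eqI:
  assumes c: "(U, \<phi>) \<in> \<C>" and y: "y \<in> U" and \<xi>: "\<xi> \<in> fibre y" and \<eta>: "\<eta> \<in> fibre y"
    and eq: "\<And>i. i < m \<Longrightarrow> evl \<xi> (\<lambda>z. \<phi> z i) = evl \<eta> (\<lambda>z. \<phi> z i)"
  shows "\<xi> = \<eta>"
proof -
  let ?a = "\<phi> y"
  have yM: "y \<in> topspace M" using y chart_subset[OF c] by blast
  obtain e where e: "e > 0" "open_box m ?a e \<subseteq> \<phi> ` U"
    using openin_contains_box[OF chart(2)[OF c]] y by blast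
  let ?B = "open_box m ?a e"
  note B = openin_open_box[of m ?a e]
  have aB: "?a \<in> ?B" using center_in_open_box[OF chart_model[OF c y] e(1)] .
  obtain W where W: "openin M W" "y \<in> W" "W \<subseteq> U" "\<And>z. z \<in> W \<Longrightarrow> \<phi> z \<in> ?B"
      "\<And>h. smooth_on m ?B h \<Longrightarrow> \<exists>f\<in>SF. \<forall>z\<in>W. f z = h (\<phi> z)"
    using SF_realize_germs[OF c y B aB] by blast
  obtain X where X: "\<And>i. X i \<in> SF" "\<And>i z. z \<in> W \<Longrightarrow> X i z = \<phi> z i"
    using W(5)[OF smooth_on_coord[OF B]] by metis
  have evX: "evl \<zeta> (\<lambda>z. \<phi> z i) = \<zeta> (X i)" if "\<zeta> \<in> fibre y" for \<zeta> i
    by (rule evl_eq[OF that yM X(1) W(1,2) X(2)])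
  define c where "c i = \<xi> (X i)" for i
  have cX: "\<xi> (X i) = c i" "i < m \<Longrightarrow> \<eta> (X i) = c i" for i
    using evX[OF \<xi>, of i] evX[OF \<eta>, of i] eq[of i] by (simp_all add: c_def)
  have cN: "c i - of_real (?a i) \<in> N" for i
    using real_part_diff[of "\<xi> (X i)"] fibreD(6)[OF \<xi> X(1), of i] X(2)[OF W(2)] by (simp add: c_def)
  have "\<xi> f - \<eta> f \<in> ideal_power N (Suc k)" if "f \<in> SF" for f k
    using that
  proof (induction k arbitrary: f)
    case 0
    have "real_part N (\<xi> f - \<eta> f) = 0"
      using linear_diff[OF linear_real_part, of "\<xi> f" "\<eta> f"] fibreD(6)[OF \<xi> 0] fibreD(6)[OF \<eta> 0] by simp
    then show ?case by (intro N_in_ideal_power_1) (simp add: mem_N_iff)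
  next
    case (Suc k)
    have "smooth_on m ?B (\<lambda>p. f (inv_into U \<phi> p))"
      by (rule smooth_on_subset[OF SF_chart[OF Suc.prems assms(1)] e(2)])
    then obtain g where g: "\<And>i. i < m \<Longrightarrow> smooth_on m ?B (g i)"
        "\<And>p. p \<in> ?B \<Longrightarrow> f (inv_into U \<phi> p) = f (inv_into U \<phi> ?a) + (\<Sum>i<m. (p i - ?a i) * g i p)"
      using Hadamard[OF chart_model[OF assms(1) y]] by blast
    have "\<exists>h\<in>SF. \<forall>z\<in>W. h z = g i (\<phi> z)" if "i < m" for i using W(5)[OF g(1)[OF that]] .
    then obtain G where G: "\<And>i. i < m \<Longrightarrow> G i \<in> SF" "\<And>i z. i < m \<Longrightarrow> z \<in> W \<Longrightarrow> G i z = g i (\<phi> z)" by metis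
    let ?one = "indicator (topspace M) :: 'a \<Rightarrow> real"
    let ?x = "\<lambda>i z. X i z + (- ?a i) * ?one z"
    let ?f = "\<lambda>z. f y * ?one z + (\<Sum>i<m. ?x i z * G i z)"
    have x: "?x i \<in> SF" for i by (intro SF_add X(1) SF_cmult SF_one)
    have xG: "(\<lambda>z. ?x i z * G i z) \<in> SF" if "i < m" for i by (intro SF_mult x G that)
    have sumSF: "(\<lambda>z. \<Sum>i<m. ?x i z * G i z) \<in> SF" by (rule SF_sum) (use xG in auto)
    have fSF: "?f \<in> SF" by (intro SF_add SF_cmult SF_one sumSF)
    have feq: "f z = ?f z" if z: "z \<in> W" for z
    proof -
      have "z \<in> U" "z \<in> topspace M" using z W(3) chart_subset[OF assms(1)] by auto
      then show ?thesis using g(2)[OF W(4)[OF z]] chart_inv[OF assms(1)] y X(2)[OF z] G(2)[OF _ z] by simp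
    qed
    \<comment> \<open>Both morphisms respect the Hadamard expansion, realised by the global functions \<open>X i\<close> and \<open>G i\<close>.\<close>
    have expand: "\<zeta> f = of_real (f y) + (\<Sum>i<m. (\<zeta> (X i) - of_real (?a i)) * \<zeta> (G i))" if \<zeta>: "\<zeta> \<in> fibre y" for \<zeta>
    proof -
      have "\<zeta> f = \<zeta> ?f" by (rule morphism_germ[OF \<zeta> Suc.prems fSF W(1,2) feq])
      also have "\<dots> = \<zeta> (\<lambda>z. f y * ?one z) + \<zeta> (\<lambda>z. \<Sum>i<m. ?x i z * G i z)"
        by (rule fibreD(2)[OF \<zeta> SF_cmult[OF SF_one] sumSF])
      also have "\<zeta> (\<lambda>z. f y * ?one z) = of_real (f y)"
        by (simp only: fibreD(4)[OF \<zeta> SF_one] fibreD(5)[OF \<zeta>] of_real_def)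
      also have "\<zeta> (\<lambda>z. \<Sum>i<m. ?x i z * G i z) = (\<Sum>i<m. \<zeta> (\<lambda>z. ?x i z * G i z))"
        by (rule morphism_sum[OF \<zeta>]) (use xG in auto)
      also have "\<dots> = (\<Sum>i<m. (\<zeta> (X i) - of_real (?a i)) * \<zeta> (G i))"
      proof (rule sum.cong[OF refl])
        fix i assume "i \<in> {..<m}"
        then have "\<zeta> (\<lambda>z. ?x i z * G i z) = \<zeta> (?x i) * \<zeta> (G i)" using fibreD(3)[OF \<zeta> x G(1)] by simp
        also have "\<zeta> (?x i) = \<zeta> (X i) + \<zeta> (\<lambda>z. (- ?a i) * ?one z)"
          by (rule fibreD(2)[OF \<zeta> X(1) SF_cmult[OF SF_one]])
        also have "\<zeta> (\<lambda>z. (- ?a i) * ?one z) = (- ?a i) *\<^sub>R 1"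
          by (simp only: fibreD(4)[OF \<zeta> SF_one] fibreD(5)[OF \<zeta>])
        finally show "\<zeta> (\<lambda>z. ?x i z * G i z) = (\<zeta> (X i) - of_real (?a i)) * \<zeta> (G i)"
          by (simp add: of_real_def)
      qed
      finally show ?thesis .
    qed
    have "\<xi> f - \<eta> f = (\<Sum>i<m. (c i - of_real (?a i)) * (\<xi> (G i) - \<eta> (G i)))"
      using expand[OF \<xi>] expand[OF \<eta>] by (simp add: cX right_diff_distrib sum_subtractf)
    also have "\<dots> \<in> ideal_power N (Suc (Suc k))"
      by (intro subspace_sum[OF subspace_ideal_power] ideal_power_Suc_mult[OF cN] Suc.IH G) auto
    finally show ?case .
  qed
  then have "\<xi> f = \<eta> f" if "f \<in> SF" for f
    using ideal_power_zero[of "\<xi> f - \<eta> f" "Suc height"] that by simp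
  then show ?thesis using fibreD(1)[OF \<xi>] fibreD(1)[OF \<eta>] by (auto intro: extensionalityI)
qed

end

section \<open>Cubes and homotopy groups\<close>

lemma topspace_cube:
  "topspace (cube k) = {x. (\<forall>i\<ge>k. x i = 0) \<and> (\<forall>i<k. 0 \<le> x i \<and> x i \<le> 1)}"
  by (auto simp: cube_def topspace_Euclidean_space)

lemma cube_eq_product:
  "cube k = subtopology (powertop_real UNIV) (PiE UNIV (\<lambda>i. if i < k then {0..1} else {0}))"
  unfolding cube_def Euclidean_space_def subtopology_subtopology
  by (rule arg_cong[where f="subtopology _"]) (auto simp: PiE_iff not_less split: if_splits, (meson not_less)+)

lemma compact_space_cube: "compact_space (cube k)"
  unfolding cube_eq_product by (rule compact_space_subtopology) (auto simp: compactin_PiE)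

lemma Hausdorff_space_cube: "Hausdorff_space (cube k)"
  unfolding cube_eq_product
  by (intro Hausdorff_space_subtopology) (simp add: Hausdorff_space_product_topology)

lemma continuous_map_into_cube:
  "continuous_map X (cube k) f \<longleftrightarrow>
     (\<forall>i. continuous_map X euclideanreal (\<lambda>x. f x i)) \<and> f \<in> topspace X \<rightarrow> topspace (cube k)"
  unfolding cube_def Euclidean_space_def
  by (auto simp: continuous_map_in_subtopology continuous_map_componentwise_UNIV)

lemma continuous_map_cube_proj:
  "continuous_map (cube k) euclideanreal (\<lambda>x. x i)"
  using continuous_map_into_cube[of "cube k" k id] by simp

lemma closedin_cube_boundary: "closedin (cube k) (cube_boundary k)"
proof -
  have "cube_boundary k = (\<Union>i\<in>{..<k}. {x \<in> topspace (cube k). x i \<in> {0,1}})"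
    by (auto simp: cube_boundary_def)
  moreover have "closedin (cube k) {x \<in> topspace (cube k). x i \<in> {0,1}}" for i
    by (rule closedin_continuous_map_preimage[OF continuous_map_cube_proj]) auto
  ultimately show ?thesis by (auto intro!: closedin_Union)
qed

text \<open>
  The parameter in \<open>T\<close> lets the same argument concatenate homotopies.
\<close>
lemma continuous_map_cube_concat:
  assumes k: "k \<ge> 1"
    and F: "continuous_map (prod_topology T (cube k)) X F"
    and G: "continuous_map (prod_topology T (cube k)) X G"
    and b: "\<And>t x. t \<in> topspace T \<Longrightarrow> x \<in> cube_boundary k \<Longrightarrow> F (t,x) = x0 \<and> G (t,x) = x0"
  shows "continuous_map (prod_topology T (cube k)) X
           (\<lambda>z. cube_concat (\<lambda>x. F (fst z, x)) (\<lambda>x. G (fst z, x)) (snd z))"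
proof -
  have proj: "continuous_map (prod_topology T (cube k)) euclideanreal (\<lambda>z. snd z i)" for i
    using continuous_map_compose[OF continuous_map_snd continuous_map_cube_proj]
    by (simp add: o_def)
  have half: "continuous_map (subtopology (prod_topology T (cube k)) S) (prod_topology T (cube k))
       (\<lambda>z. (fst z, (snd z)(0 := 2 * snd z 0 - c)))"
    if S: "\<And>z. z \<in> S \<Longrightarrow> snd z \<in> topspace (cube k) \<Longrightarrow> 0 \<le> 2 * snd z 0 - c \<and> 2 * snd z 0 - c \<le> 1" for S c
  proof (rule continuous_map_pairedI)
    show "continuous_map (subtopology (prod_topology T (cube k)) S) T fst"
      by (simp add: continuous_map_from_subtopology continuous_map_fst)
    have "continuous_map (subtopology (prod_topology T (cube k)) S) euclideanreal
            (\<lambda>z. ((snd z)(0 := 2 * snd z 0 - c)) i)" for i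
      by (cases "i = 0") (auto intro!: continuous_intros continuous_map_from_subtopology proj)
    then show "continuous_map (subtopology (prod_topology T (cube k)) S) (cube k)
                 (\<lambda>z. (snd z)(0 := 2 * snd z 0 - c))"
      using S k by (auto simp: continuous_map_into_cube topspace_cube)
  qed
  show ?thesis
    unfolding cube_concat_def
  proof (rule continuous_map_cases_le[OF proj])
    let ?S = "{z \<in> topspace (prod_topology T (cube k)). snd z 0 \<le> 1/2}"
    show "continuous_map (subtopology (prod_topology T (cube k)) ?S) X
        (\<lambda>z. F (fst z, (snd z)(0 := 2 * snd z 0)))"
      using continuous_map_compose[OF half[of ?S 0] F] k by (auto simp: o_def topspace_cube)
    let ?S = "{z \<in> topspace (prod_topology T (cube k)). 1/2 \<le> snd z 0}"
    show "continuous_map (subtopology (prod_topology T (cube k)) ?S) X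
        (\<lambda>z. G (fst z, (snd z)(0 := 2 * snd z 0 - 1)))"
      using continuous_map_compose[OF half[of ?S 1] G] k by (auto simp: o_def topspace_cube)
    fix z assume z: "z \<in> topspace (prod_topology T (cube k))" "snd z 0 = 1/2"
    with k have "(snd z)(0 := 1) \<in> cube_boundary k" "(snd z)(0 := 0) \<in> cube_boundary k"
      by (auto simp: cube_boundary_def topspace_cube)
    then show "F (fst z, (snd z)(0 := 2 * snd z 0)) = G (fst z, (snd z)(0 := 2 * snd z 0 - 1))"
      using z(1) b by (auto simp: z(2))
  qed auto
qed

lemma cube_concat_boundary:
  assumes "k \<ge> 1" "\<And>x. x \<in> cube_boundary k \<Longrightarrow> f x = x0" "\<And>x. x \<in> cube_boundary k \<Longrightarrow> g x = x0"
    and x: "x \<in> cube_boundary k"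
  shows "cube_concat f g x = x0"
proof (cases "x 0 \<le> 1/2")
  case True
  have "x(0 := 2 * x 0) \<in> cube_boundary k"
  proof -
    obtain i where "i < k" "x i = 0 \<or> x i = 1" using x by (auto simp: cube_boundary_def)
    then have "\<exists>i<k. (x(0 := 2 * x 0)) i = 0 \<or> (x(0 := 2 * x 0)) i = 1"
      using True by (intro exI[of _ i]) auto
    then show ?thesis using x True assms(1) by (auto simp: cube_boundary_def topspace_cube)
  qed
  then show ?thesis using True assms by (simp add: cube_concat_def)
next
  case False
  have "x(0 := 2 * x 0 - 1) \<in> cube_boundary k"
  proof -
    obtain i where "i < k" "x i = 0 \<or> x i = 1" using x by (auto simp: cube_boundary_def)
    then have "\<exists>i<k. (x(0 := 2 * x 0 - 1)) i = 0 \<or> (x(0 := 2 * x 0 - 1)) i = 1"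
      using False by (intro exI[of _ i]) auto
    then show ?thesis using x False assms(1) by (auto simp: cube_boundary_def topspace_cube)
  qed
  then show ?thesis using False assms by (simp add: cube_concat_def)
qed

lemma cube_homotopyE:
  assumes "(f, g) \<in> cube_homotopy k X x0"
  obtains H :: "real \<times> (nat \<Rightarrow> real) \<Rightarrow> _" where "continuous_map (prod_topology (top_of_set {0..1}) (cube k)) X H"
    "\<And>x. H (0, x) = f x" "\<And>x. H (1, x) = g x"
    "\<And>t x. t \<in> {0..1} \<Longrightarrow> x \<in> cube_boundary k \<Longrightarrow> H (t, x) = x0"
  using assms unfolding cube_homotopy_def homotopic_with_def mem_Collect_eq case_prod_conv by blast

lemma equiv_cube_homotopy: "equiv (based_cubes k X x0) (cube_homotopy k X x0)"
proof (rule equivI)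
  define P where "P h \<longleftrightarrow> (\<forall>x\<in>cube_boundary k. h x = x0)" for h :: "(nat \<Rightarrow> real) \<Rightarrow> 'a"
  have eq: "cube_homotopy k X x0 = {(f, g). homotopic_with P (cube k) X f g}"
    by (simp add: cube_homotopy_def P_def[abs_def])
  have eqB: "based_cubes k X x0 = {f. continuous_map (cube k) X f \<and> P f}"
    by (simp add: based_cubes_def P_def)
  show "cube_homotopy k X x0 \<subseteq> based_cubes k X x0 \<times> based_cubes k X x0"
    using homotopic_with_imp_continuous_maps[of P] homotopic_with_imp_property[of P]
    unfolding eq eqB by fast
  show "refl_on (based_cubes k X x0) (cube_homotopy k X x0)"
    unfolding eq eqB refl_on_def by simp
  show "sym (cube_homotopy k X x0)"
    unfolding eq sym_def using homotopic_with_symD[of P] by blast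
  show "trans (cube_homotopy k X x0)"
    unfolding eq trans_def using homotopic_with_trans[of P] by blast
qed

lemma cube_homotopy_concat:
  assumes k: "k \<ge> 1" and f: "(f, f') \<in> cube_homotopy k X x0" and g: "(g, g') \<in> cube_homotopy k X x0"
  shows "(cube_concat f g, cube_concat f' g') \<in> cube_homotopy k X x0"
proof -
  obtain F :: "real \<times> (nat \<Rightarrow> real) \<Rightarrow> _" where F: "continuous_map (prod_topology (top_of_set {0..1}) (cube k)) X F"
      "\<And>x. F (0,x) = f x" "\<And>x. F (1,x) = f' x" "\<And>t x. t \<in> {0..1} \<Longrightarrow> x \<in> cube_boundary k \<Longrightarrow> F (t,x) = x0"
    using f by (elim cube_homotopyE) blast
  obtain G :: "real \<times> (nat \<Rightarrow> real) \<Rightarrow> _" where G: "continuous_map (prod_topology (top_of_set {0..1}) (cube k)) X G"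
      "\<And>x. G (0,x) = g x" "\<And>x. G (1,x) = g' x" "\<And>t x. t \<in> {0..1} \<Longrightarrow> x \<in> cube_boundary k \<Longrightarrow> G (t,x) = x0"
    using g by (elim cube_homotopyE) blast
  let ?H = "\<lambda>z. cube_concat (\<lambda>x. F (fst z, x)) (\<lambda>x. G (fst z, x)) (snd z)"
  have "continuous_map (prod_topology (top_of_set {0..1}) (cube k)) X ?H"
    by (rule continuous_map_cube_concat[OF k F(1) G(1), of x0]) (auto simp: F G)
  moreover have "\<forall>t\<in>{0..1}. \<forall>x\<in>cube_boundary k. ?H (t,x) = x0"
    using F(4) G(4) by (auto intro!: cube_concat_boundary[OF k])
  ultimately show ?thesis
    unfolding cube_homotopy_def homotopic_with_def
    by (auto intro!: exI[of _ ?H] simp: F G)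
qed

text \<open>
  The product of two classes is a union over all representatives, which collapses since
  concatenation respects homotopy.
\<close>
lemma mult_homotopy_group:
  assumes k: "k \<ge> 1" and f: "f \<in> based_cubes k X x0" and g: "g \<in> based_cubes k X x0"
  shows "(cube_homotopy k X x0 `` {f}) \<otimes>\<^bsub>homotopy_group k X x0\<^esub> (cube_homotopy k X x0 `` {g})
       = cube_homotopy k X x0 `` {cube_concat f g}"
proof -
  let ?R = "cube_homotopy k X x0"
  have eq: "?R `` {cube_concat f' g'} = ?R `` {cube_concat f g}" if "(f,f') \<in> ?R" "(g,g') \<in> ?R" for f' g'
    using cube_homotopy_concat[OF k that] equiv_class_eq[OF equiv_cube_homotopy] by metis
  have "(f,f) \<in> ?R" "(g,g) \<in> ?R"
    using f g equiv_cube_homotopy[of k X x0] by (auto simp: equiv_def refl_on_def)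
  moreover have "(?R `` {f}) \<otimes>\<^bsub>homotopy_group k X x0\<^esub> (?R `` {g})
      = (\<Union>f'\<in>?R `` {f}. \<Union>g'\<in>?R `` {g}. ?R `` {cube_concat f g})"
    unfolding homotopy_group_def monoid.simps by (intro SUP_cong refl eq) simp_all
  ultimately show ?thesis by blast
qed

text \<open>
  Composition with \<open>p\<close> always induces a homomorphism. The assumptions on lifts say that it is onto and
  one-to-one.
\<close>
lemma homotopy_group_iso_lift:
  assumes k: "k \<ge> 1" and p: "continuous_map E M p"
    and surj: "\<And>g. g \<in> based_cubes k M (p \<xi>) \<Longrightarrow>
       \<exists>f\<in>based_cubes k E \<xi>. (p \<circ> f, g) \<in> cube_homotopy k M (p \<xi>)"
    and inj: "\<And>f f'. f \<in> based_cubes k E \<xi> \<Longrightarrow> f' \<in> based_cubes k E \<xi> \<Longrightarrow>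
       (p \<circ> f, p \<circ> f') \<in> cube_homotopy k M (p \<xi>) \<Longrightarrow> (f, f') \<in> cube_homotopy k E \<xi>"
  shows "homotopy_group k E \<xi> \<cong> homotopy_group k M (p \<xi>)"
proof -
  let ?R = "cube_homotopy k E \<xi>" and ?S = "cube_homotopy k M (p \<xi>)"
  let ?A = "based_cubes k E \<xi>" and ?B = "based_cubes k M (p \<xi>)"
  note eR = equiv_cube_homotopy[of k E \<xi>] and eS = equiv_cube_homotopy[of k M "p \<xi>"]
  have comp: "(p \<circ> f, p \<circ> f') \<in> ?S" if "(f,f') \<in> ?R" for f f'
    using that p unfolding cube_homotopy_def
    by (auto intro!: homotopic_with_compose_continuous_map_left)
  have compB: "p \<circ> f \<in> ?B" if "f \<in> ?A" for f
    using that p by (auto simp: based_cubes_def intro: continuous_map_compose)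
  define h where "h A = (\<Union>f\<in>A. ?S `` {p \<circ> f})" for A
  have h: "h (?R `` {f}) = ?S `` {p \<circ> f}" if "f \<in> ?A" for f
  proof -
    have eq: "?S `` {p \<circ> f'} = ?S `` {p \<circ> f}" if "(f,f') \<in> ?R" for f'
      using comp[OF that] equiv_class_eq[OF eS] by metis
    have "(f,f) \<in> ?R" using eR that by (auto simp: equiv_def refl_on_def)
    moreover have "h (?R `` {f}) = (\<Union>f'\<in>?R `` {f}. ?S `` {p \<circ> f})"
      unfolding h_def by (intro SUP_cong refl eq) simp
    ultimately show ?thesis by blast
  qed
  have "h \<in> hom (homotopy_group k E \<xi>) (homotopy_group k M (p \<xi>))"
  proof (rule homI)
    fix A assume "A \<in> carrier (homotopy_group k E \<xi>)"
    then obtain f where "f \<in> ?A" "A = ?R `` {f}" by (auto simp: homotopy_group_def quotient_def)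
    then show "h A \<in> carrier (homotopy_group k M (p \<xi>))"
      using quotientI[OF compB] by (simp add: h homotopy_group_def)
  next
    fix A B assume "A \<in> carrier (homotopy_group k E \<xi>)" "B \<in> carrier (homotopy_group k E \<xi>)"
    then obtain f g where fg: "f \<in> ?A" "A = ?R `` {f}" "g \<in> ?A" "B = ?R `` {g}"
      by (auto simp: homotopy_group_def quotient_def)
    have "(cube_concat f g, cube_concat f g) \<in> ?R"
      using fg eR by (auto intro!: cube_homotopy_concat[OF k] simp: equiv_def refl_on_def)
    then have "cube_concat f g \<in> ?A" using eR by (auto simp: equiv_def)
    then have "h (?R `` {cube_concat f g}) = ?S `` {p \<circ> cube_concat f g}" by (rule h)
    also have "p \<circ> cube_concat f g = cube_concat (p \<circ> f) (p \<circ> g)"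
      by (auto simp: cube_concat_def fun_eq_iff)
    also have "?S `` {\<dots>} = h A \<otimes>\<^bsub>homotopy_group k M (p \<xi>)\<^esub> h B"
      unfolding fg(2,4) h[OF fg(1)] h[OF fg(3)]
      by (rule mult_homotopy_group[OF k compB[OF fg(1)] compB[OF fg(3)], symmetric])
    finally show "h (A \<otimes>\<^bsub>homotopy_group k E \<xi>\<^esub> B) = h A \<otimes>\<^bsub>homotopy_group k M (p \<xi>)\<^esub> h B"
      unfolding fg(2,4) mult_homotopy_group[OF k fg(1,3)] .
  qed
  moreover have "bij_betw h (carrier (homotopy_group k E \<xi>)) (carrier (homotopy_group k M (p \<xi>)))"
    unfolding bij_betw_def
  proof
    show "inj_on h (carrier (homotopy_group k E \<xi>))"
    proof (rule inj_onI)
      fix A B assume "A \<in> carrier (homotopy_group k E \<xi>)" "B \<in> carrier (homotopy_group k E \<xi>)" and eq: "h A = h B"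
      then obtain f g where fg: "f \<in> ?A" "A = ?R `` {f}" "g \<in> ?A" "B = ?R `` {g}"
        by (auto simp: homotopy_group_def quotient_def)
      have "?S `` {p \<circ> f} = ?S `` {p \<circ> g}" using eq unfolding fg(2,4) h[OF fg(1)] h[OF fg(3)] .
      then have "(p \<circ> f, p \<circ> g) \<in> ?S" using eq_equiv_class[OF _ eS] compB fg by blast
      then have "(f, g) \<in> ?R" using inj fg by blast
      then show "A = B" using fg equiv_class_eq[OF eR] by blast
    qed
    show "h ` carrier (homotopy_group k E \<xi>) = carrier (homotopy_group k M (p \<xi>))"
    proof (intro equalityI subsetI)
      fix C assume "C \<in> h ` carrier (homotopy_group k E \<xi>)"
      then obtain f where f: "f \<in> ?A" "C = h (?R `` {f})"
        by (auto simp: homotopy_group_def quotient_def)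
      show "C \<in> carrier (homotopy_group k M (p \<xi>))"
        unfolding f(2) h[OF f(1)] using quotientI[OF compB[OF f(1)]] by (simp add: homotopy_group_def)
    next
      fix C assume "C \<in> carrier (homotopy_group k M (p \<xi>))"
      then obtain g where g: "g \<in> ?B" "C = ?S `` {g}" by (auto simp: homotopy_group_def quotient_def)
      then obtain f where f: "f \<in> ?A" "(p \<circ> f, g) \<in> ?S" using surj by blast
      then have "C = h (?R `` {f})" using g(2) h[OF f(1)] equiv_class_eq[OF eS f(2)] by (simp only:)
      then show "C \<in> h ` carrier (homotopy_group k E \<xi>)"
        using quotientI[OF f(1)] by (simp add: homotopy_group_def)
    qed
  qed
  ultimately show ?thesis by (auto simp: is_iso_def iso_def)
qed

section \<open>Projections with local interpolation in the fibres\<close>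

text \<open>
  \<open>J\<close> moves \<open>\<xi>\<close> to \<open>\<eta>\<close> inside their common fibre over a point of \<open>U\<close>, as straight lines in a vector
  space do. That \<open>J\<close> rests between equal points is what makes the resulting homotopies relative.
\<close>
definition fibre_interpolation ::
  "'e topology \<Rightarrow> ('e \<Rightarrow> 'x) \<Rightarrow> 'x set \<Rightarrow> (real \<Rightarrow> 'e \<Rightarrow> 'e \<Rightarrow> 'e) \<Rightarrow> bool" where
  "fibre_interpolation E p U J \<longleftrightarrow>
     continuous_map
       (subtopology (prod_topology (top_of_set {0..1}) (prod_topology E E)) {(t, \<xi>, \<eta>). p \<xi> \<in> U \<and> p \<eta> = p \<xi>})
       E (\<lambda>(t, \<xi>, \<eta>). J t \<xi> \<eta>) \<and>
     (\<forall>\<xi>\<in>topspace E. \<forall>\<eta>\<in>topspace E. p \<xi> \<in> U \<longrightarrow> p \<eta> = p \<xi> \<longrightarrow>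
        J 0 \<xi> \<eta> = \<xi> \<and> J 1 \<xi> \<eta> = \<eta> \<and> (\<forall>t\<in>{0..1}. p (J t \<xi> \<eta>) = p \<xi> \<and> J t \<xi> \<xi> = \<xi>))"

lemma fibre_interpolationD:
  assumes "fibre_interpolation E p U J" "\<xi> \<in> topspace E" "\<eta> \<in> topspace E" "p \<xi> \<in> U" "p \<eta> = p \<xi>"
  shows "J 0 \<xi> \<eta> = \<xi>" "J 1 \<xi> \<eta> = \<eta>"
    and "0 \<le> t \<Longrightarrow> t \<le> 1 \<Longrightarrow> p (J t \<xi> \<eta>) = p \<xi>" "0 \<le> t \<Longrightarrow> t \<le> 1 \<Longrightarrow> J t \<xi> \<xi> = \<xi>"
  using assms unfolding fibre_interpolation_def by auto

lemma mult_min_one_le_one: "0 \<le> a \<Longrightarrow> a \<le> 1 \<Longrightarrow> 0 \<le> c \<Longrightarrow> a * min 1 c \<le> (1::real)"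
  by (rule mult_le_one) auto

text \<open>
  An interpolation available only over \<open>U\<close> is cut off by \<open>\<kappa>\<close>. Where \<open>\<kappa> = 0\<close> its parameter is 0, so
  it joins continuously with \<open>f0\<close>. At time 1 it has reached \<open>f1\<close> wherever \<open>\<kappa> \<ge> 1\<close>.
\<close>
lemma continuous_map_interpolation_patch:
  assumes J: "fibre_interpolation E p U J"
    and \<kappa>: "continuous_map K euclideanreal \<kappa>" and f0: "continuous_map K E f0"
    and f1: "continuous_map (subtopology K {z \<in> topspace K. 0 \<le> \<kappa> z}) E f1"
    and U: "\<And>z. z \<in> topspace K \<Longrightarrow> 0 \<le> \<kappa> z \<Longrightarrow> p (f0 z) \<in> U \<and> p (f1 z) = p (f0 z)"
  shows "continuous_map (prod_topology (top_of_set {0..1}) K) E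
     (\<lambda>w. if \<kappa> (snd w) \<le> 0 then f0 (snd w)
          else J (fst w * min 1 (\<kappa> (snd w))) (f0 (snd w)) (f1 (snd w)))"
proof (rule continuous_map_cases_le)
  let ?P = "prod_topology (top_of_set {0..1::real}) K"
  let ?S = "{w \<in> topspace ?P. 0 \<le> \<kappa> (snd w)}"
  have \<kappa>': "continuous_map ?P euclideanreal (\<lambda>w. \<kappa> (snd w))"
    using continuous_map_compose[OF continuous_map_snd \<kappa>] by (simp add: o_def)
  then show "continuous_map ?P euclideanreal (\<lambda>w. \<kappa> (snd w))" .
  have f0': "continuous_map ?P E (\<lambda>w. f0 (snd w))"
    using continuous_map_compose[OF continuous_map_snd f0] by (simp add: o_def)
  then show "continuous_map (subtopology ?P {x \<in> topspace ?P. \<kappa> (snd x) \<le> 0}) E (\<lambda>w. f0 (snd w))"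
    by (rule continuous_map_from_subtopology)
  have sndS: "continuous_map (subtopology ?P ?S) (subtopology K {z \<in> topspace K. 0 \<le> \<kappa> z}) snd"
    by (intro continuous_map_into_subtopology continuous_map_from_subtopology continuous_map_snd) auto
  have f1': "continuous_map (subtopology ?P ?S) E (\<lambda>w. f1 (snd w))"
    using continuous_map_compose[OF sndS f1] by (simp add: o_def)
  have fst': "continuous_map ?P euclideanreal fst"
    using continuous_map_fst[of "top_of_set {0..1::real}" K] by (simp add: continuous_map_in_subtopology)
  have E1: "f1 z \<in> topspace E" if "z \<in> topspace K" "0 \<le> \<kappa> z" for z
    using continuous_map_funspace[OF f1] that by auto
  have E0: "f0 z \<in> topspace E" if "z \<in> topspace K" for z
    using continuous_map_funspace[OF f0] that by auto
  let ?D = "subtopology (prod_topology (top_of_set {0..1}) (prod_topology E E)) {(t, \<xi>, \<eta>). p \<xi> \<in> U \<and> p \<eta> = p \<xi>}"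
  have "continuous_map (subtopology ?P ?S) ?D
         (\<lambda>w. (fst w * min 1 (\<kappa> (snd w)), f0 (snd w), f1 (snd w)))"
  proof (intro continuous_map_into_subtopology continuous_map_pairedI)
    show "continuous_map (subtopology ?P ?S) euclideanreal (\<lambda>w. fst w * min 1 (\<kappa> (snd w)))"
      by (intro continuous_intros continuous_map_from_subtopology \<kappa>' fst') 
    show "continuous_map (subtopology ?P ?S) E (\<lambda>w. f0 (snd w))"
      by (rule continuous_map_from_subtopology[OF f0'])
  qed (use f1' U in \<open>auto intro: mult_min_one_le_one\<close>)
  from continuous_map_compose[OF this, of E "\<lambda>(t, \<xi>, \<eta>). J t \<xi> \<eta>"]
  show "continuous_map (subtopology ?P ?S) E
         (\<lambda>w. J (fst w * min 1 (\<kappa> (snd w))) (f0 (snd w)) (f1 (snd w)))"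
    using J by (simp add: fibre_interpolation_def o_def)
  show "f0 (snd w) = J (fst w * min 1 (\<kappa> (snd w))) (f0 (snd w)) (f1 (snd w))"
    if "w \<in> topspace ?P" "\<kappa> (snd w) = 0" for w
    using that J U[of "snd w"] E1[of "snd w"] E0[of "snd w"] by (auto simp: fibre_interpolation_def)
qed auto

text \<open>
  The features of a bundle of affine spaces with a section that the homotopy argument relies on.
  The interpolations over different open sets may be unrelated, as straight lines in different
  charts are.
\<close>
locale locally_affine_projection =
  fixes E :: "'e topology" and M :: "'x topology" and p :: "'e \<Rightarrow> 'x" and s :: "'x \<Rightarrow> 'e"
  assumes cont_p: "continuous_map E M p"
    and cont_s: "continuous_map M E s"
    and p_s: "\<And>y. y \<in> topspace M \<Longrightarrow> p (s y) = y"
    and local_structure: "\<And>\<xi>. \<xi> \<in> topspace E \<Longrightarrow>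
       \<exists>U J \<sigma>. openin M U \<and> p \<xi> \<in> U \<and> fibre_interpolation E p U J \<and>
         continuous_map (subtopology M U) E \<sigma> \<and> \<sigma> (p \<xi>) = \<xi> \<and> (\<forall>y\<in>U. p (\<sigma> y) = y)"
begin

lemma s_in: "y \<in> topspace M \<Longrightarrow> s y \<in> topspace E"
  using continuous_map_funspace[OF cont_s] by auto

lemma p_in: "\<xi> \<in> topspace E \<Longrightarrow> p \<xi> \<in> topspace M"
  using continuous_map_funspace[OF cont_p] by auto

text \<open>
  The induction runs over finitely many cut-off functions \<open>\<kappa> a\<close>. Its invariant is that the current map
  \<open>f'\<close> still has the projection of \<open>f1\<close> and agrees with \<open>f1\<close> on the regions \<open>W a\<close> treated so far; the
  next interpolation, being at rest where \<open>f' = f1\<close>, preserves this.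
\<close>
lemma same_projection_homotopic:
  assumes K: "compact_space K" "Hausdorff_space K"
    and f0: "continuous_map K E f0" and f1: "continuous_map K E f1"
    and pf: "\<And>z. z \<in> topspace K \<Longrightarrow> p (f0 z) = p (f1 z)"
  shows "homotopic_with (\<lambda>h. \<forall>z\<in>topspace K. f0 z = f1 z \<longrightarrow> h z = f1 z) K E f0 f1"
proof -
  define good where "good \<kappa> \<longleftrightarrow> continuous_map K euclideanreal \<kappa> \<and>
     (\<exists>U J. fibre_interpolation E p U J \<and> (\<forall>z\<in>topspace K. 0 \<le> \<kappa> z \<longrightarrow> p (f1 z) \<in> U))" for \<kappa>
  let ?Q = "\<lambda>h. \<forall>z\<in>topspace K. f0 z = f1 z \<longrightarrow> h z = f1 z"
  have nK: "normal_space K" using K compact_Hausdorff_or_regular_imp_normal_space by blast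
  have f1E: "f1 z \<in> topspace E" if "z \<in> topspace K" for z
    using continuous_map_funspace[OF f1] that by auto
  \<comment> \<open>The cut-off is negative off the preimage of \<open>U\<close>, and the value 2 at \<open>z\<close> leaves a neighbourhood of
    \<open>z\<close> where it exceeds 1, so that the interpolation runs to its end there.\<close>
  have ex: "\<exists>\<kappa>. good \<kappa> \<and> \<kappa> z = 2" if z: "z \<in> topspace K" for z
  proof -
    obtain U J where U: "openin M U" "p (f1 z) \<in> U" "fibre_interpolation E p U J"
      using local_structure[OF f1E[OF z]] by blast
    let ?T = "{w \<in> topspace K. p (f1 w) \<in> U}"
    have "openin K ?T"
      using openin_continuous_map_preimage[OF continuous_map_compose[OF f1 cont_p] U(1)] by simp
    then have "closedin K (topspace K - ?T)" by blast
    moreover have "closedin K {z}" using K(2) z by (simp add: closedin_Hausdorff_singleton)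
    moreover have "disjnt (topspace K - ?T) {z}" using U z by (auto simp: disjnt_def)
    ultimately obtain \<kappa> where \<kappa>: "continuous_map K (top_of_set {-1..2}) \<kappa>"
        "\<kappa> ` (topspace K - ?T) \<subseteq> {-1::real}" "\<kappa> ` {z} \<subseteq> {2}"
      using Urysohn_lemma[OF nK, of "topspace K - ?T" "{z}" "-1" 2] by auto
    have "p (f1 w) \<in> U" if "w \<in> topspace K" "0 \<le> \<kappa> w" for w
      using \<kappa>(2) that by (smt (verit, ccfv_threshold) DiffI image_subset_iff mem_Collect_eq singletonD)
    then have "good \<kappa>" using \<kappa>(1) U(3) by (auto simp: good_def continuous_map_in_subtopology)
    then show ?thesis using \<kappa>(3) by auto
  qed
  then obtain \<kappa> where \<kappa>: "\<And>z. z \<in> topspace K \<Longrightarrow> good (\<kappa> z)" "\<And>z. z \<in> topspace K \<Longrightarrow> \<kappa> z z = 2"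
    by metis
  define W where "W z = {w \<in> topspace K. 1 < \<kappa> z w}" for z
  have "openin K (W z)" if "z \<in> topspace K" for z
    using openin_continuous_map_preimage[of K euclideanreal "\<kappa> z" "{1<..}"] \<kappa>(1)[OF that]
    by (simp add: W_def good_def)
  then obtain \<F> where \<F>: "finite \<F>" "\<F> \<subseteq> W ` topspace K" "topspace K \<subseteq> \<Union>\<F>"
    using K(1) \<kappa>(2) unfolding compact_space_alt
    by (elim allE[of _ "W ` topspace K"]) (force simp: W_def)
  then obtain F where F: "finite F" "F \<subseteq> topspace K" "\<F> = W ` F"
    by (meson finite_subset_image)
  have "\<exists>f'. homotopic_with ?Q K E f0 f' \<and> (\<forall>z\<in>topspace K. p (f' z) = p (f1 z)) \<and>
             (\<forall>z\<in>\<Union>(W ` F). f' z = f1 z)"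
    using F(1,2)
  proof (induction F)
    case empty
    show ?case using f0 pf by (intro exI[of _ f0]) auto
  next
    case (insert a F)
    then obtain f' where f': "homotopic_with ?Q K E f0 f'" "\<And>z. z \<in> topspace K \<Longrightarrow> p (f' z) = p (f1 z)"
        "\<And>z. z \<in> \<Union>(W ` F) \<Longrightarrow> f' z = f1 z" by blast
    have Q: "f' z = f1 z" if "z \<in> topspace K" "f0 z = f1 z" for z
      using homotopic_with_imp_property[OF f'(1)] that by auto
    have cf': "continuous_map K E f'" using homotopic_with_imp_continuous_maps[OF f'(1)] by blast
    have f'E: "f' z \<in> topspace E" if "z \<in> topspace K" for z
      using continuous_map_funspace[OF cf'] that by auto
    have ga: "good (\<kappa> a)" using insert \<kappa>(1) by auto
    then obtain U J where J: "fibre_interpolation E p U J" 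
        and U: "\<And>z. z \<in> topspace K \<Longrightarrow> 0 \<le> \<kappa> a z \<Longrightarrow> p (f1 z) \<in> U"
      unfolding good_def by blast
    define H where "H w = (if \<kappa> a (snd w) \<le> 0 then f' (snd w)
          else J (fst w * min 1 (\<kappa> a (snd w))) (f' (snd w)) (f1 (snd w)))" for w
    have H: "continuous_map (prod_topology (top_of_set {0..1}) K) E H"
      unfolding H_def using ga cf' f'(2) U
      by (intro continuous_map_interpolation_patch[OF J] continuous_map_from_subtopology f1)
         (auto simp: good_def)
    have J01: "J 0 (f' z) (f1 z) = f' z" "J 1 (f' z) (f1 z) = f1 z"
      if "z \<in> topspace K" "0 \<le> \<kappa> a z" for z
      using fibre_interpolationD(1,2)[OF J f'E f1E] U f'(2) that by auto
    have Jt: "p (J t (f' z) (f1 z)) = p (f1 z)" "J t (f1 z) (f1 z) = f1 z"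
      if "z \<in> topspace K" "0 \<le> \<kappa> a z" "0 \<le> t" "t \<le> 1" for z t
      using fibre_interpolationD(3)[OF J f'E f1E] fibre_interpolationD(4)[OF J f1E f1E] U f'(2) that by auto
    have eq: "H (t,z) = f1 z" if "z \<in> topspace K" "f' z = f1 z" "0 \<le> t" "t \<le> 1" for z t
      using that Jt(2)[of z "t * min 1 (\<kappa> a z)"] by (auto simp: H_def mult_min_one_le_one)
    have "homotopic_with ?Q K E f' (\<lambda>z. H (1,z))"
      by (subst homotopic_with) (use H J01 eq Q in \<open>auto intro!: exI[of _ H] simp: H_def\<close>)
    then have "homotopic_with ?Q K E f0 (\<lambda>z. H (1,z))"
      using f'(1) homotopic_with_trans by blast
    moreover have "\<forall>z\<in>topspace K. p (H (1,z)) = p (f1 z)"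
      using Jt f'(2) by (auto simp: H_def)
    moreover have "\<forall>z\<in>\<Union>(W ` insert a F). H (1,z) = f1 z"
    proof
      fix z assume z: "z \<in> \<Union>(W ` insert a F)"
      then have zK: "z \<in> topspace K" by (auto simp: W_def)
      show "H (1,z) = f1 z"
      proof (cases "z \<in> W a")
        case True
        then show ?thesis using J01(2)[of z] by (auto simp: H_def W_def)
      next
        case False
        then show ?thesis using z f'(3) eq[OF zK] by auto
      qed
    qed
    ultimately show ?case by blast
  qed
  moreover have "topspace K \<subseteq> \<Union>(W ` F)" using \<F>(3) F(3) by simp
  ultimately obtain f' where f': "homotopic_with ?Q K E f0 f'" "\<And>z. z \<in> topspace K \<Longrightarrow> f' z = f1 z"
    by (meson subsetD)
  have "homotopic_with ?Q K E f' f1"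
    by (rule homotopic_with_equal) (use f' homotopic_with_imp_continuous_maps[OF f'(1)] in auto)
  then show ?thesis using f' homotopic_with_trans by blast
qed

text \<open>
  The lift starts as \<open>s \<circ> g\<close>. Near \<open>L\<close> the map \<open>g\<close> stays in a set \<open>U\<close> with a local section \<open>\<sigma>\<close> through
  \<open>\<xi>\<close>, and \<open>s \<circ> g\<close> is deformed there into \<open>\<sigma> \<circ> g\<close>, which is \<open>\<xi>\<close> on \<open>L\<close>.
\<close>
lemma lift_with_constant_boundary:
  assumes K: "compact_space K" "Hausdorff_space K" and L: "closedin K L"
    and g: "continuous_map K M g" and \<xi>: "\<xi> \<in> topspace E" and gL: "\<And>z. z \<in> L \<Longrightarrow> g z = p \<xi>"
  shows "\<exists>f. continuous_map K E f \<and> (\<forall>z\<in>topspace K. p (f z) = g z) \<and> (\<forall>z\<in>L. f z = \<xi>)"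
proof -
  obtain U J \<sigma> where U: "openin M U" "p \<xi> \<in> U" and J: "fibre_interpolation E p U J"
    and \<sigma>: "continuous_map (subtopology M U) E \<sigma>" "\<sigma> (p \<xi>) = \<xi>" "\<And>y. y \<in> U \<Longrightarrow> p (\<sigma> y) = y"
    using local_structure[OF \<xi>] by blast
  have nK: "normal_space K" using K compact_Hausdorff_or_regular_imp_normal_space by blast
  let ?T = "{w \<in> topspace K. g w \<in> U}"
  have "openin K ?T"
    using openin_continuous_map_preimage[OF g U(1)] by simp
  then have "closedin K (topspace K - ?T)" by blast
  moreover have "disjnt (topspace K - ?T) L" using U gL by (auto simp: disjnt_def)
  ultimately obtain \<kappa> where \<kappa>: "continuous_map K (top_of_set {-1..1}) \<kappa>"
      "\<kappa> ` (topspace K - ?T) \<subseteq> {-1::real}" "\<kappa> ` L \<subseteq> {1}"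
    using Urysohn_lemma[OF nK _ L, of "topspace K - ?T" "-1" 1] by auto
  have \<kappa>U: "g w \<in> U" if "w \<in> topspace K" "0 \<le> \<kappa> w" for w
    using \<kappa>(2) that by (smt (verit, ccfv_threshold) DiffI image_subset_iff mem_Collect_eq singletonD)
  have gM: "g z \<in> topspace M" if "z \<in> topspace K" for z
    using continuous_map_funspace[OF g] that by auto
  define H where "H w = (if \<kappa> (snd w) \<le> 0 then s (g (snd w))
          else J (fst w * min 1 (\<kappa> (snd w))) (s (g (snd w))) (\<sigma> (g (snd w))))" for w
  have sg: "continuous_map K E (\<lambda>z. s (g z))"
    using continuous_map_compose[OF g cont_s] by (simp add: o_def)
  have "continuous_map (subtopology K {z \<in> topspace K. 0 \<le> \<kappa> z}) (subtopology M U) g"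
    using \<kappa>U by (intro continuous_map_into_subtopology continuous_map_from_subtopology g) auto
  from continuous_map_compose[OF this \<sigma>(1)]
  have \<sigma>g: "continuous_map (subtopology K {z \<in> topspace K. 0 \<le> \<kappa> z}) E (\<lambda>z. \<sigma> (g z))"
    by (simp add: o_def)
  have H: "continuous_map (prod_topology (top_of_set {0..1}) K) E H"
    unfolding H_def using \<kappa>(1) \<kappa>U \<sigma>(3) gM p_s
    by (intro continuous_map_interpolation_patch[OF J] \<sigma>g sg) (auto simp: continuous_map_in_subtopology)
  have JE: "J 1 (s (g z)) (\<sigma> (g z)) = \<sigma> (g z)"
    "0 \<le> t \<Longrightarrow> t \<le> 1 \<Longrightarrow> p (J t (s (g z)) (\<sigma> (g z))) = g z"
    if "z \<in> topspace K" "0 \<le> \<kappa> z" for z t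
    using fibre_interpolationD(2,3)[OF J s_in[OF gM], of z "\<sigma> (g z)"] that \<kappa>U[OF that] gM[OF that(1)]
      p_s \<sigma>(3) continuous_map_funspace[OF \<sigma>g] by auto
  show ?thesis
  proof (intro exI conjI ballI)
    show "continuous_map K E (\<lambda>z. H (1,z))"
      using continuous_map_o_Pair[OF H, of 1] by (simp add: o_def)
    show "p (H (1,z)) = g z" if "z \<in> topspace K" for z
      using that JE(2)[OF that] gM p_s by (auto simp: H_def)
    show "H (1,z) = \<xi>" if "z \<in> L" for z
      using JE(1)[of z] that \<kappa>(3) gL \<sigma>(2) closedin_subset[OF L] by (auto simp: H_def image_subset_iff)
  qed
qed

text \<open>
  For injectivity, the homotopy between the projections of \<open>f\<close> and \<open>f'\<close> is lifted with boundary value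
  \<open>\<xi>\<close>. The ends of the lift have the projections of \<open>f\<close> and \<open>f'\<close>, and the value \<open>\<xi>\<close> on the boundary
  as well, hence are homotopic to \<open>f\<close> and \<open>f'\<close> relative to the boundary.
\<close>
theorem homotopy_group_iso:
  assumes k: "k \<ge> 1" and \<xi>: "\<xi> \<in> topspace E"
  shows "homotopy_group k E \<xi> \<cong> homotopy_group k M (p \<xi>)"
proof (rule homotopy_group_iso_lift[OF k cont_p])
  fix g assume g: "g \<in> based_cubes k M (p \<xi>)"
  then obtain f where f: "continuous_map (cube k) E f" "\<And>z. z \<in> topspace (cube k) \<Longrightarrow> p (f z) = g z"
      "\<And>z. z \<in> cube_boundary k \<Longrightarrow> f z = \<xi>"
    using lift_with_constant_boundary[OF compact_space_cube Hausdorff_space_cube closedin_cube_boundary _ \<xi>, of k g]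
    by (auto simp: based_cubes_def)
  have "(p \<circ> f, g) \<in> cube_homotopy k M (p \<xi>)"
    unfolding cube_homotopy_def using f g continuous_map_compose[OF f(1) cont_p]
    by (auto simp: based_cubes_def intro!: homotopic_with_equal)
  with f show "\<exists>f\<in>based_cubes k E \<xi>. (p \<circ> f, g) \<in> cube_homotopy k M (p \<xi>)"
    by (intro bexI[of _ f]) (auto simp: based_cubes_def)
next
  fix f f' assume f: "f \<in> based_cubes k E \<xi>" "f' \<in> based_cubes k E \<xi>"
    and "(p \<circ> f, p \<circ> f') \<in> cube_homotopy k M (p \<xi>)"
  then obtain H :: "real \<times> (nat \<Rightarrow> real) \<Rightarrow> _" where H: "continuous_map (prod_topology (top_of_set {0..1}) (cube k)) M H"
      "\<And>x. H (0,x) = p (f x)" "\<And>x. H (1,x) = p (f' x)"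
      "\<And>t x. t \<in> {0..1} \<Longrightarrow> x \<in> cube_boundary k \<Longrightarrow> H (t,x) = p \<xi>"
    by (elim cube_homotopyE) simp
  let ?P = "prod_topology (top_of_set {0..1::real}) (cube k)" and ?L = "{0..1} \<times> cube_boundary k"
  have "compact_space ?P" "Hausdorff_space ?P"
    by (auto simp: compact_space_prod_topology compact_space_cube Hausdorff_space_prod_topology
        Hausdorff_space_cube compact_space_subtopology Hausdorff_space_subtopology)
  moreover have "closedin ?P ?L"
    using closedin_cube_boundary by (simp add: closedin_prod_Times_iff)
  ultimately obtain F where F: "continuous_map ?P E F" "\<And>w. w \<in> topspace ?P \<Longrightarrow> p (F w) = H w"
      "\<And>w. w \<in> ?L \<Longrightarrow> F w = \<xi>"
    using lift_with_constant_boundary[OF _ _ _ H(1) \<xi>, of ?L] H(4) by auto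
  have cF: "continuous_map (cube k) E (\<lambda>x. F (t,x))" if "t \<in> {0..1}" for t
    using continuous_map_o_Pair[OF F(1), of t] that by (simp add: o_def)
  have FF: "((\<lambda>x. F (0,x)), (\<lambda>x. F (1,x))) \<in> cube_homotopy k E \<xi>"
    using F unfolding cube_homotopy_def homotopic_with_def by (auto intro!: exI[of _ F])
  have bd: "x \<in> topspace (cube k)" if "x \<in> cube_boundary k" for x
    using that by (auto simp: cube_boundary_def)
  have close: "(g, (\<lambda>x. F (t,x))) \<in> cube_homotopy k E \<xi>"
    if g: "g \<in> based_cubes k E \<xi>" "\<And>x. H (t,x) = p (g x)" and t: "t \<in> {0..1}" for g t
  proof -
    have "homotopic_with (\<lambda>h. \<forall>z\<in>topspace (cube k). g z = F (t,z) \<longrightarrow> h z = F (t,z)) (cube k) E g (\<lambda>x. F (t,x))"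
      by (rule same_projection_homotopic[OF compact_space_cube Hausdorff_space_cube _ cF[OF t]])
         (use g t F(2) in \<open>auto simp: based_cubes_def\<close>)
    then show ?thesis unfolding cube_homotopy_def using g(1) F(3) t bd
      by (auto simp: based_cubes_def elim!: homotopic_with_mono)
  qed
  have tr: "(a, c) \<in> cube_homotopy k E \<xi>" if "(a, b) \<in> cube_homotopy k E \<xi>" "(b, c) \<in> cube_homotopy k E \<xi>" for a b c
    using equiv_cube_homotopy[of k E \<xi>] that by (meson equivE transD)
  have "(f, (\<lambda>x. F (1,x))) \<in> cube_homotopy k E \<xi>"
    using tr[OF close[OF f(1) H(2)] FF] by simp
  moreover have "((\<lambda>x. F (1,x)), f') \<in> cube_homotopy k E \<xi>"
    using close[OF f(2) H(3)] unfolding cube_homotopy_def by (simp add: homotopic_with_sym)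
  ultimately show "(f, f') \<in> cube_homotopy k E \<xi>"
    by (rule tr)
qed

text \<open>
  A homotopy of maps from the one-point space \<open>cube 0\<close> is a path, so every point is joined to the
  point of the section with the same projection. Paths in \<open>M\<close> may then be lifted by the section.
\<close>
theorem path_components_bij:
  "\<exists>h. bij_betw h (path_components_of E) (path_components_of M)"
proof -
  have to_s: "path_component_of E \<xi> (s (p \<xi>))" if \<xi>: "\<xi> \<in> topspace E" for \<xi>
  proof -
    have "continuous_map (cube 0) E (\<lambda>_. \<xi>)" "continuous_map (cube 0) E (\<lambda>_. s (p \<xi>))"
      using \<xi> s_in p_in by auto
    note same_projection_homotopic[OF compact_space_cube Hausdorff_space_cube this]
    then have "homotopic_with (\<lambda>_. True) (cube 0) E (\<lambda>_. \<xi>) (\<lambda>_. s (p \<xi>))"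
      by (rule homotopic_with_mono) (use \<xi> p_in p_s in auto)
    moreover have "cube 0 \<noteq> trivial_topology"
    proof -
      have "(\<lambda>_. 0) \<in> topspace (cube 0)" by (simp add: topspace_cube)
      then show ?thesis by auto
    qed
    ultimately show ?thesis by (simp add: homotopic_constant_maps)
  qed
  have down: "path_component_of M (p \<xi>) (p \<eta>)" if a: "path_component_of E \<xi> \<eta>" for \<xi> \<eta>
  proof -
    obtain g where "pathin E g" "g 0 = \<xi>" "g 1 = \<eta>" using a unfolding path_component_of_def by blast
    then show ?thesis unfolding path_component_of_def
      by (intro exI[of _ "p \<circ> g"]) (auto simp: pathin_def intro: continuous_map_compose cont_p)
  qed
  have lift_s: "path_component_of E (s x) (s y)" if a: "path_component_of M x y" for x y
  proof -
    obtain g where "pathin M g" "g 0 = x" "g 1 = y" using a unfolding path_component_of_def by blast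
    then show ?thesis unfolding path_component_of_def
      by (intro exI[of _ "s \<circ> g"]) (auto simp: pathin_def intro: continuous_map_compose cont_s)
  qed
  have iff: "path_component_of E \<xi> \<eta> \<longleftrightarrow> path_component_of M (p \<xi>) (p \<eta>)"
    if "\<xi> \<in> topspace E" "\<eta> \<in> topspace E" for \<xi> \<eta>
    using down lift_s[of "p \<xi>" "p \<eta>"] to_s[OF that(1)] to_s[OF that(2)]
    by (meson path_component_of_sym path_component_of_trans)
  have "bij_betw (\<lambda>C. p ` C) (path_components_of E) (path_components_of M)"
  proof -
    have im: "p ` path_component_of_set E \<xi> = path_component_of_set M (p \<xi>)" if \<xi>: "\<xi> \<in> topspace E" for \<xi>
    proof (intro equalityI subsetI)
      fix y assume y: "y \<in> path_component_of_set M (p \<xi>)"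
      then have "y \<in> topspace M" using path_component_in_topspace by fastforce
      then have "s y \<in> path_component_of_set E \<xi>" "p (s y) = y"
        using iff[OF \<xi> s_in] y p_s by auto
      then show "y \<in> p ` path_component_of_set E \<xi>" by force
    qed (use down in auto)
    show ?thesis unfolding bij_betw_def
    proof
      show "inj_on ((`) p) (path_components_of E)"
      proof (rule inj_onI)
        fix C D assume "C \<in> path_components_of E" "D \<in> path_components_of E" and eq: "p ` C = p ` D"
        then obtain \<xi> \<eta> where CD: "\<xi> \<in> topspace E" "\<eta> \<in> topspace E"
          "C = path_component_of_set E \<xi>" "D = path_component_of_set E \<eta>"
          by (auto simp: path_components_of_def)
        then have "path_component_of_set M (p \<xi>) = path_component_of_set M (p \<eta>)" using im eq by simp
        then have "path_component_of M (p \<xi>) (p \<eta>)"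
          using path_component_of_refl[of M "p \<eta>"] p_in[OF CD(2)] by blast
        then have "path_component_of E \<xi> \<eta>" using iff CD by blast
        then show "C = D" using CD by (simp add: path_component_of_equiv) 
      qed
      show "(`) p ` path_components_of E = path_components_of M"
      proof (intro equalityI subsetI)
        fix C assume "C \<in> path_components_of M"
        then obtain y where y: "y \<in> topspace M" "C = path_component_of_set M y"
          by (auto simp: path_components_of_def)
        then have "C = p ` path_component_of_set E (s y)" using im[OF s_in] p_s by simp
        then show "C \<in> (`) p ` path_components_of E" using s_in y by (auto simp: path_components_of_def)
      qed (use im p_in in \<open>auto simp: path_components_of_def\<close>)
    qed
  qed
  then show ?thesis by blast
qed

end

section \<open>The topology of the Weil bundle\<close>

context weil_algebra_loc
begin

text \<open>
  The type of the algebra carries no topology. Testing with all linear functionals amounts to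
  continuity for the vector space topology and, unlike coordinates, does not single out a basis; the
  topology of the Weil bundle is generated with all bases at once.
\<close>
definition algebra_continuous :: "'z topology \<Rightarrow> ('z \<Rightarrow> 'b) \<Rightarrow> bool" where
  "algebra_continuous Z u \<longleftrightarrow> (\<forall>l. linear l \<longrightarrow> continuous_map Z euclideanreal (\<lambda>z. l (u z)))"

lemma linear_representation: "algebra_basis B \<Longrightarrow> linear (\<lambda>v. representation B v b)"
  by (rule linearI) (simp_all add: algebra_basis_def representation_add representation_scale)

lemma linear_expand:
  assumes B: "algebra_basis B" and l: "linear (l :: 'b \<Rightarrow> real)"
  shows "l v = (\<Sum>b\<in>B. representation B v b * l b)"
proof -
  have "v = (\<Sum>b\<in>B. representation B v b *\<^sub>R b)"
    using B sum_representation_eq[of B v B] by (simp add: algebra_basis_def)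
  then have "l v = l (\<Sum>b\<in>B. representation B v b *\<^sub>R b)" by simp
  also have "\<dots> = (\<Sum>b\<in>B. representation B v b * l b)"
    by (simp add: linear_sum[OF l] linear_scale[OF l])
  finally show ?thesis .
qed

lemma algebra_continuous_basisI:
  assumes B: "algebra_basis B"
    and c: "\<And>b. b \<in> B \<Longrightarrow> continuous_map Z euclideanreal (\<lambda>z. representation B (u z) b)"
  shows "algebra_continuous Z u"
  unfolding algebra_continuous_def
proof (intro allI impI)
  fix l :: "'b \<Rightarrow> real" assume l: "linear l"
  have "continuous_map Z euclideanreal (\<lambda>z. \<Sum>b\<in>B. representation B (u z) b * l b)"
    using B by (intro continuous_map_sum continuous_map_real_mult c) (auto simp: algebra_basis_def)
  then show "continuous_map Z euclideanreal (\<lambda>z. l (u z))"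
    by (rule continuous_map_eq) (rule linear_expand[OF B l, symmetric])
qed

lemma algebra_continuousD:
  "algebra_continuous Z u \<Longrightarrow> linear l \<Longrightarrow> continuous_map Z euclideanreal (\<lambda>z. l (u z))"
  by (simp add: algebra_continuous_def)

lemma algebra_continuous_const: "algebra_continuous Z (\<lambda>_. a)"
  by (simp add: algebra_continuous_def)

lemma algebra_continuous_sum:
  assumes "finite I" "\<And>i. i \<in> I \<Longrightarrow> algebra_continuous Z (u i)"
  shows "algebra_continuous Z (\<lambda>z. \<Sum>i\<in>I. u i z)"
  unfolding algebra_continuous_def
proof (intro allI impI)
  fix l :: "'b \<Rightarrow> real" assume l: "linear l"
  have "continuous_map Z euclideanreal (\<lambda>z. \<Sum>i\<in>I. l (u i z))"
    using assms by (intro continuous_map_sum algebra_continuousD[OF _ l]) auto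
  then show "continuous_map Z euclideanreal (\<lambda>z. l (\<Sum>i\<in>I. u i z))" by (simp add: linear_sum[OF l])
qed

lemma algebra_continuous_add:
  assumes "algebra_continuous Z u" "algebra_continuous Z v"
  shows "algebra_continuous Z (\<lambda>z. u z + v z)"
  using assms unfolding algebra_continuous_def by (auto simp: linear_add intro!: continuous_map_add)

lemma algebra_continuous_diff:
  assumes "algebra_continuous Z u" "algebra_continuous Z v"
  shows "algebra_continuous Z (\<lambda>z. u z - v z)"
  using assms unfolding algebra_continuous_def by (auto simp: linear_diff intro!: continuous_map_diff)

lemma algebra_continuous_scaleR:
  assumes "continuous_map Z euclideanreal c" "algebra_continuous Z u"
  shows "algebra_continuous Z (\<lambda>z. c z *\<^sub>R u z)"
  using assms unfolding algebra_continuous_def by (auto simp: linear_scale intro!: continuous_map_real_mult)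

lemma algebra_continuous_of_real:
  "continuous_map Z euclideanreal c \<Longrightarrow> algebra_continuous Z (\<lambda>z. of_real (c z))"
  using algebra_continuous_scaleR[OF _ algebra_continuous_const[of Z 1]] by (simp add: of_real_def)

lemma algebra_continuous_mult:
  assumes u: "algebra_continuous Z u" and v: "algebra_continuous Z v"
  shows "algebra_continuous Z (\<lambda>z. u z * v z)"
  unfolding algebra_continuous_def
proof (intro allI impI)
  fix l :: "'b \<Rightarrow> real" assume l: "linear l"
  obtain B :: "'b set" where B: "algebra_basis B" using algebra_basis_with_one by blast
  have "linear (\<lambda>a. l (a * c))" for c
    by (rule linearI) (simp_all add: distrib_right linear_add[OF l] linear_scale[OF l])
  then have expand: "l (a * c) = (\<Sum>b\<in>B. representation B a b * l (b * c))" for a c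
    by (rule linear_expand[OF B, of "\<lambda>a. l (a * c)"])
  have "continuous_map Z euclideanreal (\<lambda>z. \<Sum>b\<in>B. representation B (u z) b * l (b * v z))"
  proof (intro continuous_map_sum continuous_map_real_mult)
    show "continuous_map Z euclideanreal (\<lambda>z. representation B (u z) b)" for b
      by (rule algebra_continuousD[OF u linear_representation[OF B]])
    have "linear (\<lambda>a. l (b * a))" for b
      by (rule linearI) (simp_all add: distrib_left linear_add[OF l] linear_scale[OF l])
    then show "continuous_map Z euclideanreal (\<lambda>z. l (b * v z))" for b
      by (rule algebra_continuousD[OF v])
  qed (use B in \<open>simp add: algebra_basis_def\<close>)
  then show "continuous_map Z euclideanreal (\<lambda>z. l (u z * v z))"
    by (rule continuous_map_eq) (rule expand[symmetric])
qed

lemma algebra_continuous_compose: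
  assumes "algebra_continuous Z u" "continuous_map Y Z h"
  shows "algebra_continuous Y (\<lambda>y. u (h y))"
  using assms continuous_map_compose[OF assms(2)] unfolding algebra_continuous_def o_def by blast

lemma algebra_continuous_jet:
  assumes S: "openin (Euclidean_space m) S" and q: "continuous_map Z (Euclidean_space m) q"
    and qS: "\<And>z. z \<in> topspace Z \<Longrightarrow> q z \<in> S"
    and n: "\<And>i. i < m \<Longrightarrow> algebra_continuous Z (\<lambda>z. n z i)"
  shows "smooth_on m S f \<Longrightarrow> algebra_continuous Z (\<lambda>z. jet m (n z) j f (q z))"
proof (induction j arbitrary: f)
  case 0
  have "continuous_map (subtopology (Euclidean_space m) S) euclideanreal f"
    using smooth_on_imp_continuous_on[OF S 0] continuous_map_Euclidean_iff[OF S, of f] by blast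
  moreover have "continuous_map Z (subtopology (Euclidean_space m) S) q"
    by (rule continuous_map_into_subtopology[OF q]) (use qS in auto)
  ultimately have "continuous_map Z euclideanreal (\<lambda>z. f (q z))"
    using continuous_map_compose[of Z _ q euclideanreal f] by (simp add: o_def)
  then show ?case by (simp add: algebra_continuous_of_real)
next
  case (Suc j)
  have "algebra_continuous Z (\<lambda>z. jet m (n z) j (pd i f) (q z))" if "i < m" for i
    by (rule Suc.IH[OF smooth_on_pd(1)[OF S Suc.prems that]])
  then show ?case unfolding jet.simps
    by (intro algebra_continuous_scaleR algebra_continuous_sum algebra_continuous_mult n) auto
qed

end

context weil_bundle_loc
begin

abbreviation WT :: "(('a \<Rightarrow> real) \<Rightarrow> 'b) topology" where "WT \<equiv> weil_topology m M \<C> N"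

definition over :: "'a set \<Rightarrow> (('a \<Rightarrow> real) \<Rightarrow> 'b) set" where
  "over U = {\<xi> \<in> WB. proj \<xi> \<in> U}"

lemma over_WB: "over U \<subseteq> WB" by (auto simp: over_def)

lemma overD:
  assumes "\<xi> \<in> over U" shows "proj \<xi> \<in> U" "\<xi> \<in> fibre (proj \<xi>)" "\<xi> \<in> WB"
  using assms WB_D by (auto simp: over_def)

lemma weil_coords_PiE: "weil_coords m M \<C> N B \<phi> \<xi> \<in> PiE ({..<m} \<times> B) (\<lambda>_. UNIV)"
  by (auto simp: weil_coords_def)

lemma openin_WT_basic:
  assumes "(U, \<phi>) \<in> \<C>" "algebra_basis B" "1 \<in> B"
    "openin (product_topology (\<lambda>_. euclideanreal) ({..<m} \<times> B)) V"
  shows "openin WT {\<xi> \<in> over U. weil_coords m M \<C> N B \<phi> \<xi> \<in> V}"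
proof -
  have "{\<xi> \<in> over U. weil_coords m M \<C> N B \<phi> \<xi> \<in> V} =
     {\<xi> \<in> WB. proj \<xi> \<in> U \<and> weil_coords m M \<C> N B \<phi> \<xi> \<in> V}" by (auto simp: over_def)
  then show ?thesis unfolding weil_topology_def
    by (intro topology_generated_by_Basis) (use assms in blast)
qed

lemma openin_over:
  assumes c: "(U, \<phi>) \<in> \<C>" shows "openin WT (over U)"
proof -
  obtain B :: "'b set" where B: "algebra_basis B" "1 \<in> B" by (rule algebra_basis_with_one)
  have "openin WT {\<xi> \<in> over U. weil_coords m M \<C> N B \<phi> \<xi> \<in> topspace (product_topology (\<lambda>_. euclideanreal) ({..<m} \<times> B))}"
    by (rule openin_WT_basic[OF c B]) (rule openin_topspace)
  moreover have "{\<xi> \<in> over U. weil_coords m M \<C> N B \<phi> \<xi> \<in> topspace (product_topology (\<lambda>_. euclideanreal) ({..<m} \<times> B))} = over U"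
    using weil_coords_PiE by auto
  ultimately show ?thesis by simp
qed

lemma topspace_WT: "topspace WT = WB"
proof
  show "topspace WT \<subseteq> WB" unfolding weil_topology_def topology_generated_by_topspace by auto
  show "WB \<subseteq> topspace WT"
  proof
    fix \<xi> assume \<xi>: "\<xi> \<in> WB"
    obtain U \<phi> where c: "(U, \<phi>) \<in> \<C>" "proj \<xi> \<in> U" using chart_at[OF WB_D(1)[OF \<xi>]] .
    then have "\<xi> \<in> over U" using \<xi> by (simp add: over_def)
    then show "\<xi> \<in> topspace WT" using openin_subset[OF openin_over[OF c(1)]] by blast
  qed
qed

lemma topspace_over: "topspace (subtopology WT (over U)) = over U"
  using over_WB by (auto simp: topspace_WT)

lemma evl_algebra_continuous:
  assumes c: "(U, \<phi>) \<in> \<C>" and i: "i < m"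
  shows "algebra_continuous (subtopology WT (over U)) (\<lambda>\<xi>. evl \<xi> (\<lambda>z. \<phi> z i))"
proof -
  obtain B :: "'b set" where B: "algebra_basis B" "1 \<in> B" by (rule algebra_basis_with_one)
  let ?P = "product_topology (\<lambda>_. euclideanreal) ({..<m} \<times> B)"
  have coords: "continuous_map (subtopology WT (over U)) ?P (weil_coords m M \<C> N B \<phi>)"
    unfolding continuous_map_def
  proof (intro conjI allI impI)
    show "weil_coords m M \<C> N B \<phi> \<in> topspace (subtopology WT (over U)) \<rightarrow> topspace ?P"
      using weil_coords_PiE by auto
    fix V assume V: "openin ?P V"
    have "openin WT {\<xi> \<in> over U. weil_coords m M \<C> N B \<phi> \<xi> \<in> V}"
      by (rule openin_WT_basic[OF c B V])
    then show "openin (subtopology WT (over U)) {\<xi> \<in> topspace (subtopology WT (over U)). weil_coords m M \<C> N B \<phi> \<xi> \<in> V}"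
      unfolding topspace_over using openin_over[OF c] by (auto simp: openin_open_subtopology)
  qed
  show ?thesis
  proof (rule algebra_continuous_basisI[OF B(1)])
    fix b assume b: "b \<in> B"
    have "continuous_map ?P euclideanreal (\<lambda>x. x (i, b))"
      by (rule continuous_map_product_projection) (use i b in auto)
    from continuous_map_compose[OF coords this]
    show "continuous_map (subtopology WT (over U)) euclideanreal (\<lambda>\<xi>. representation B (evl \<xi> (\<lambda>z. \<phi> z i)) b)"
      using i b by (simp add: o_def weil_coords_def)
  qed
qed

text \<open>
  The coordinates of the base point are the real parts of \<open>\<xi>(\<phi>\<^sub>i)\<close>, hence linear in the coordinates of
  \<open>\<xi>\<close>.
\<close>
lemma proj_continuous: "continuous_map WT M proj"
proof (rule continuous_map_locally)
  fix \<xi> assume "\<xi> \<in> topspace WT"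
  then have \<xi>: "\<xi> \<in> WB" by (simp add: topspace_WT)
  obtain U \<phi> where c: "(U, \<phi>) \<in> \<C>" "proj \<xi> \<in> U" using chart_at[OF WB_D(1)[OF \<xi>]] .
  let ?X = "subtopology WT (over U)"
  let ?r = "\<lambda>\<eta> i. if i < m then real_part N (evl \<eta> (\<lambda>z. \<phi> z i)) else 0"
  have r: "?r \<eta> = \<phi> (proj \<eta>)" if "\<eta> \<in> over U" for \<eta>
  proof
    fix i
    note h = overD[OF that]
    show "?r \<eta> i = \<phi> (proj \<eta>) i"
      using real_part_eqI[OF evl_chart_in_N[OF c(1) h(1,2), of i]] chart_model[OF c(1) h(1)]
      by (simp add: model_space_iff)
  qed
  have "continuous_map ?X (Euclidean_space m) ?r"
    unfolding continuous_map_componentwise_Euclidean_space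
    using algebra_continuousD[OF evl_algebra_continuous[OF c(1)] linear_real_part] by blast
  then have "continuous_map ?X (subtopology (Euclidean_space m) (\<phi> ` U)) ?r"
  proof (rule continuous_map_into_subtopology)
    show "?r \<in> topspace ?X \<rightarrow> \<phi> ` U"
    proof
      fix \<eta> assume "\<eta> \<in> topspace ?X"
      then have \<eta>: "\<eta> \<in> over U" by (simp only: topspace_over)
      show "?r \<eta> \<in> \<phi> ` U" unfolding r[OF \<eta>] using overD(1)[OF \<eta>] by (rule imageI)
    qed
  qed
  from continuous_map_compose[OF this chart_inv_continuous[OF c(1)]]
  have "continuous_map ?X M (\<lambda>\<eta>. inv_into U \<phi> (?r \<eta>))" unfolding o_def .
  then have "continuous_map ?X M proj"
  proof (rule continuous_map_eq)
    fix \<eta> assume "\<eta> \<in> topspace ?X"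
    then have "\<eta> \<in> over U" by (simp only: topspace_over)
    then show "inv_into U \<phi> (?r \<eta>) = proj \<eta>" unfolding r[OF \<open>\<eta> \<in> over U\<close>]
      by (rule chart_inv[OF c(1) overD(1)])
  qed
  then show "\<exists>T. openin WT T \<and> \<xi> \<in> T \<and> continuous_map (subtopology WT T) M proj"
    using openin_over[OF c(1)] c(2) \<xi> by (intro exI[of _ "over U"]) (auto simp: over_def)
qed

lemma jet_point_over:
  assumes c: "(U, \<phi>) \<in> \<C>" and y: "y \<in> U" and n: "\<And>i. i < m \<Longrightarrow> n i \<in> N"
  shows "jet_point U \<phi> n y \<in> WB" "proj (jet_point U \<phi> n y) = y"
proof -
  have "jet_point U \<phi> n y \<in> fibre y" by (rule jet_point_in_fibre[OF c y]) (rule n)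
  moreover have "y \<in> topspace M" using y chart_subset[OF c] by blast
  ultimately show "jet_point U \<phi> n y \<in> WB" "proj (jet_point U \<phi> n y) = y"
    by (auto intro: in_WB proj_eq)
qed

text \<open>
  Every generating open set comes from some chart \<open>\<psi>\<close>. In the coordinates of \<open>\<psi>\<close> the map consists of jets
  of the transition map, whose coefficients are smooth functions of the base point.
\<close>
lemma jet_point_continuous:
  assumes c: "(U, \<phi>) \<in> \<C>" and y: "continuous_map Z M y" and yU: "\<And>z. z \<in> topspace Z \<Longrightarrow> y z \<in> U"
    and n: "\<And>i. i < m \<Longrightarrow> algebra_continuous Z (\<lambda>z. n z i)"
    and nN: "\<And>z i. z \<in> topspace Z \<Longrightarrow> i < m \<Longrightarrow> n z i \<in> N"
  shows "continuous_map Z WT (\<lambda>z. jet_point U \<phi> (n z) (y z))"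
proof -
  let ?T = "\<lambda>z. jet_point U \<phi> (n z) (y z)"
  have T: "?T z \<in> WB" "proj (?T z) = y z" if "z \<in> topspace Z" for z
    using jet_point_over[OF c yU[OF that], of "n z"] nN[OF that] by auto
  have "openin Z {z \<in> topspace Z. y z \<in> V \<and> weil_coords m M \<C> N B \<psi> (?T z) \<in> O'}"
    if d: "(V, \<psi>) \<in> \<C>" and B: "algebra_basis B" and O': "openin (product_topology (\<lambda>_. euclideanreal) ({..<m} \<times> B)) O'"
    for V \<psi> B O'
  proof -
    let ?P = "product_topology (\<lambda>_. euclideanreal) ({..<m} \<times> B)"
    let ?Z = "{z \<in> topspace Z. y z \<in> V}"
    have Z: "openin Z ?Z" using openin_continuous_map_preimage[OF y chart(1)[OF d]] .
    let ?X = "subtopology Z ?Z"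
    have tX: "topspace ?X = ?Z" by auto
    let ?S = "\<phi> ` (U \<inter> V)"
    have S: "openin (Euclidean_space m) ?S"
      by (rule chart_image_open[OF c]) (use chart(1)[OF c] chart(1)[OF d] in auto)
    have "continuous_map ?X (subtopology M U) y"
      by (intro continuous_map_into_subtopology continuous_map_from_subtopology y) (use yU in auto)
    from continuous_map_compose[OF this chart_continuous[OF c]]
    have q: "continuous_map ?X (Euclidean_space m) (\<lambda>z. \<phi> (y z))" unfolding o_def .
    have qS: "\<phi> (y z) \<in> ?S" if "z \<in> topspace ?X" for z using that yU by auto
    have n': "algebra_continuous ?X (\<lambda>z. n z i)" if "i < m" for i
      using algebra_continuous_compose[OF n[OF that] continuous_map_from_subtopology[OF continuous_map_id]]
      by (simp add: id_def)
    have "continuous_map ?X ?P (\<lambda>z. weil_coords m M \<C> N B \<psi> (?T z))"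
      unfolding continuous_map_componentwise
    proof (intro conjI ballI)
      show "(\<lambda>z. weil_coords m M \<C> N B \<psi> (?T z)) ` topspace ?X \<subseteq> extensional ({..<m} \<times> B)"
        by (auto simp: weil_coords_def)
      fix k assume "k \<in> {..<m} \<times> B"
      then obtain i b where k: "k = (i, b)" and i: "i < m" and b: "b \<in> B" by auto
      have "smoothly_compatible m (U, \<phi>) (V, \<psi>)"
        using manifold c d unfolding smooth_manifold_def by blast
      then have sm: "smooth_on m ?S (\<lambda>p. \<psi> (inv_into U \<phi> p) i)"
        using i by (simp add: smoothly_compatible_def)
      have "algebra_continuous ?X (\<lambda>z. \<Sum>k\<le>height. jet m (n z) k (\<lambda>p. \<psi> (inv_into U \<phi> p) i) (\<phi> (y z)))"
        by (intro algebra_continuous_sum algebra_continuous_jet[OF S q qS n' sm]) auto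
      from algebra_continuousD[OF this linear_representation[OF B]]
      show "continuous_map ?X euclideanreal (\<lambda>z. weil_coords m M \<C> N B \<psi> (?T z) k)"
      proof (rule continuous_map_eq)
        fix z assume "z \<in> topspace ?X"
        then have z: "z \<in> topspace Z" "y z \<in> V" by auto
        have "evl (?T z) (\<lambda>x. \<psi> x i) = (\<Sum>k\<le>height. jet m (n z) k (\<lambda>p. \<psi> (inv_into U \<phi> p) i) (\<phi> (y z)))"
          by (rule evl_jet_point[OF c d yU[OF z(1)] z(2)]) (rule nN[OF z(1)])
        then show "representation B (\<Sum>k\<le>height. jet m (n z) k (\<lambda>p. \<psi> (inv_into U \<phi> p) i) (\<phi> (y z))) b
           = weil_coords m M \<C> N B \<psi> (?T z) k"
          using i b by (simp add: weil_coords_def k)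
      qed
    qed
    from openin_continuous_map_preimage[OF this O']
    have "openin Z {z \<in> ?Z. weil_coords m M \<C> N B \<psi> (?T z) \<in> O'}"
      unfolding tX using Z openin_trans_full by blast
    moreover have "{z \<in> ?Z. weil_coords m M \<C> N B \<psi> (?T z) \<in> O'} =
       {z \<in> topspace Z. y z \<in> V \<and> weil_coords m M \<C> N B \<psi> (?T z) \<in> O'}" by auto
    ultimately show ?thesis by simp
  qed
  note pre = this
  show ?thesis unfolding weil_topology_def
  proof (rule continuous_on_generated_topo)
    fix G assume "G \<in> {{\<xi> \<in> WB. proj \<xi> \<in> U \<and> weil_coords m M \<C> N B \<phi> \<xi> \<in> V} |U \<phi> B V.
        (U, \<phi>) \<in> \<C> \<and> algebra_basis B \<and> 1 \<in> B \<and> openin (product_topology (\<lambda>_. euclideanreal) ({..<m} \<times> B)) V}"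
    then obtain V \<psi> B O' where G: "G = {\<xi> \<in> WB. proj \<xi> \<in> V \<and> weil_coords m M \<C> N B \<psi> \<xi> \<in> O'}"
      "(V, \<psi>) \<in> \<C>" "algebra_basis B" "openin (product_topology (\<lambda>_. euclideanreal) ({..<m} \<times> B)) O'" by blast
    have "?T -` G \<inter> topspace Z = {z \<in> topspace Z. y z \<in> V \<and> weil_coords m M \<C> N B \<psi> (?T z) \<in> O'}"
      unfolding G(1) using T by auto
    then show "openin Z (?T -` G \<inter> topspace Z)" using pre[OF G(2-4)] by simp
  next
    have "?T ` topspace Z \<subseteq> topspace WT" using T(1) topspace_WT by auto
    then show "?T ` topspace Z \<subseteq> \<Union>{{\<xi> \<in> WB. proj \<xi> \<in> U \<and> weil_coords m M \<C> N B \<phi> \<xi> \<in> V} |U \<phi> B V.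
        (U, \<phi>) \<in> \<C> \<and> algebra_basis B \<and> 1 \<in> B \<and> openin (product_topology (\<lambda>_. euclideanreal) ({..<m} \<times> B)) V}"
      unfolding weil_topology_def topology_generated_by_topspace .
  qed
qed

text \<open>
  In every chart this is the section with displacement zero; the formula is independent of charts,
  which makes the section global.
\<close>
definition zero_section :: "'a \<Rightarrow> ('a \<Rightarrow> real) \<Rightarrow> 'b" where
  "zero_section y = (\<lambda>f\<in>SF. of_real (f y))"

lemma zero_section_eq:
  assumes c: "(U, \<phi>) \<in> \<C>" and y: "y \<in> U"
  shows "zero_section y = jet_point U \<phi> (\<lambda>_. 0) y"
proof
  fix f
  show "zero_section y f = jet_point U \<phi> (\<lambda>_. 0) y f"
    by (simp add: zero_section_def jet_point_def jet_no_displacement chart_inv[OF c y] del: jet.simps)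
qed

definition displacement :: "('a \<Rightarrow> nat \<Rightarrow> real) \<Rightarrow> (('a \<Rightarrow> real) \<Rightarrow> 'b) \<Rightarrow> nat \<Rightarrow> 'b" where
  "displacement \<phi> \<xi> i = evl \<xi> (\<lambda>z. \<phi> z i) - of_real (\<phi> (proj \<xi>) i)"

lemma displacement_in_N: "(U, \<phi>) \<in> \<C> \<Longrightarrow> \<xi> \<in> over U \<Longrightarrow> displacement \<phi> \<xi> i \<in> N"
  unfolding displacement_def by (rule evl_chart_in_N) (auto dest: overD)

lemma jet_point_displacement:
  assumes c: "(U, \<phi>) \<in> \<C>" and \<xi>: "\<xi> \<in> over U"
  shows "jet_point U \<phi> (displacement \<phi> \<xi>) (proj \<xi>) = \<xi>"
proof (rule fibre_eqI[OF c overD(1)[OF \<xi>] _ overD(2)[OF \<xi>]])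
  show "jet_point U \<phi> (displacement \<phi> \<xi>) (proj \<xi>) \<in> fibre (proj \<xi>)"
    by (rule jet_point_in_fibre[OF c overD(1)[OF \<xi>] displacement_in_N[OF c \<xi>]])
  show "evl (jet_point U \<phi> (displacement \<phi> \<xi>) (proj \<xi>)) (\<lambda>z. \<phi> z i) = evl \<xi> (\<lambda>z. \<phi> z i)" if "i < m" for i
    by (subst evl_jet_point_same[OF c overD(1)[OF \<xi>] displacement_in_N[OF c \<xi>] that])
       (simp add: displacement_def)
qed

lemma displacement_continuous:
  assumes c: "(U, \<phi>) \<in> \<C>" and i: "i < m"
  shows "algebra_continuous (subtopology WT (over U)) (\<lambda>\<xi>. displacement \<phi> \<xi> i)"
  unfolding displacement_def
proof (intro algebra_continuous_diff algebra_continuous_of_real evl_algebra_continuous[OF c i])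
  have "continuous_map (subtopology WT (over U)) (subtopology M U) proj"
    by (intro continuous_map_into_subtopology continuous_map_from_subtopology proj_continuous)
       (auto simp only: topspace_over overD(1))
  from continuous_map_compose[OF this chart_continuous[OF c]]
  have "continuous_map (subtopology WT (over U)) (Euclidean_space m) (\<lambda>\<xi>. \<phi> (proj \<xi>))" unfolding o_def .
  then show "continuous_map (subtopology WT (over U)) euclideanreal (\<lambda>\<xi>. \<phi> (proj \<xi>) i)"
    unfolding Euclidean_space_def by (simp add: continuous_map_in_subtopology continuous_map_componentwise_UNIV)
qed

definition interpolate :: "'a set \<Rightarrow> ('a \<Rightarrow> nat \<Rightarrow> real) \<Rightarrow> real \<Rightarrow> (('a \<Rightarrow> real) \<Rightarrow> 'b) \<Rightarrow> (('a \<Rightarrow> real) \<Rightarrow> 'b) \<Rightarrow> ('a \<Rightarrow> real) \<Rightarrow> 'b" where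
  "interpolate U \<phi> t \<xi> \<eta> =
     jet_point U \<phi> (\<lambda>i. (1 - t) *\<^sub>R displacement \<phi> \<xi> i + t *\<^sub>R displacement \<phi> \<eta> i) (proj \<xi>)"

lemma fibre_interpolation_interpolate:
  assumes c: "(U, \<phi>) \<in> \<C>"
  shows "fibre_interpolation WT proj U (interpolate U \<phi>)"
  unfolding fibre_interpolation_def
proof (intro conjI ballI impI)
  let ?I = "top_of_set {0..1::real}"
  let ?D = "{(t, \<xi>, \<eta>). proj \<xi> \<in> U \<and> proj \<eta> = proj \<xi>} :: (real \<times> (('a \<Rightarrow> real) \<Rightarrow> 'b) \<times> (('a \<Rightarrow> real) \<Rightarrow> 'b)) set"
  let ?Z = "subtopology (prod_topology ?I (prod_topology WT WT)) ?D"
  have Zt: "z \<in> topspace ?Z \<Longrightarrow> fst (snd z) \<in> over U \<and> snd (snd z) \<in> over U" for z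
    by (auto simp: topspace_WT over_def)
  have p1: "continuous_map ?Z WT (\<lambda>z. fst (snd z))" and p2: "continuous_map ?Z WT (\<lambda>z. snd (snd z))"
    using continuous_map_compose[OF continuous_map_snd continuous_map_fst]
      continuous_map_compose[OF continuous_map_snd continuous_map_snd]
    by (auto simp: o_def intro!: continuous_map_from_subtopology)
  have q1: "continuous_map ?Z (subtopology WT (over U)) (\<lambda>z. fst (snd z))"
    and q2: "continuous_map ?Z (subtopology WT (over U)) (\<lambda>z. snd (snd z))"
    by (rule continuous_map_into_subtopology, rule p1 p2, use Zt in blast)+
  have t: "continuous_map ?Z euclideanreal fst"
    using continuous_map_fst[of ?I "prod_topology WT WT"]
    by (auto simp: continuous_map_in_subtopology intro: continuous_map_from_subtopology)
  have one_t: "continuous_map ?Z euclideanreal (\<lambda>z. 1 - fst z)"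
    by (intro continuous_map_diff t) simp
  have "continuous_map ?Z WT (\<lambda>z. jet_point U \<phi>
     (\<lambda>i. (1 - fst z) *\<^sub>R displacement \<phi> (fst (snd z)) i + fst z *\<^sub>R displacement \<phi> (snd (snd z)) i) (proj (fst (snd z))))"
  proof (rule jet_point_continuous[OF c])
    show "continuous_map ?Z M (\<lambda>z. proj (fst (snd z)))"
      using continuous_map_compose[OF p1 proj_continuous] by (simp add: o_def)
    show "proj (fst (snd z)) \<in> U" if "z \<in> topspace ?Z" for z using Zt[OF that] overD(1) by blast
    show "algebra_continuous ?Z (\<lambda>z. (1 - fst z) *\<^sub>R displacement \<phi> (fst (snd z)) i + fst z *\<^sub>R displacement \<phi> (snd (snd z)) i)"
      if "i < m" for i
      by (intro algebra_continuous_add algebra_continuous_scaleR t one_t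
          algebra_continuous_compose[OF displacement_continuous[OF c that] q1]
          algebra_continuous_compose[OF displacement_continuous[OF c that] q2])
    show "(1 - fst z) *\<^sub>R displacement \<phi> (fst (snd z)) i + fst z *\<^sub>R displacement \<phi> (snd (snd z)) i \<in> N"
      if "z \<in> topspace ?Z" for z i
      using Zt[OF that] displacement_in_N[OF c] by (intro subspace_add subspace_scale N_subspace) auto
  qed
  then show "continuous_map ?Z WT (\<lambda>(t, \<xi>, \<eta>). interpolate U \<phi> t \<xi> \<eta>)"
    by (simp add: interpolate_def case_prod_unfold)
  fix \<xi> \<eta> assume "\<xi> \<in> topspace WT" "\<eta> \<in> topspace WT" "proj \<xi> \<in> U" and eq: "proj \<eta> = proj \<xi>"
  then have over: "\<xi> \<in> over U" "\<eta> \<in> over U" by (auto simp: topspace_WT over_def)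
  show "interpolate U \<phi> 0 \<xi> \<eta> = \<xi>" using jet_point_displacement[OF c over(1)] by (simp add: interpolate_def)
  show "interpolate U \<phi> 1 \<xi> \<eta> = \<eta>" using jet_point_displacement[OF c over(2)] by (simp add: interpolate_def eq)
  fix t :: real
  show "interpolate U \<phi> t \<xi> \<xi> = \<xi>"
    using jet_point_displacement[OF c over(1)] by (simp add: interpolate_def flip: scaleR_left_distrib)
  show "proj (interpolate U \<phi> t \<xi> \<eta>) = proj \<xi>" unfolding interpolate_def
    by (rule jet_point_over(2)[OF c \<open>proj \<xi> \<in> U\<close>])
       (intro subspace_add subspace_scale N_subspace displacement_in_N[OF c] over)
qed

lemma locally_affine: "locally_affine_projection WT M proj zero_section"
proof
  show "continuous_map WT M proj" by (rule proj_continuous)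
  show "continuous_map M WT zero_section"
  proof (rule continuous_map_locally)
    fix y assume "y \<in> topspace M"
    then obtain U \<phi> where c: "(U, \<phi>) \<in> \<C>" "y \<in> U" by (rule chart_at)
    have tU: "topspace (subtopology M U) = U" using chart_subset[OF c(1)] by auto
    have "continuous_map (subtopology M U) WT (\<lambda>y. jet_point U \<phi> (\<lambda>_. 0) y)"
      by (rule jet_point_continuous[OF c(1)])
         (auto intro: continuous_map_from_subtopology algebra_continuous_const subspace_0[OF N_subspace])
    then have "continuous_map (subtopology M U) WT zero_section"
      by (rule continuous_map_eq) (simp only: tU zero_section_eq[OF c(1)])
    then show "\<exists>T. openin M T \<and> y \<in> T \<and> continuous_map (subtopology M T) WT zero_section"
      using c chart(1) by blast
  qed
  show "proj (zero_section y) = y" if y: "y \<in> topspace M" for y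
  proof -
    obtain U \<phi> where c: "(U, \<phi>) \<in> \<C>" "y \<in> U" using y by (rule chart_at)
    show ?thesis unfolding zero_section_eq[OF c]
      by (rule jet_point_over(2)[OF c]) (rule subspace_0[OF N_subspace])
  qed
  fix \<xi> assume "\<xi> \<in> topspace WT"
  then have \<xi>: "\<xi> \<in> WB" by (simp add: topspace_WT)
  obtain U \<phi> where c: "(U, \<phi>) \<in> \<C>" "proj \<xi> \<in> U" using chart_at[OF WB_D(1)[OF \<xi>]] .
  have over: "\<xi> \<in> over U" using \<xi> c by (simp add: over_def)
  let ?\<sigma> = "jet_point U \<phi> (displacement \<phi> \<xi>)"
  have "continuous_map (subtopology M U) WT ?\<sigma>"
    by (rule jet_point_continuous[OF c(1)])
       (auto intro: continuous_map_from_subtopology algebra_continuous_const displacement_in_N[OF c(1) over])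
  moreover have "\<forall>y\<in>U. proj (?\<sigma> y) = y"
    by (intro ballI jet_point_over(2)[OF c(1)] displacement_in_N[OF c(1) over])
  ultimately show "\<exists>U J \<sigma>. openin M U \<and> proj \<xi> \<in> U \<and> fibre_interpolation WT proj U J \<and>
         continuous_map (subtopology M U) WT \<sigma> \<and> \<sigma> (proj \<xi>) = \<xi> \<and> (\<forall>y\<in>U. proj (\<sigma> y) = y)"
    using chart(1)[OF c(1)] c(2) fibre_interpolation_interpolate[OF c(1)] jet_point_displacement[OF c(1) over] by blast
qed

end

theorem theorem5p2:
  fixes m :: nat and M :: "'a topology" and \<C> :: "'a chart set"
    and N :: "'b::{comm_ring_1,real_algebra_1} set"
  assumes "smooth_manifold m M \<C>"
    and "weil_algebra N"
  shows "(\<exists>h. bij_betw h (path_components_of (weil_topology m M \<C> N)) (path_components_of M)) \<and>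
    (\<forall>k\<ge>1. \<forall>\<xi>\<in>weil_bundle m M \<C> N.
       homotopy_group k (weil_topology m M \<C> N) \<xi> \<cong> homotopy_group k M (weil_proj m M \<C> N \<xi>))"
proof -
  interpret weil_bundle_loc m M \<C> N
    by unfold_locales (rule assms)+
  interpret locally_affine_projection WT M proj zero_section by (rule locally_affine)
  show ?thesis using path_components_bij homotopy_group_iso by (simp add: topspace_WT)
qed

end
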